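(* Assume that the Kac–Moody matrix of the root generating system $\mathcal S$ is of size $2$. Let $\tau\in T_{\mathbb C}$. Then $I_\tau$ is irreducible (as a ${}^{BL}\mathcal H_{\mathbb C}$-module) if and only if $\tau\in\mathcal U_{\mathbb C}$ and $W_\tau=W_{(\tau)}$.
   Context: Let $\mathcal S=(A,X,Y,(\alpha_i)_{i\in I},(\alpha_i^\vee)_{i\in I})$ be a root generating system: $A=(a_{i,j})$ is a Kac–Moody matrix (finite index set $I$, integer entries, $a_{i,i}=2$, $a_{i,j}\le 0$ for $i\ne j$, $a_{i,j}=0\iff a_{j,i}=0$), $X,Y$ are dual free $\mathbb Z$-modules of finite rank, $(\alpha_i)$ and $(\alpha_i^\vee)$ are free families in $X$ and $Y$ with $\alpha_j(\alpha_i^\vee)=a_{i,j}$. Put $\mathbb A=Y\otimes\mathbb R$, $r_i(v)=v-\alpha_i(v)\alpha_i^\vee$, $\mathscr S=\{r_i\}$, $W^v=\langle\mathscr S\rangle\subset GL(\mathbb A)$ (Coxeter group with length $\ell$); for $s=r_i$ write $\alpha_s=\alpha_i$, $\alpha_s^\vee=\alpha_i^\vee$. $\Phi^\vee=\{w.\alpha_s^\vee\mid w\in W^v,s\in\mathscr S\}$; for $\alpha^\vee=w.\alpha_s^\vee$, $r_{\alpha^\vee}=wsw^{-1}$. $(\sigma_s)_{s\in\mathscr S},(\sigma'_s)_{s\in\mathscr S}$ are families in $\mathbb C^*$ such that $\sigma_s=\sigma'_s$ if $\alpha_s(Y)=\mathbb Z$, and $\sigma_s=\sigma_t=\sigma'_s=\sigma'_t$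 for $s\ne t$ with $st$ of finite odd order. Standing assumptions: $\sigma'_s\notin\{\sigma_s^{-1},-\sigma_s,-\sigma_s^{-1}\}$ and $|\sigma_s|>1$ for all $s\in\mathscr S$. ${}^{BL}\mathcal H_{\mathbb C}$ is the $\mathbb C$-vector space with basis $(Z^\lambda H_w)_{\lambda\in Y,w\in W^v}$ ($Z^\lambda=Z^\lambda H_1$, $H_w=Z^0H_w$) with the unique associative product such that $Z^\lambda*H_w=Z^\lambda H_w$; $Z^\lambda*Z^\mu=Z^{\lambda+\mu}$; $H_s*H_w=H_{sw}$ if $\ell(sw)=\ell(w)+1$ and $H_s*H_w=(\sigma_s-\sigma_s^{-1})H_w+H_{sw}$ if $\ell(sw)=\ell(w)-1$; and $H_s*Z^\lambda-Z^{s.\lambda}*H_s=Q_s(Z)(Z^\lambda-Z^{s.\lambda})$ with $Q_s(Z)=\frac{(\sigma_s-\sigma_s^{-1})+(\sigma_s'-\sigma_s'^{-1})Z^{-\alpha_s^\vee}}{1-Z^{-2\alpha_s^\vee}}$. $\mathbb C[Y]=\bigoplus_\lambda\mathbb CZ^\lambda$, with fraction field $\mathbb C(Y)$; $W^v$ acts on both by $(Z^\lambda)^w=Z^{w.\lambda}$. $T_{\mathbb C}=\mathrm{Hom}_{\mathrm{Gr}}(Y,\mathbb C^* )$, with $(w.\tau)(\lambda)=\tau(w^{-1}.\lambda)$; $\tau$ is extended to an algebra morphism $\mathbb C[Y]\to\mathbb C$; $I_\tau={}^{BL}\mathcal H_{\mathbb C}\otimes_{\mathbb C[Y]}\mathbb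 C$, $\mathbb C[Y]$ acting on $\mathbb C$ via $\tau$. $W_\tau=\{w\in W^v\mid w.\tau=\tau\}$. For $s\in\mathscr S$, $\zeta_s=-\sigma_sQ_s(Z)+\sigma_s^2\in\mathbb C(Y)$; for $\alpha^\vee=w.\alpha_s^\vee\in\Phi^\vee$, $\zeta_{\alpha^\vee}=(\zeta_s)^w$ (well defined). Write $\zeta_{\alpha^\vee}=\zeta^{\mathrm{num}}_{\alpha^\vee}/\zeta^{\mathrm{den}}_{\alpha^\vee}$ with coprime $\zeta^{\mathrm{num}}_{\alpha^\vee},\zeta^{\mathrm{den}}_{\alpha^\vee}$ in the UFD $\mathbb C[Y]$. $\mathcal U_{\mathbb C}=\{\tau\in T_{\mathbb C}\mid\tau(\zeta^{\mathrm{num}}_{\alpha^\vee})\ne0\ \forall\alpha^\vee\in\Phi^\vee\}$, and $W_{(\tau)}=\langle r_{\alpha^\vee}\mid\alpha^\vee\in\Phi^\vee,\ \tau(\zeta^{\mathrm{den}}_{\alpha^\vee})=0\rangle\subset W_\tau$. (If $\sigma_s=\sigma'_s=\sqrt q$ for all $s$, these conditions read $\tau(\alpha^\vee)\neq q$, respectively $\tau(\alpha^\vee)=1$.) *)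

theory Defs
  imports
    "HOL-Computational_Algebra.Polynomial_Factorial"
    "HOL-Algebra.Bij"
    "HOL-Algebra.Generated_Groups"
    "HOL-Algebra.Multiplicative_Group"
    "HOL-Algebra.Free_Abelian_Groups"
begin

section \<open>Free abelian groups of finite rank\<close>

definition (in ab_group_add) zscale :: "int \<Rightarrow> 'a \<Rightarrow> 'a" where
  "zscale k x = (\<Sum>_<nat k. x) - (\<Sum>_<nat (- k). x)"

class finite_free_ab_group = ab_group_add +
  assumes ex_finite_basis:
    "\<exists>B. finite B \<and> (\<forall>x. \<exists>!c. (\<forall>b. b \<notin> B \<longrightarrow> c b = 0) \<and> x = (\<Sum>b\<in>B. zscale (c b) b))"

definition free_family :: "('i::finite \<Rightarrow> 'a::ab_group_add) \<Rightarrow> bool" where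
  "free_family f \<longleftrightarrow> (\<forall>c. (\<Sum>i\<in>UNIV. zscale (c i) (f i)) = 0 \<longrightarrow> (\<forall>i. c i = 0))"

lemma zscale_diff: "zscale (int m - int n) x = (\<Sum>_<m. x) - (\<Sum>_<n. x)"
  for x :: "'a::ab_group_add"
proof -
  have add: "(\<Sum>_<p + q. x) = (\<Sum>_<p. x) + (\<Sum>_<q. x)" for p q :: nat
    by (induction q) (simp_all add: algebra_simps)
  show ?thesis
  proof (cases "m \<le> n")
    case True
    then obtain k where "n = m + k" using le_Suc_ex by blast
    then show ?thesis by (simp add: zscale_def add)
  next
    case False
    then obtain k where "m = n + k" using le_Suc_ex nat_le_linear by blast
    then show ?thesis by (simp add: zscale_def add)
  qed
qed

lemma zscale_add_left: "zscale (a + b) x = zscale a x + zscale b x"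
  for x :: "'a::ab_group_add"
proof -
  have add: "(\<Sum>_<p + q. x) = (\<Sum>_<p. x) + (\<Sum>_<q. x)" for p q :: nat
    by (induction q) (simp_all add: algebra_simps)
  obtain m n where a: "a = int m - int n" by (rule int_diff_cases)
  obtain m' n' where b: "b = int m' - int n'" by (rule int_diff_cases)
  have "a + b = int (m + m') - int (n + n')" using a b by simp
  then have "zscale (a + b) x = (\<Sum>_<m + m'. x) - (\<Sum>_<n + n'. x)"
    by (simp only: zscale_diff)
  then show ?thesis
    by (simp add: add a b zscale_diff)
qed

lemma (in finite_free_ab_group) ex_coords:
  "\<exists>B c. finite B \<and> (\<forall>x. (\<forall>b. b \<notin> B \<longrightarrow> c x b = 0) \<and> x = (\<Sum>b\<in>B. zscale (c x b) b)) \<and>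
     (\<forall>x d. (\<forall>b. b \<notin> B \<longrightarrow> d b = 0) \<and> x = (\<Sum>b\<in>B. zscale (d b) b) \<longrightarrow> d = c x)"
proof -
  obtain B where B: "finite B"
    "\<forall>x. \<exists>!c. (\<forall>b. b \<notin> B \<longrightarrow> c b = 0) \<and> x = (\<Sum>b\<in>B. zscale (c b) b)"
    using ex_finite_basis by blast
  define P where "P x c \<longleftrightarrow> (\<forall>b. b \<notin> B \<longrightarrow> c b = 0) \<and> x = (\<Sum>b\<in>B. zscale (c b) b)" for x c
  have P: "\<exists>!c. P x c" for x using B(2) by (simp add: P_def)
  define c where "c x = (THE d. P x d)" for x
  have c: "P x (c x)" for x unfolding c_def using theI'[OF P[of x]] .
  have "d = c x" if "P x d" for x d using P[of x] c[of x] that by blast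
  then show ?thesis using B(1) c unfolding P_def by blast
qed

lemma ex_inj_additive:
  "\<exists>f :: 'a::finite_free_ab_group \<Rightarrow> nat \<Rightarrow>\<^sub>0 int. inj f \<and> f 0 = 0 \<and> (\<forall>x y. f (x + y) = f x + f y)"
proof -
  obtain B :: "'a set" and c where Bc: "finite B \<and>
      (\<forall>x. (\<forall>b. b \<notin> B \<longrightarrow> c x b = 0) \<and> x = (\<Sum>b\<in>B. zscale (c x b) b)) \<and>
      (\<forall>x d. (\<forall>b. b \<notin> B \<longrightarrow> d b = 0) \<and> x = (\<Sum>b\<in>B. zscale (d b) b) \<longrightarrow> d = c x)"
    using ex_coords[where 'a = 'a] by (elim exE)
  have B: "finite B" using Bc by (rule conjunct1)
  have c0: "c x b = 0" if "b \<notin> B" for x b using Bc that by blast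
  have c: "x = (\<Sum>b\<in>B. zscale (c x b) b)" for x using Bc by blast
  have uniq: "d = c x" if "\<And>b. b \<notin> B \<Longrightarrow> d b = 0" "x = (\<Sum>b\<in>B. zscale (d b) b)" for x d
    using Bc[THEN conjunct2, THEN conjunct2, rule_format, of d x] that by blast
  have c_add: "c (x + y) = (\<lambda>b. c x b + c y b)" for x y
  proof (rule sym, rule uniq)
    show "x + y = (\<Sum>b\<in>B. zscale (c x b + c y b) b)"
      unfolding zscale_add_left sum.distrib using c[of x] c[of y] by (rule arg_cong2[where f = "(+)"])
  qed (simp add: c0)
  have c_zero: "c 0 b = 0" for b
  proof -
    have "c 0 b = c 0 b + c 0 b"
      using fun_cong[OF c_add[of 0 0], of b] by (simp only: add_0_left)
    then show ?thesis by linarith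
  qed
  obtain e :: "'a \<Rightarrow> nat" where e: "inj_on e B"
    using finite_imp_inj_to_nat_seg[OF B] by blast
  define f where "f x = (\<Sum>b\<in>B. Poly_Mapping.single (e b) (c x b))" for x
  have look: "Poly_Mapping.lookup (f x) (e b) = c x b" if "b \<in> B" for x b
  proof -
    have "Poly_Mapping.lookup (f x) (e b) = (\<Sum>b'\<in>B. if b' = b then c x b' else 0)"
      unfolding f_def lookup_sum
      by (rule sum.cong) (use e that in \<open>auto simp: lookup_single when_def inj_on_def\<close>)
    then show ?thesis using B that by simp
  qed
  have "inj f"
  proof (rule injI)
    fix x y assume "f x = f y"
    then have "c x b = c y b" for b using look c0 by (cases "b \<in> B") metis+
    then have "c x = c y" by blast
    then have "(\<Sum>b\<in>B. zscale (c x b) b) = (\<Sum>b\<in>B. zscale (c y b) b)" by (simp only:)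
    then show "x = y" by (simp only: c[symmetric])
  qed
  moreover have "f 0 = 0" by (simp add: f_def c_zero)
  moreover have "f (x + y) = f x + f y" for x y
    by (simp add: f_def c_add single_add sum.distrib)
  ultimately show ?thesis by blast
qed


section \<open>The group algebra \<open>\<complex>[Y]\<close> and its fraction field\<close>

text \<open>
  A copy of \<^typ>\<open>'y \<Rightarrow>\<^sub>0 complex\<close>: the library makes the latter an integral domain
  only for linearly ordered exponents, whereas the fraction field is needed here for every free
  abelian group of finite rank.
\<close>

typedef (overloaded) 'y group_algebra = "UNIV :: ('y \<Rightarrow>\<^sub>0 complex) set"
  morphisms coeffs Group_Algebra by simp

setup_lifting type_definition_group_algebra

lift_definition coeff_at :: "'y group_algebra \<Rightarrow> 'y \<Rightarrow> complex" is Poly_Mapping.lookup .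

lift_definition support :: "'y group_algebra \<Rightarrow> 'y set" is Poly_Mapping.keys .

lift_definition monomial :: "complex \<Rightarrow> 'y \<Rightarrow> 'y group_algebra" is "\<lambda>c \<mu>. Poly_Mapping.single \<mu> c" .

instantiation group_algebra :: (comm_monoid_add) comm_ring_1
begin
lift_definition zero_group_algebra :: "'a group_algebra" is 0 .
lift_definition one_group_algebra :: "'a group_algebra" is 1 .
lift_definition plus_group_algebra :: "'a group_algebra \<Rightarrow> 'a group_algebra \<Rightarrow> 'a group_algebra" is "(+)" .
lift_definition minus_group_algebra :: "'a group_algebra \<Rightarrow> 'a group_algebra \<Rightarrow> 'a group_algebra" is "(-)" .
lift_definition uminus_group_algebra :: "'a group_algebra \<Rightarrow> 'a group_algebra" is "uminus" .
lift_definition times_group_algebra :: "'a group_algebra \<Rightarrow> 'a group_algebra \<Rightarrow> 'a group_algebra" is "(*)" .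
instance
  by standard (transfer; simp add: algebra_simps)+
end

lemma poly_mapping_no_zero_divisors:
  fixes p q :: "'y::finite_free_ab_group \<Rightarrow>\<^sub>0 complex"
  assumes "p * q = 0"
  shows "p = 0 \<or> q = 0"
proof -
  obtain f :: "'y \<Rightarrow> nat \<Rightarrow>\<^sub>0 int" where f: "inj f" "f 0 = 0" "\<And>x y. f (x + y) = f x + f y"
    using ex_inj_additive by blast
  define F :: "('y \<Rightarrow>\<^sub>0 complex) \<Rightarrow> (nat \<Rightarrow>\<^sub>0 int) \<Rightarrow>\<^sub>0 complex"
    where "F p = (\<Sum>k\<in>Poly_Mapping.keys p. Poly_Mapping.single (f k) (Poly_Mapping.lookup p k))" for p
  have F_sup: "F p = (\<Sum>k\<in>K. Poly_Mapping.single (f k) (Poly_Mapping.lookup p k))"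
    if "finite K" "Poly_Mapping.keys p \<subseteq> K" for p K
    unfolding F_def by (rule sum.mono_neutral_left) (use that in \<open>auto simp: in_keys_iff\<close>)
  have F_add: "F (p + q) = F p + F q" for p q
  proof -
    let ?K = "Poly_Mapping.keys p \<union> Poly_Mapping.keys q"
    have "F (p + q) = (\<Sum>k\<in>?K. Poly_Mapping.single (f k) (Poly_Mapping.lookup (p + q) k))"
      by (rule F_sup) (auto dest: set_mp[OF Poly_Mapping.keys_add])
    also have "\<dots> = F p + F q"
      by (simp add: lookup_add single_add sum.distrib F_sup[of ?K])
    finally show ?thesis .
  qed
  have F_0: "F 0 = 0" by (simp add: F_def)
  have F_sum: "F (sum g A) = (\<Sum>a\<in>A. F (g a))" if "finite A" for g :: "'b \<Rightarrow> _" and A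
    using that by (induction A) (simp_all add: F_add F_0)
  have F_single: "F (Poly_Mapping.single k c) = Poly_Mapping.single (f k) c" for k c
    by (simp add: F_def)
  have expand: "p = (\<Sum>k\<in>Poly_Mapping.keys p. Poly_Mapping.single k (Poly_Mapping.lookup p k))"
    for p :: "'y \<Rightarrow>\<^sub>0 complex"
  proof (rule poly_mapping_eqI)
    fix k
    show "Poly_Mapping.lookup p k = Poly_Mapping.lookup (\<Sum>k\<in>Poly_Mapping.keys p. Poly_Mapping.single k (Poly_Mapping.lookup p k)) k"
      by (simp add: lookup_sum lookup_single when_def in_keys_iff)
  qed
  have F_mult: "F (p * q) = F p * F q"
  proof -
    have "F (p * q) = F ((\<Sum>k\<in>Poly_Mapping.keys p. Poly_Mapping.single k (Poly_Mapping.lookup p k)) *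
        (\<Sum>k\<in>Poly_Mapping.keys q. Poly_Mapping.single k (Poly_Mapping.lookup q k)))"
      by (simp only: expand[symmetric])
    also have "\<dots> = F p * F q"
      by (simp add: sum_product mult_single F_sum F_single f(3)) (simp add: F_def sum_product mult_single)
    finally show ?thesis .
  qed
  have F_inj: "r = 0" if "F r = 0" for r
  proof (rule poly_mapping_eqI)
    fix k
    have "Poly_Mapping.lookup (F r) (f k) = (\<Sum>k'\<in>insert k (Poly_Mapping.keys r). if k' = k then Poly_Mapping.lookup r k' else 0)"
      by (subst F_sup[of "insert k (Poly_Mapping.keys r)"])
         (auto simp: lookup_sum lookup_single when_def inj_eq[OF f(1)] intro!: sum.cong)
    also have "\<dots> = Poly_Mapping.lookup r k" by simp
    finally show "Poly_Mapping.lookup r k = Poly_Mapping.lookup 0 k" using that by simp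
  qed
  have "F p * F q = 0" using assms F_mult F_0 by metis
  then show ?thesis using F_inj by auto
qed

instantiation group_algebra :: (finite_free_ab_group) idom_divide
begin
definition divide_group_algebra :: "'a group_algebra \<Rightarrow> 'a group_algebra \<Rightarrow> 'a group_algebra" where
  "divide_group_algebra a b = (if b = 0 then 0 else (SOME c. a = c * b))"
instance
proof
  have nz: "a * b \<noteq> 0" if "a \<noteq> 0" "b \<noteq> 0" for a b :: "'a group_algebra"
    using that by transfer (use poly_mapping_no_zero_divisors in blast)
  show "a * b \<noteq> 0" if "a \<noteq> 0" "b \<noteq> 0" for a b :: "'a group_algebra"
    using nz that by blast
  show "a * b div b = a" if "b \<noteq> 0" for a b :: "'a group_algebra"
  proof -
    have "a * b = (SOME c. a * b = c * b) * b" by (rule someI[of _ a]) simp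
    then have "(a - (SOME c. a * b = c * b)) * b = 0" by (simp add: left_diff_distrib)
    then have "a - (SOME c. a * b = c * b) = 0" using nz that by blast
    then show ?thesis using that by (simp add: divide_group_algebra_def)
  qed
  show "a div 0 = 0" for a :: "'a group_algebra"
    by (simp add: divide_group_algebra_def)
qed
end

instance group_algebra :: (finite_free_ab_group) algebraic_semidom ..

definition act_algebra :: "('y \<Rightarrow> 'y) \<Rightarrow> 'y group_algebra \<Rightarrow> 'y::finite_free_ab_group group_algebra" where
  "act_algebra w p = (\<Sum>\<mu>\<in>support p. monomial (coeff_at p \<mu>) (w \<mu>))"

definition act_fract ::
  "('y \<Rightarrow> 'y) \<Rightarrow> 'y::finite_free_ab_group group_algebra fract \<Rightarrow> 'y group_algebra fract" where
  "act_fract w z =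
     (THE z'. \<exists>p q. q \<noteq> 0 \<and> z = Fract p q \<and> z' = Fract (act_algebra w p) (act_algebra w q))"

definition const_fract :: "complex \<Rightarrow> 'y::finite_free_ab_group group_algebra fract" where
  "const_fract c = to_fract (monomial c 0)"

definition Z_fract :: "'y \<Rightarrow> 'y::finite_free_ab_group group_algebra fract" where
  "Z_fract \<mu> = to_fract (monomial 1 \<mu>)"

text \<open>The torus \<open>T\<close> of complex characters of \<open>Y\<close>, and the extension of a character to \<open>\<complex>[Y]\<close>.\<close>

definition torus :: "('y::finite_free_ab_group \<Rightarrow> complex) set" where
  "torus = {\<tau>. (\<forall>\<mu> \<nu>. \<tau> (\<mu> + \<nu>) = \<tau> \<mu> * \<tau> \<nu>) \<and> (\<forall>\<mu>. \<tau> \<mu> \<noteq> 0)}"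

definition ev :: "('y \<Rightarrow> complex) \<Rightarrow> 'y group_algebra \<Rightarrow> complex" where
  "ev \<tau> p = (\<Sum>\<mu>\<in>support p. coeff_at p \<mu> * \<tau> \<mu>)"


section \<open>Tensor products and irreducible modules\<close>

text \<open>
  The tensor product over a ring \<open>'r\<close> of the right module \<open>'m\<close> (action \<open>ract\<close>) and the left
  module \<open>'n\<close> (action \<open>lact\<close>): the free abelian group on \<open>'m \<times> 'n\<close> modulo the biadditivity and
  balancing relations.
\<close>

definition tensor_relations ::
  "('m::ab_group_add \<Rightarrow> 'r \<Rightarrow> 'm) \<Rightarrow> ('r \<Rightarrow> 'n::ab_group_add \<Rightarrow> 'n) \<Rightarrow> ('m \<times> 'n \<Rightarrow>\<^sub>0 int) set" where
  "tensor_relations ract lact = generate (free_Abelian_group UNIV)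
     ({frag_of (x + x', y) - frag_of (x, y) - frag_of (x', y) | x x' y. True} \<union>
      {frag_of (x, y + y') - frag_of (x, y) - frag_of (x, y') | x y y'. True} \<union>
      {frag_of (ract x r, y) - frag_of (x, lact r y) | x r y. True})"

definition tensor_product ::
  "('m::ab_group_add \<Rightarrow> 'r \<Rightarrow> 'm) \<Rightarrow> ('r \<Rightarrow> 'n::ab_group_add \<Rightarrow> 'n) \<Rightarrow> ('m \<times> 'n \<Rightarrow>\<^sub>0 int) set monoid" where
  "tensor_product ract lact = free_Abelian_group UNIV Mod tensor_relations ract lact"

text \<open>The left action \<open>a (x \<otimes> y) = (a x) \<otimes> y\<close> when \<open>'m\<close> is itself a ring; tensors are cosets.\<close>

definition tensor_act ::
  "('m::ring_1 \<Rightarrow> 'r \<Rightarrow> 'm) \<Rightarrow> ('r \<Rightarrow> 'n::ab_group_add \<Rightarrow> 'n) \<Rightarrow>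
   'm \<Rightarrow> ('m \<times> 'n \<Rightarrow>\<^sub>0 int) set \<Rightarrow> ('m \<times> 'n \<Rightarrow>\<^sub>0 int) set" where
  "tensor_act ract lact a t =
     (\<Union>u\<in>t. tensor_relations ract lact #>\<^bsub>free_Abelian_group UNIV\<^esub>
        frag_extend (\<lambda>(x, y). frag_of (a * x, y)) u)"

text \<open>
  The module is an abelian group \<open>M\<close> (in the multiplicative notation of HOL-Algebra) with an
  action of the ring \<open>'r\<close>.
\<close>

definition submodule_of :: "('m, 'b) monoid_scheme \<Rightarrow> ('r::ring_1 \<Rightarrow> 'm \<Rightarrow> 'm) \<Rightarrow> 'm set \<Rightarrow> bool" where
  "submodule_of M act N \<longleftrightarrow> subgroup N M \<and> (\<forall>a. \<forall>x\<in>N. act a x \<in> N)"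

definition irreducible_module :: "('m, 'b) monoid_scheme \<Rightarrow> ('r::ring_1 \<Rightarrow> 'm \<Rightarrow> 'm) \<Rightarrow> bool" where
  "irreducible_module M act \<longleftrightarrow>
     carrier M \<noteq> {one M} \<and> (\<forall>N. submodule_of M act N \<longrightarrow> N = {one M} \<or> N = carrier M)"


section \<open>Root generating systems\<close>

locale root_generating_system =
  fixes A :: "'i::finite \<Rightarrow> 'i \<Rightarrow> int"
    and pairing :: "'x::finite_free_ab_group \<Rightarrow> 'y::finite_free_ab_group \<Rightarrow> int"
    and \<alpha> :: "'i \<Rightarrow> 'x"
    and \<alpha>v :: "'i \<Rightarrow> 'y"
  assumes A_diag: "A i i = 2"
    and A_off_diag: "i \<noteq> j \<Longrightarrow> A i j \<le> 0"
    and A_zero_iff: "A i j = 0 \<longleftrightarrow> A j i = 0"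
    and pairing_add_left: "pairing (x + x') y = pairing x y + pairing x' y"
    and pairing_add_right: "pairing x (y + y') = pairing x y + pairing x y'"
    and pairing_perfect_left: "Modules.additive f \<Longrightarrow> \<exists>!x. pairing x = f"
    and pairing_perfect_right: "Modules.additive g \<Longrightarrow> \<exists>!y. (\<lambda>x. pairing x y) = g"
    and roots_free: "free_family \<alpha>"
    and coroots_free: "free_family \<alpha>v"
    and pairing_roots: "pairing (\<alpha> j) (\<alpha>v i) = A i j"
begin

text \<open>
  The Weyl group is taken as a group of automorphisms of the lattice \<open>Y\<close>. Since \<open>Y\<close> spans
  \<open>Y \<otimes> \<real>\<close> and is stable under the reflections, restriction to \<open>Y\<close> identifies it with the
  subgroup of \<open>GL(Y \<otimes> \<real>)\<close> generated by the simple reflections. Moreover \<open>i \<mapsto> refl i\<close> is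
  injective because the simple coroots are free, so families indexed by the simple
  reflections are indexed by \<open>'i\<close>.
\<close>

definition refl :: "'i \<Rightarrow> 'y \<Rightarrow> 'y" where
  "refl i v = v - zscale (pairing (\<alpha> i) v) (\<alpha>v i)"

definition W :: "('y \<Rightarrow> 'y) set" where
  "W = generate (BijGroup UNIV) (range refl)"

definition len :: "('y \<Rightarrow> 'y) \<Rightarrow> nat" where
  "len w = (LEAST n. \<exists>is. length is = n \<and> w = foldr (\<circ>) (map refl is) id)"

definition coroots :: "'y set" where
  "coroots = {w (\<alpha>v i) | w i. w \<in> W}"

definition coroot_refl :: "'y \<Rightarrow> 'y \<Rightarrow> 'y" where
  "coroot_refl \<beta> = (THE r. \<exists>w\<in>W. \<exists>i. \<beta> = w (\<alpha>v i) \<and> r = w \<circ> refl i \<circ> inv_into UNIV w)"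

definition torus_act :: "('y \<Rightarrow> 'y) \<Rightarrow> ('y \<Rightarrow> complex) \<Rightarrow> 'y \<Rightarrow> complex" where
  "torus_act w \<tau> \<mu> = \<tau> (inv_into UNIV w \<mu>)"

definition W_stab :: "('y \<Rightarrow> complex) \<Rightarrow> ('y \<Rightarrow> 'y) set" where
  "W_stab \<tau> = {w \<in> W. torus_act w \<tau> = \<tau>}"

end


section \<open>Parameters, \<open>\<zeta>\<close> and the subsets of the torus\<close>

locale hecke_parameters = root_generating_system A pairing \<alpha> \<alpha>v
  for A :: "'i::finite \<Rightarrow> 'i \<Rightarrow> int"
    and pairing :: "'x::finite_free_ab_group \<Rightarrow> 'y::finite_free_ab_group \<Rightarrow> int"
    and \<alpha> :: "'i \<Rightarrow> 'x"
    and \<alpha>v :: "'i \<Rightarrow> 'y" +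
  fixes \<sigma> \<sigma>' :: "'i \<Rightarrow> complex"
  assumes \<sigma>_nonzero: "\<sigma> i \<noteq> 0"
    and \<sigma>'_nonzero: "\<sigma>' i \<noteq> 0"
    and \<sigma>_eq_\<sigma>': "range (pairing (\<alpha> i)) = UNIV \<Longrightarrow> \<sigma> i = \<sigma>' i"
    and \<sigma>_odd_order: "i \<noteq> j \<Longrightarrow> odd (group.ord (BijGroup UNIV) (refl i \<circ> refl j)) \<Longrightarrow>
          \<sigma> i = \<sigma> j \<and> \<sigma> i = \<sigma>' i \<and> \<sigma> i = \<sigma>' j" \<comment> \<open>\<^const>\<open>group.ord\<close> is 0 for infinite order\<close>
    and \<sigma>'_generic: "\<sigma>' i \<notin> {inverse (\<sigma> i), - \<sigma> i, - inverse (\<sigma> i)}"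
    and \<sigma>_norm: "norm (\<sigma> i) > 1"
begin

definition Q :: "'i \<Rightarrow> 'y group_algebra fract" where
  "Q i = (const_fract (\<sigma> i - inverse (\<sigma> i)) + const_fract (\<sigma>' i - inverse (\<sigma>' i)) * Z_fract (- \<alpha>v i)) /
         (1 - Z_fract (zscale (- 2) (\<alpha>v i)))"

definition \<zeta>_simple :: "'i \<Rightarrow> 'y group_algebra fract" where
  "\<zeta>_simple i = - const_fract (\<sigma> i) * Q i + const_fract ((\<sigma> i)\<^sup>2)"

definition \<zeta> :: "'y \<Rightarrow> 'y group_algebra fract" where
  "\<zeta> \<beta> = (THE z. \<exists>w\<in>W. \<exists>i. \<beta> = w (\<alpha>v i) \<and> z = act_fract w (\<zeta>_simple i))"

text \<open>A choice of coprime numerator and denominator; it is unique up to units of \<open>\<complex>[Y]\<close>.\<close>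

definition \<zeta>_num_den :: "'y \<Rightarrow> 'y group_algebra \<times> 'y group_algebra" where
  "\<zeta>_num_den \<beta> = (SOME (n, d). d \<noteq> 0 \<and> coprime n d \<and> \<zeta> \<beta> = Fract n d)"

definition \<zeta>_num :: "'y \<Rightarrow> 'y group_algebra" where
  "\<zeta>_num \<beta> = fst (\<zeta>_num_den \<beta>)"

definition \<zeta>_den :: "'y \<Rightarrow> 'y group_algebra" where
  "\<zeta>_den \<beta> = snd (\<zeta>_num_den \<beta>)"

definition U_set :: "('y \<Rightarrow> complex) set" where
  "U_set = {\<tau> \<in> torus. \<forall>\<beta>\<in>coroots. ev \<tau> (\<zeta>_num \<beta>) \<noteq> 0}"

definition W_paren :: "('y \<Rightarrow> complex) \<Rightarrow> ('y \<Rightarrow> 'y) set" where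
  "W_paren \<tau> = generate (BijGroup UNIV) (coroot_refl ` {\<beta> \<in> coroots. ev \<tau> (\<zeta>_den \<beta>) = 0})"

end


section \<open>The Bernstein--Lusztig--Hecke algebra\<close>

text \<open>
  The algebra is an arbitrary unital associative \<open>\<complex>\<close>-algebra, on the type \<open>'h\<close> with scalar
  multiplication \<open>scl\<close>, in which the vectors \<open>ZH \<mu> w\<close>, for \<open>w \<in> W\<close>, form a basis and the defining
  relations hold. These relations determine the product, so the locale pins the algebra down up
  to isomorphism.
\<close>

definition evaluate :: "(complex \<Rightarrow> 'h \<Rightarrow> 'h) \<Rightarrow> ('y \<Rightarrow> 'h) \<Rightarrow> 'y group_algebra \<Rightarrow> 'h::comm_monoid_add" where
  "evaluate scl Z p = (\<Sum>\<mu>\<in>support p. scl (coeff_at p \<mu>) (Z \<mu>))"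

locale BL_Hecke_algebra = hecke_parameters A pairing \<alpha> \<alpha>v \<sigma> \<sigma>' + Vector_Spaces.vector_space scl
  for A :: "'i::finite \<Rightarrow> 'i \<Rightarrow> int"
    and pairing :: "'x::finite_free_ab_group \<Rightarrow> 'y::finite_free_ab_group \<Rightarrow> int"
    and \<alpha> :: "'i \<Rightarrow> 'x"
    and \<alpha>v :: "'i \<Rightarrow> 'y"
    and \<sigma> \<sigma>' :: "'i \<Rightarrow> complex"
    and scl :: "complex \<Rightarrow> 'h::ring_1 \<Rightarrow> 'h" +
  fixes ZH :: "'y \<Rightarrow> ('y \<Rightarrow> 'y) \<Rightarrow> 'h"
  assumes scl_mult_left: "scl c x * y = scl c (x * y)"
    and scl_mult_right: "x * scl c y = scl c (x * y)"
    and basis_inj: "inj_on (case_prod ZH) (UNIV \<times> W)"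
    and basis_independent: "independent ((case_prod ZH) ` (UNIV \<times> W))"
    and basis_span: "span ((case_prod ZH) ` (UNIV \<times> W)) = UNIV"
    and Z_mult_H: "w \<in> W \<Longrightarrow> ZH \<mu> id * ZH 0 w = ZH \<mu> w"
    and Z_mult_Z: "ZH \<mu> id * ZH \<nu> id = ZH (\<mu> + \<nu>) id"
    and H_mult_H_up: "w \<in> W \<Longrightarrow> len (refl i \<circ> w) = len w + 1 \<Longrightarrow>
          ZH 0 (refl i) * ZH 0 w = ZH 0 (refl i \<circ> w)"
    and H_mult_H_down: "w \<in> W \<Longrightarrow> int (len (refl i \<circ> w)) = int (len w) - 1 \<Longrightarrow>
          ZH 0 (refl i) * ZH 0 w = scl (\<sigma> i - inverse (\<sigma> i)) (ZH 0 w) + ZH 0 (refl i \<circ> w)"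
    and Bernstein_Lusztig: "\<exists>p. to_fract p = Q i * (Z_fract \<mu> - Z_fract (refl i \<mu>)) \<and>
          ZH 0 (refl i) * ZH \<mu> id - ZH (refl i \<mu>) id * ZH 0 (refl i) =
            evaluate scl (\<lambda>\<nu>. ZH \<nu> id) p"
begin

definition of_algebra :: "'y group_algebra \<Rightarrow> 'h" where
  "of_algebra p = evaluate scl (\<lambda>\<nu>. ZH \<nu> id) p"

definition I_carrier :: "('y \<Rightarrow> complex) \<Rightarrow> ('h \<times> complex \<Rightarrow>\<^sub>0 int) set monoid" where
  "I_carrier \<tau> = tensor_product (\<lambda>h p. h * of_algebra p) (\<lambda>p c. ev \<tau> p * c)"

definition I_act :: "('y \<Rightarrow> complex) \<Rightarrow> 'h \<Rightarrow> ('h \<times> complex \<Rightarrow>\<^sub>0 int) set \<Rightarrow> ('h \<times> complex \<Rightarrow>\<^sub>0 int) set" where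
  "I_act \<tau> = tensor_act (\<lambda>h p. h * of_algebra p) (\<lambda>p c. ev \<tau> p * c)"

end

end

theory Submission
  imports Defs "HOL-Analysis.Continuum_Not_Denumerable"
    "HOL-Computational_Algebra.Fundamental_Theorem_Algebra"
begin

text \<open>
  The module \<open>I\<^sub>\<tau>\<close> is the quotient of the algebra by a left ideal, so that it is irreducible iff this
  ideal is maximal. The intertwiner of a simple reflection exchanges weights and squares to a
  product of two numerators. If a numerator vanishes on the orbit of \<open>\<tau>\<close>, an intertwiner with
  nonzero image is not invertible; if \<open>w\<close> fixes \<open>\<tau>\<close> without lying in the group generated by the
  reflections with vanishing denominator, intertwiners produce a second vector of weight \<open>\<tau>\<close>,
  against Schur's lemma.

  Conversely, let \<open>P\<close> be the set of walls of the dihedral Coxeter complex at which the denominator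
  vanishes. Products of intertwiners, regularised at the walls in \<open>P\<close>, along the galleries from the
  fundamental chamber form a basis on which \<open>\<complex>[Y]\<close> acts triangularly with respect to the number of
  walls in \<open>P\<close> that are crossed. The subleading coefficients of this action are roots. A weight
  vector of weight \<open>\<tau>\<close> with a top coefficient off the fundamental chamber would give a linear relation
  between at most two nonproportional roots, so all such weight vectors are scalars. The invertible
  intertwiners bring a weight vector from every nonzero submodule to the weight \<open>\<tau>\<close>.
\<close>

section \<open>Integer multiples in lattices\<close>

text \<open>Rank two enters twice. The Weyl group is dihedral, so that chambers are integers and
  folding a gallery at the wall \<open>k\<close> sends its end \<open>n\<close> to
  \<open>2 * k - 1 - n\<close>; a finite group is handled as a periodic quotient of this picture.
  Moreover, among the chambers of weight \<tau>, the number of crossed walls of \<open>P\<close>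
  leaves at most one on each side of the fundamental chamber. This is why the final relation has at
  most two terms. That two different reflections have nonproportional roots rests on the freeness of
  both roots and coroots. The obstacle is a character at which a denominator vanishes: there the
  intertwiner \<open>Fop i\<close> only multiplies weight vectors by a scalar and reaches nothing
  new. \<open>Kop i\<close> does produce a new vector, at the price that it is no longer a weight
  vector. The roots in the triangular action arise in this way.\<close>

lemma zscale_0 [simp]: "zscale 0 x = 0" for x :: "'a::ab_group_add"
  by (simp add: zscale_def)

lemma zscale_1 [simp]: "zscale 1 x = x" for x :: "'a::ab_group_add"
  by (simp add: zscale_def)

lemma zscale_hom:
  fixes f :: "'a::ab_group_add \<Rightarrow> 'b::ab_group_add"
  assumes "\<And>x y. f (x + y) = f x + f y"
  shows "f (zscale k x) = zscale k (f x)"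
proof (induction k rule: int_induct[where k = 0])
  case base
  have "f 0 + f 0 = f 0 + 0" by (metis assms add_0_right)
  then show ?case by simp
next
  case (step1 i)
  then show ?case by (simp add: zscale_add_left assms)
next
  case (step2 i)
  have "zscale i x = zscale (i - 1) x + x" "zscale i (f x) = zscale (i - 1) (f x) + f x"
    by (simp_all flip: zscale_add_left[of "i - 1" 1, simplified])
  then show ?case using step2 assms by (metis add_right_cancel)
qed

lemma zscale_right_add: "zscale k (x + y) = zscale k x + zscale k y" for x :: "'a::ab_group_add"
proof (induction k rule: int_induct[where k = 0])
  case (step2 i)
  have "zscale i z = zscale (i - 1) z + z" for z :: 'a
    by (simp flip: zscale_add_left[of "i - 1" 1, simplified])
  then have "zscale (i - 1) z = zscale i z - z" for z :: 'a by (simp add: algebra_simps)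
  then show ?case using step2 by simp
qed (simp_all add: zscale_add_left)

lemma zscale_mult: "zscale k (zscale l x) = zscale (k * l) x" for x :: "'a::ab_group_add"
proof -
  have "zscale k (zscale l x) = zscale l (zscale k x)"
    by (rule zscale_hom) (rule zscale_right_add)
  show ?thesis
  proof (induction k rule: int_induct[where k = 0])
    case (step2 i)
    have "zscale i z = zscale (i - 1) z + z" for z :: 'a
      by (simp flip: zscale_add_left[of "i - 1" 1, simplified])
    then have "zscale (i - 1) z = zscale i z - z" for z :: 'a by (simp add: algebra_simps)
    moreover have "zscale (i * l) x = zscale ((i - 1) * l) x + zscale l x"
      by (simp flip: zscale_add_left add: algebra_simps)
    ultimately show ?case using step2 by simp
  qed (simp_all add: zscale_add_left distrib_right)
qed

global_interpretation zmod: Modules.module "zscale :: int \<Rightarrow> 'a \<Rightarrow> 'a::ab_group_add"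
  by unfold_locales (simp_all add: zscale_right_add zscale_add_left zscale_mult)

lemma zscale_int [simp]: "zscale k (n :: int) = k * n"
  using zscale_hom[of "\<lambda>k. k * n" k 1] by (induction k rule: int_induct[where k = 0])
    (simp_all add: zmod.scale_left_distrib zmod.scale_left_diff_distrib algebra_simps)

text \<open>Torsion-freeness, inherited from the additive embedding into integer-valued
  functions.\<close>

lemma zscale_eq_0_iff [simp]: "zscale k x = 0 \<longleftrightarrow> k = 0 \<or> x = 0"
  for x :: "'a::finite_free_ab_group"
proof
  assume eq: "zscale k x = 0"
  obtain f :: "'a \<Rightarrow> nat \<Rightarrow>\<^sub>0 int" where f: "inj f" "f 0 = 0" "\<And>x y. f (x + y) = f x + f y"
    using ex_inj_additive by blast
  have *: "k * Poly_Mapping.lookup (f x) i = 0" for i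
  proof -
    have "zscale k (Poly_Mapping.lookup (f x) i) = Poly_Mapping.lookup (f (zscale k x)) i"
      by (rule zscale_hom[symmetric]) (simp add: f lookup_add)
    then show ?thesis using eq f(2) by simp
  qed
  show "k = 0 \<or> x = 0"
  proof (rule ccontr)
    assume nz: "\<not> (k = 0 \<or> x = 0)"
    then have "Poly_Mapping.lookup (f x) i = Poly_Mapping.lookup (f 0) i" for i
      using * f(2) by simp
    then have "f x = f 0" by (rule poly_mapping_eqI)
    then show False using f(1) nz by (auto dest: injD)
  qed
qed auto

lemma zscale_cancel_left: "k \<noteq> 0 \<Longrightarrow> zscale k x = zscale k y \<longleftrightarrow> x = y"
  for x :: "'a::finite_free_ab_group"
  using zscale_eq_0_iff[of k "x - y"] by (simp add: zmod.scale_right_diff_distrib)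


section \<open>The Weyl group of a root generating system\<close>

context root_generating_system
begin

lemma pairing_0 [simp]: "pairing x 0 = 0" "pairing 0 y = 0"
  using pairing_add_right[of x 0 0] pairing_add_left[of 0 0 y] by simp_all

lemma pairing_zscale [simp]:
  "pairing x (zscale k y) = k * pairing x y" "pairing (zscale k x) y = k * pairing x y"
  using zscale_hom[of "pairing x" k y, OF pairing_add_right]
    zscale_hom[of "\<lambda>x. pairing x y" k x, OF pairing_add_left] by simp_all

lemma pairing_minus [simp]: "pairing x (- y) = - pairing x y" "pairing (- x) y = - pairing x y"
  using pairing_zscale(1)[of x "-1" y] pairing_zscale(2)[of "-1" x y] by simp_all

lemma pairing_diff: "pairing x (y - y') = pairing x y - pairing x y'"
    "pairing (x - x') y = pairing x y - pairing x' y"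
  using pairing_add_right[of x y "- y'"] pairing_add_left[of x "- x'" y] by simp_all

lemma pairing_eqI: "(\<And>y. pairing x y = pairing x' y) \<Longrightarrow> x = x'"
proof -
  assume "\<And>y. pairing x y = pairing x' y"
  then have "pairing x = pairing x'" by blast
  moreover have "Modules.additive (pairing x)"
    by (simp add: Modules.additive_def pairing_add_right)
  ultimately show ?thesis using pairing_perfect_left by metis
qed

lemma pairing_root [simp]: "pairing (\<alpha> i) (\<alpha>v i) = 2"
  by (simp add: pairing_roots A_diag)

lemma free_familyD:
  fixes f :: "'i \<Rightarrow> 'a::ab_group_add"
  assumes f: "free_family f" and ij: "i \<noteq> j" and eq: "zscale k (f i) + zscale l (f j) = 0"
  shows "k = 0" "l = 0"
proof -
  let ?c = "\<lambda>x. if x = i then k else if x = j then l else 0"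
  have "(\<Sum>x\<in>UNIV. zscale (?c x) (f x)) = (\<Sum>x\<in>{i, j}. zscale (?c x) (f x))"
    by (rule sum.mono_neutral_right) auto
  also have "\<dots> = 0" using ij eq by simp
  finally have "\<forall>x. ?c x = 0" using f unfolding free_family_def by (elim allE[of _ ?c]) simp
  from this[rule_format, of i] this[rule_format, of j] show "k = 0" "l = 0" using ij by auto
qed

lemma coroot_nonzero [simp]: "\<alpha>v i \<noteq> 0"
  using pairing_root[of i] by (metis pairing_0(1) zero_neq_numeral)

lemma refl_add: "refl i (x + y) = refl i x + refl i y"
  by (simp add: refl_def pairing_add_right zmod.scale_left_distrib)

lemma refl_refl [simp]: "refl i (refl i x) = x"
  by (simp add: refl_def pairing_diff zmod.scale_left_distrib zmod.scale_left_diff_distrib)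

lemma refl_comp_refl [simp]: "refl i \<circ> refl i = id" "refl i \<circ> (refl i \<circ> w) = w"
  by (simp_all add: fun_eq_iff)

lemma refl_coroot [simp]: "refl i (\<alpha>v i) = - \<alpha>v i"
proof -
  have "zscale 2 (\<alpha>v i) = \<alpha>v i + \<alpha>v i" using zscale_add_left[of 1 1 "\<alpha>v i"] by simp
  then show ?thesis by (simp add: refl_def)
qed

lemma pairing_refl [simp]: "pairing (\<alpha> i) (refl i x) = - pairing (\<alpha> i) x"
  by (simp add: refl_def pairing_diff)

lemma bij_refl: "bij (refl i)"
  by (rule o_bij[of "refl i"]) (simp_all add: fun_eq_iff)

lemma carrier_BijGroup [simp]: "carrier (BijGroup UNIV) = {f. bij f}"
  by (auto simp: BijGroup_def Bij_def extensional_def)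

lemma mult_BijGroup: "bij f \<Longrightarrow> bij g \<Longrightarrow> f \<otimes>\<^bsub>BijGroup UNIV\<^esub> g = f \<circ> g"
  by (auto simp: BijGroup_def Bij_def extensional_def compose_def)

lemma one_BijGroup: "\<one>\<^bsub>BijGroup UNIV\<^esub> = id"
  by (simp add: BijGroup_def id_def restrict_def)

lemma inv_BijGroup_eq: "bij f \<Longrightarrow> inv\<^bsub>BijGroup UNIV\<^esub> f = inv_into UNIV f"
  by (subst inv_BijGroup) (auto simp: Bij_def extensional_def restrict_def)

lemma inv_into_refl [simp]: "inv_into UNIV (refl i) = refl i"
  by (rule inv_unique_comp) simp_all

lemma W_subset_bij: "w \<in> W \<Longrightarrow> bij w"
  using group.generate_in_carrier[OF group_BijGroup, of "range refl" UNIV w]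
  by (simp add: W_def image_subset_iff bij_refl)

lemma id_in_W [simp]: "id \<in> W"
  unfolding W_def using generate.one[of "BijGroup UNIV"] by (simp add: one_BijGroup)

lemma refl_in_W [simp]: "refl i \<in> W"
  unfolding W_def by (rule generate.incl) simp

lemma W_comp: "w \<in> W \<Longrightarrow> w' \<in> W \<Longrightarrow> w \<circ> w' \<in> W"
  using generate.eng[of w "BijGroup UNIV" "range refl" w'] W_subset_bij
  by (simp add: W_def[symmetric] mult_BijGroup)

lemma W_inv: "w \<in> W \<Longrightarrow> inv_into UNIV w \<in> W"
  using group.generate_m_inv_closed[OF group_BijGroup, of "range refl" UNIV w] W_subset_bij
  by (simp add: W_def[symmetric] inv_BijGroup_eq bij_refl image_subset_iff)

lemma W_induct [consumes 1, case_names id refl]: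
  assumes "w \<in> W" "P id" "\<And>i w. w \<in> W \<Longrightarrow> P w \<Longrightarrow> P (refl i \<circ> w)"
  shows "P w"
proof -
  \<comment> \<open>The claim is strengthened so that it passes to products: left multiplication by
    \<open>w\<close> preserves \<open>P\<close>.\<close>
  have "w \<in> W \<and> (\<forall>u\<in>W. P u \<longrightarrow> P (w \<circ> u))" using assms(1) unfolding W_def
  proof (induction rule: generate.induct)
    case one
    then show ?case by (simp add: one_BijGroup del: id_apply flip: W_def)
  next
    case (incl h)
    then obtain i where "h = refl i" by blast
    then show ?case using assms(3) refl_in_W unfolding W_def by blast
  next
    case (inv h)
    then obtain i where "h = refl i" by blast
    then have "inv\<^bsub>BijGroup UNIV\<^esub> h = refl i" by (simp add: inv_BijGroup_eq bij_refl)
    then show ?case using assms(3) refl_in_W unfolding W_def by metis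
  next
    case (eng h1 h2)
    then have "h1 \<in> W" "h2 \<in> W" "\<forall>u\<in>W. P u \<longrightarrow> P (h1 \<circ> u)" "\<forall>u\<in>W. P u \<longrightarrow> P (h2 \<circ> u)"
      unfolding W_def by blast+
    moreover from this have "h1 \<otimes>\<^bsub>BijGroup UNIV\<^esub> h2 = h1 \<circ> h2"
      by (intro mult_BijGroup W_subset_bij)
    ultimately show ?case unfolding W_def[symmetric] by (metis W_comp comp_assoc)
  qed
  then show ?thesis using assms(2) by (metis comp_id id_in_W)
qed

lemma W_add: "w \<in> W \<Longrightarrow> w (x + y) = w x + w y"
  by (induction arbitrary: x y rule: W_induct) (simp_all add: refl_add)

lemma W_0 [simp]: "w \<in> W \<Longrightarrow> w 0 = 0"
  using W_add[of w 0 0] by simp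

lemma W_zscale: "w \<in> W \<Longrightarrow> w (zscale k x) = zscale k (w x)"
  by (rule zscale_hom) (rule W_add)

lemma W_minus: "w \<in> W \<Longrightarrow> w (- x) = - w x"
  using W_zscale[of w "-1" x] by simp

lemma W_diff: "w \<in> W \<Longrightarrow> w (x - y) = w x - w y"
  using W_add[of w x "- y"] by (simp add: W_minus)

lemma W_inv_f_f [simp]: "w \<in> W \<Longrightarrow> inv_into UNIV w (w x) = x"
  by (meson W_subset_bij bij_is_inj inv_f_f)

lemma W_f_inv_f [simp]: "w \<in> W \<Longrightarrow> w (inv_into UNIV w x) = x"
  by (meson W_subset_bij bij_is_surj surj_f_inv_f)

lemma W_comp_inv: "w \<in> W \<Longrightarrow> w \<circ> inv_into UNIV w = id" "w \<in> W \<Longrightarrow> inv_into UNIV w \<circ> w = id"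
  by (simp_all add: fun_eq_iff)

lemma inv_refl_comp: "w \<in> W \<Longrightarrow> inv_into UNIV (refl i \<circ> w) = inv_into UNIV w \<circ> refl i"
  by (rule inv_unique_comp) (simp_all add: fun_eq_iff)

lemma W_inv_inv [simp]: "w \<in> W \<Longrightarrow> inv_into UNIV (inv_into UNIV w) = w"
  by (rule inv_unique_comp) (simp_all add: fun_eq_iff)

lemma conj_refl:
  assumes "w \<in> W"
  shows "(w \<circ> refl i \<circ> inv_into UNIV w) y = y - zscale (pairing (\<alpha> i) (inv_into UNIV w y)) (w (\<alpha>v i))"
  using assms by (simp add: refl_def W_diff W_zscale)

lemma torus_act_refl_comp: "w \<in> W \<Longrightarrow> torus_act (refl i \<circ> w) \<tau> = torus_act (refl i) (torus_act w \<tau>)"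
  by (simp add: torus_act_def fun_eq_iff inv_refl_comp)

lemma torus_act_refl: "torus_act (refl i) \<tau> y = \<tau> (refl i y)"
  by (simp add: torus_act_def)

lemma torus_act_id [simp]: "torus_act id \<tau> = \<tau>"
  by (simp add: torus_act_def fun_eq_iff)

lemma torus_act_comp: "w \<in> W \<Longrightarrow> w' \<in> W \<Longrightarrow> torus_act (w \<circ> w') \<tau> = torus_act w (torus_act w' \<tau>)"
  by (simp add: torus_act_def fun_eq_iff o_inv_distrib W_subset_bij)

lemma torus_act_in_torus: "w \<in> W \<Longrightarrow> \<tau> \<in> torus \<Longrightarrow> torus_act w \<tau> \<in> torus"
  by (simp add: torus_def torus_act_def W_add W_inv)

end

lemma torus_add: "\<tau> \<in> torus \<Longrightarrow> \<tau> (x + y) = \<tau> x * \<tau> y"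
  and torus_nonzero: "\<tau> \<in> torus \<Longrightarrow> \<tau> x \<noteq> 0"
  by (simp_all add: torus_def)

lemma torus_0 [simp]: "\<tau> \<in> torus \<Longrightarrow> \<tau> 0 = 1"
  using torus_add[of \<tau> 0 0] torus_nonzero[of \<tau> 0] by simp

lemma torus_minus: "\<tau> \<in> torus \<Longrightarrow> \<tau> (- x) = inverse (\<tau> x)"
  using torus_add[of \<tau> x "- x"] by (simp add: inverse_unique)

lemma torus_diff: "\<tau> \<in> torus \<Longrightarrow> \<tau> (x - y) = \<tau> x / \<tau> y"
  using torus_add[of \<tau> x "- y"] by (simp add: torus_minus divide_inverse)

lemma torus_zscale_eq_1: "\<tau> \<in> torus \<Longrightarrow> \<tau> x = 1 \<Longrightarrow> \<tau> (zscale k x) = 1"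
  by (induction k rule: int_induct[where k = 0])
    (simp_all add: zmod.scale_left_distrib zmod.scale_left_diff_distrib torus_add torus_diff)

section \<open>Rank two: the Weyl group as a dihedral group\<close>

locale rank_two_system = root_generating_system A pairing \<alpha> \<alpha>v
  for A :: "'i::finite \<Rightarrow> 'i \<Rightarrow> int"
    and pairing :: "'x::finite_free_ab_group \<Rightarrow> 'y::finite_free_ab_group \<Rightarrow> int"
    and \<alpha> :: "'i \<Rightarrow> 'x"
    and \<alpha>v :: "'i \<Rightarrow> 'y" +
  fixes a b :: 'i
  assumes a_neq_b: "a \<noteq> b" and UNIV_ab: "UNIV = {a, b}"
begin

text \<open>
  The chambers of the infinite dihedral group are indexed by the integers, the wall \<open>k\<close>
  separating the chambers \<open>k - 1\<close> and \<open>k\<close>; \<open>wall_label k\<close> is the type of the wall \<open>k\<close>, and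
  \<open>ch k\<close> is the Weyl group element of the chamber \<open>k\<close>. When the Weyl group is finite this
  indexing is periodic.
\<close>

definition wall_label :: "int \<Rightarrow> 'i" where
  "wall_label k = (if odd k then a else b)"

primrec ch_pos :: "nat \<Rightarrow> 'y \<Rightarrow> 'y" where
  "ch_pos 0 = id"
| "ch_pos (Suc n) = refl (wall_label (int (Suc n))) \<circ> ch_pos n"

primrec ch_neg :: "nat \<Rightarrow> 'y \<Rightarrow> 'y" where
  "ch_neg 0 = id"
| "ch_neg (Suc n) = refl (wall_label (- int n)) \<circ> ch_neg n"

definition ch :: "int \<Rightarrow> 'y \<Rightarrow> 'y" where
  "ch k = (if k \<ge> 0 then ch_pos (nat k) else ch_neg (nat (- k)))"

text \<open>The walls of the chamber \<open>q\<close> are \<open>q\<close> and \<open>q + 1\<close>,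
  and exactly one of them has type \<open>i\<close>; \<open>nb i q\<close> is the chamber beyond
  it.\<close>

definition nb :: "'i \<Rightarrow> int \<Rightarrow> int" where
  "nb i q = (if wall_label q = i then q - 1 else q + 1)"

lemma cases_ab: "i = a \<or> i = b"
  using UNIV_ab by blast

lemma wall_label_cong: "even (k - l) \<Longrightarrow> wall_label k = wall_label l"
  by (simp add: wall_label_def)

lemma wall_label_eq_iff: "wall_label k = wall_label l \<longleftrightarrow> even (k - l)"
  using a_neq_b by (simp add: wall_label_def)

lemma wall_label_neq: "wall_label q \<noteq> i \<Longrightarrow> wall_label (q + 1) = i" "wall_label (q + 1) \<noteq> i \<Longrightarrow> wall_label q = i"
  using cases_ab[of i] by (auto simp: wall_label_def split: if_splits)

lemma ch_0 [simp]: "ch 0 = id"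
  by (simp add: ch_def)

lemma ch_step: "ch k = refl (wall_label k) \<circ> ch (k - 1)"
proof (cases "k \<ge> 1")
  case True
  then have "nat k = Suc (nat (k - 1))" "int (Suc (nat (k - 1))) = k" by simp_all
  then show ?thesis using True by (simp add: ch_def del: of_nat_Suc)
next
  case False
  then have "nat (- (k - 1)) = Suc (nat (- k))" "- int (nat (- k)) = k" by simp_all
  moreover have "ch k = ch_neg (nat (- k))" using False by (cases "k = 0") (simp_all add: ch_def)
  ultimately show ?thesis using False by (simp add: ch_def del: of_nat_Suc)
qed

lemma ch_step': "ch (k - 1) = refl (wall_label k) \<circ> ch k"
  by (simp add: ch_step[of k])

lemma ch_1: "ch 1 = refl a" and ch_minus_1: "ch (- 1) = refl b"
  using ch_step[of 1] ch_step'[of 0] by (simp_all add: wall_label_def)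

lemma ch_nb: "ch (nb i q) = refl i \<circ> ch q"
  using ch_step'[of q] ch_step[of "q + 1"] wall_label_neq(1)[of q i] by (auto simp: nb_def)

lemma refl_comp_ch_add:
  "ch (m + 1) \<circ> w = refl (wall_label (m + 1)) \<circ> (ch m \<circ> w)"
  "ch (m - 1) \<circ> w = refl (wall_label m) \<circ> (ch m \<circ> w)"
  using ch_step[of "m + 1"] ch_step'[of m] by (simp_all add: comp_assoc)

text \<open>Wall types depend only on the parity. Started at an even \<open>n\<close>, the word of
  \<open>ch m\<close> therefore moves as it does from 0; started at an odd \<open>n\<close>, it
  moves in the opposite direction.\<close>

lemma ch_mult_even: "even n \<Longrightarrow> ch m \<circ> ch n = ch (n + m)"
proof (induction m rule: int_induct[where k = 0])
  case (step1 m)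
  then have "wall_label (m + 1) = wall_label (n + m + 1)" by (intro wall_label_cong) simp
  then show ?case using step1 ch_step[of "n + m + 1"] by (simp del: comp_apply add: refl_comp_ch_add add.assoc)
next
  case (step2 m)
  then have "wall_label m = wall_label (n + m)" by (intro wall_label_cong) simp
  then show ?case using step2 ch_step'[of "n + m"] by (simp del: comp_apply add: refl_comp_ch_add algebra_simps)
qed simp

lemma ch_mult_odd: "odd n \<Longrightarrow> ch m \<circ> ch n = ch (n - m)"
proof (induction m rule: int_induct[where k = 0])
  case (step1 m)
  then have w: "wall_label (m + 1) = wall_label (n - m)" by (intro wall_label_cong) simp
  have "ch m \<circ> ch n = ch (n - m)" using step1 by blast
  then have "ch (m + 1) \<circ> ch n = ch (n - m - 1)"
    unfolding refl_comp_ch_add w ch_step' by (rule arg_cong)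
  then show ?case by (simp del: comp_apply add: diff_diff_eq)
next
  case (step2 m)
  then have w: "wall_label m = wall_label (n - m + 1)" by (intro wall_label_cong) simp
  have "ch m \<circ> ch n = ch (n - m)" using step2 by blast
  then have "ch (m - 1) \<circ> ch n = ch (n - m + 1)"
    unfolding refl_comp_ch_add w ch_step[of "n - m + 1"] by simp
  moreover have "n - m + 1 = n - (m - 1)" by simp
  ultimately show ?case by (simp only:)
qed simp

lemma ch_in_W [simp]: "ch k \<in> W"
proof (induction k rule: int_induct[where k = 0])
  case (step1 k)
  then show ?case using ch_step[of "k + 1"] by (simp del: comp_apply add: W_comp)
next
  case (step2 k)
  then show ?case using ch_step'[of k] by (simp del: comp_apply add: W_comp)
qed (simp del: id_apply)

lemma W_eq_range_ch: "W = range ch"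
proof
  show "W \<subseteq> range ch"
  proof
    fix w assume "w \<in> W"
    then show "w \<in> range ch"
    proof (induction rule: W_induct)
      case id
      then show ?case using ch_0 by (metis rangeI)
    next
      case (refl i w)
      then obtain n where "w = ch n" by blast
      then have "refl i \<circ> w = ch (nb i n)" by (simp only: ch_nb)
      then show ?case by blast
    qed
  qed
qed auto

lemma W_cases: "w \<in> W \<Longrightarrow> (\<And>n. w = ch n \<Longrightarrow> P) \<Longrightarrow> P"
  using W_eq_range_ch by blast

lemma inv_ch: "inv_into UNIV (ch n) = ch (if even n then - n else n)"
  by (rule inv_unique_comp) (simp_all add: ch_mult_even ch_mult_odd)

text \<open>So \<open>ch (2 * k - 1)\<close> is the reflection in the wall \<open>k\<close>.
  Multiplied from the right it sends the chamber \<open>n\<close> to \<open>2 * k - 1 - n\<close>,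
  the mirror image behind all foldings below.\<close>

lemma conj_wall: "inv_into UNIV (ch k) \<circ> refl (wall_label k) \<circ> ch k = ch (2 * k - 1)"
  unfolding comp_assoc ch_step'[symmetric] by (simp add: inv_ch ch_mult_even ch_mult_odd)

lemma refl_eq_ch: "refl i = ch (if i = a then 1 else - 1)"
  using cases_ab[of i] by (auto simp: ch_1 ch_minus_1)

lemma conj_ch:
  "ch n \<circ> refl i \<circ> inv_into UNIV (ch n) =
     ch (let e = if i = a then 1 else - 1 in if even n then e - 2 * n else 2 * n - e)"
  by (simp add: refl_eq_ch inv_ch comp_assoc ch_mult_even ch_mult_odd Let_def)

lemma conj_refl_odd:
  assumes "w \<in> W"
  obtains d where "odd d" "w \<circ> refl i \<circ> inv_into UNIV w = ch d"
proof -
  obtain n where n: "w = ch n" using W_cases[OF assms] .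
  show ?thesis by (rule that[OF _ conj_ch[of n i, folded n]]) (simp add: Let_def)
qed

lemma refl_neq_id: "refl i \<noteq> id"
proof
  assume "refl i = id"
  then have "- \<alpha>v i = \<alpha>v i" using refl_coroot[of i] by simp
  then have "zscale 2 (\<alpha>v i) = 0"
    using zscale_add_left[of 1 1 "\<alpha>v i"] by (metis add.right_inverse one_add_one zscale_1)
  then show False by simp
qed

text \<open>By \<open>conj_wall\<close> an element of odd index is conjugate to a simple
  reflection.\<close>

lemma ch_odd_neq_id: "odd d \<Longrightarrow> ch d \<noteq> id"
proof
  assume "odd d" "ch d = id"
  then obtain c where "d = 2 * c + 1" by (auto elim: oddE)
  then obtain k where k: "d = 2 * k - 1" by (intro that[of "c + 1"]) simp
  have "refl (wall_label k) = ch k \<circ> ch d \<circ> inv_into UNIV (ch k)"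
    unfolding k conj_wall[symmetric] by (simp add: fun_eq_iff)
  then have "refl (wall_label k) = id"
    using \<open>ch d = id\<close> by (simp add: W_comp_inv)
  then show False using refl_neq_id by blast
qed

text \<open>Half the period of \<open>ch\<close>, or 0 when the Weyl group is infinite.\<close>

definition per :: nat where
  "per = (if \<exists>d>0. ch (int d) = id then (LEAST d. d > 0 \<and> ch (int d) = id) div 2 else 0)"

text \<open>The least positive index of the identity is even, since odd indices give reflections, so
  halving it in \<open>per\<close> loses nothing; division with remainder does the rest.
  Divisibility by 0 covers the infinite group.\<close>

lemma ch_eq_id_iff: "ch d = id \<longleftrightarrow> 2 * int per dvd d"
proof (cases "\<exists>d>0. ch (int d) = id")
  case False
  have "d = 0" if "ch d = id" for d
  proof (rule ccontr)
    assume "d \<noteq> 0"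
    moreover have "ch (- d) = id"
      using that ch_odd_neq_id[of d] inv_ch[of d] by (metis inv_id)
    ultimately have "nat \<bar>d\<bar> > 0 \<and> ch (int (nat \<bar>d\<bar>)) = id" using that by (simp add: abs_if)
    then show False using False by blast
  qed
  moreover have "per = 0" using False by (simp only: per_def if_False)
  ultimately show ?thesis by auto
next
  case True
  define D where "D = (LEAST d. d > 0 \<and> ch (int d) = id)"
  have D: "D > 0" "ch (int D) = id" and least: "\<And>d. d > 0 \<Longrightarrow> ch (int d) = id \<Longrightarrow> D \<le> d"
    using LeastI_ex[OF True] Least_le[of "\<lambda>d. d > 0 \<and> ch (int d) = id"] by (auto simp: D_def)
  have even: "even D" using ch_odd_neq_id[of "int D"] D(2) by auto
  have per: "2 * int per = int D" using True even by (simp only: per_def if_True D_def[symmetric]) auto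
  have mult: "ch (int D * q) = id" for q
  proof (induction q rule: int_induct[where k = 0])
    case base
    show ?case by (metis ch_0 mult_zero_right)
  next
    case (step1 q)
    then show ?case using ch_mult_even[of "int D" "int D * q"] even D(2) by (simp add: algebra_simps)
  next
    case (step2 q)
    have "ch (int D * (q - 1)) = ch (int D) \<circ> ch (int D * (q - 1))" by (simp add: D(2))
    also have "\<dots> = ch (int D * q)" using even by (subst ch_mult_even) (simp_all add: algebra_simps)
    finally show ?case using step2 by simp
  qed
  show ?thesis unfolding per
  proof
    assume d: "ch d = id"
    have "ch (d mod int D) = ch (int D * (d div int D)) \<circ> ch (d mod int D)" by (simp add: mult)
    also have "\<dots> = ch d"
    proof (subst ch_mult_even)
      show "even (d mod int D)" using even ch_odd_neq_id[of d] d dvd_mod_iff[of 2 "int D" d] by auto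
    qed simp
    finally have r: "ch (d mod int D) = id" using d by simp
    have "d mod int D = 0"
    proof (rule ccontr)
      assume "d mod int D \<noteq> 0"
      moreover have "0 \<le> d mod int D" "d mod int D < int D" using D(1) by simp_all
      ultimately show False using least[of "nat (d mod int D)"] r by simp
    qed
    then show "int D dvd d" by auto
  next
    assume "int D dvd d"
    then show "ch d = id" using mult by auto
  qed
qed

lemma ch_eq_iff: "ch n = ch n' \<longleftrightarrow> 2 * int per dvd n - n'"
proof -
  have "ch n = ch n' \<longleftrightarrow> ch n \<circ> inv_into UNIV (ch n') = id"
  proof
    assume "ch n \<circ> inv_into UNIV (ch n') = id"
    then have "ch n \<circ> (inv_into UNIV (ch n') \<circ> ch n') = ch n'" by (simp add: comp_assoc[symmetric])
    then show "ch n = ch n'" by (simp add: W_comp_inv)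
  qed (simp add: W_comp_inv)
  also have "\<dots> \<longleftrightarrow> 2 * int per dvd n - n'"
    by (simp add: inv_ch ch_mult_even ch_mult_odd ch_eq_id_iff dvd_diff_commute)
  finally show ?thesis .
qed

text \<open>One index of least absolute value for each Weyl group element. The longest element has
  the two indices \<open>per\<close> and \<open>- per\<close>, of which the first is kept.\<close>

definition idx :: "int set" where
  "idx = {n. per = 0 \<or> - int per < n \<and> n \<le> int per}"

lemma inj_on_ch_idx: "inj_on ch idx"
proof (rule inj_onI)
  fix n n' assume n: "n \<in> idx" "n' \<in> idx" and "ch n = ch n'"
  then have dvd: "2 * int per dvd n - n'" by (simp add: ch_eq_iff)
  show "n = n'"
  proof (cases "per = 0")
    case False
    then have "\<bar>n - n'\<bar> < 2 * int per" using n by (auto simp: idx_def)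
    then show ?thesis using dvd_imp_le_int[OF _ dvd] by force
  qed (use dvd in simp)
qed

lemma ex_idx: obtains n' where "n' \<in> idx" "ch n' = ch n" "\<bar>n'\<bar> \<le> \<bar>n\<bar>"
proof (cases "per = 0")
  case True
  then show ?thesis using that[of n] by (simp add: idx_def)
next
  case False
  define m where "m = int per"
  define r where "r = (n + m - 1) mod (2 * m) - (m - 1)"
  have m: "m > 0" using False by (simp add: m_def)
  have "0 \<le> (n + m - 1) mod (2 * m)" "(n + m - 1) mod (2 * m) < 2 * m" using m by simp_all
  then have r: "- m < r" "r \<le> m" by (simp_all add: r_def)
  have "2 * m dvd (n + m - 1) mod (2 * m) - (n + m - 1)" by (simp flip: mod_eq_dvd_iff)
  then have dvd: "2 * m dvd r - n" by (simp add: r_def algebra_simps)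
  have "\<bar>r\<bar> \<le> \<bar>n\<bar>"
  proof (rule ccontr)
    assume "\<not> ?thesis"
    moreover from this have "\<bar>r - n\<bar> < 2 * m" using r by linarith
    ultimately show False using dvd_imp_le_int[OF _ dvd] m by force
  qed
  then show ?thesis using that[of r] r dvd by (auto simp: idx_def m_def ch_eq_iff)
qed

lemma W_idx_cases: assumes "w \<in> W" obtains n where "n \<in> idx" "w = ch n"
  using assms ex_idx by (metis W_cases)

section \<open>Lengths of Weyl group elements\<close>

lemma abs_nb: "\<bar>nb i q\<bar> = \<bar>q\<bar> + 1 \<or> \<bar>nb i q\<bar> = \<bar>q\<bar> - 1"
  by (auto simp: nb_def)

lemma word_Cons: "foldr (\<circ>) (map refl (i # is)) id = refl i \<circ> foldr (\<circ>) (map refl is) id"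
  by simp

lemma word_ch: "\<exists>n. \<bar>n\<bar> \<le> int (length is) \<and> foldr (\<circ>) (map refl is) id = ch n"
proof (induction "is")
  case Nil
  then show ?case by (intro exI[of _ 0]) simp
next
  case (Cons i "is")
  then obtain n where "\<bar>n\<bar> \<le> int (length is)" "foldr (\<circ>) (map refl is) id = ch n" by blast
  then show ?case using abs_nb[of i n] by (intro exI[of _ "nb i n"]) (auto simp del: comp_apply id_apply foldr.simps list.map simp: ch_nb word_Cons)
qed

lemma ch_word: "\<exists>is. length is = nat \<bar>n\<bar> \<and> ch n = foldr (\<circ>) (map refl is) id"
proof -
  have "\<exists>is. length is = k \<and> ch_pos k = foldr (\<circ>) (map refl is) id" for k
  proof (induction k)
    case (Suc k)
    then obtain "is" where "length is = k" "ch_pos k = foldr (\<circ>) (map refl is) id" by blast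
    then show ?case by (intro exI[of _ "wall_label (int (Suc k)) # is"]) (simp del: of_nat_Suc comp_apply id_apply foldr.simps list.map add: word_Cons)
  qed simp
  moreover have "\<exists>is. length is = k \<and> ch_neg k = foldr (\<circ>) (map refl is) id" for k
  proof (induction k)
    case (Suc k)
    then obtain "is" where "length is = k" "ch_neg k = foldr (\<circ>) (map refl is) id" by blast
    then show ?case by (intro exI[of _ "wall_label (- int k) # is"]) (simp del: comp_apply id_apply foldr.simps list.map add: word_Cons)
  qed simp
  ultimately show ?thesis by (simp add: ch_def)
qed

text \<open>A word with \<open>k\<close> letters ends at an index of absolute value at most
  \<open>k\<close>, congruent to \<open>n\<close> modulo \<open>2 * per\<close>, and within the
  bound no congruent index is closer to 0 than \<open>n\<close>.\<close>

lemma len_ch: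
  assumes "per = 0 \<or> \<bar>n\<bar> \<le> int per"
  shows "len (ch n) = nat \<bar>n\<bar>"
  unfolding len_def
proof (rule Least_equality)
  show "\<exists>is. length is = nat \<bar>n\<bar> \<and> ch n = foldr (\<circ>) (map refl is) id" by (rule ch_word)
  fix k assume "\<exists>is. length is = k \<and> ch n = foldr (\<circ>) (map refl is) id"
  then obtain n' where n': "\<bar>n'\<bar> \<le> int k" "ch n = ch n'" using word_ch by metis
  then have dvd: "2 * int per dvd n - n'" by (simp add: ch_eq_iff)
  have "\<bar>n\<bar> \<le> \<bar>n'\<bar>"
  proof (rule ccontr)
    assume less: "\<not> ?thesis"
    show False
    proof (cases "per = 0")
      case False
      then show False using less assms dvd_imp_le_int[OF _ dvd] by force
    qed (use dvd less in simp)
  qed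
  then show "nat \<bar>n\<bar> \<le> k" using n' by linarith
qed

lemma len_ch_idx: "n \<in> idx \<Longrightarrow> len (ch n) = nat \<bar>n\<bar>"
  by (rule len_ch) (auto simp: idx_def)

lemma len_id [simp]: "len id = 0"
  using len_ch[of 0] by simp

lemma len_refl [simp]: "len (refl i) = 1"
proof -
  have "per \<noteq> 0 \<longrightarrow> 1 \<le> int per" by simp
  then show ?thesis unfolding refl_eq_ch by (subst len_ch) auto
qed

lemma len_refl_comp:
  assumes "w \<in> W"
  shows "len (refl i \<circ> w) = len w + 1 \<or> len w = len (refl i \<circ> w) + 1"
proof -
  obtain n where n: "n \<in> idx" "w = ch n" using W_idx_cases[OF assms] .
  have rw: "refl i \<circ> w = ch (nb i n)" by (simp add: n ch_nb)
  show ?thesis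
  proof (cases "per = 0 \<or> \<bar>nb i n\<bar> \<le> int per")
    case True
    then show ?thesis using abs_nb[of i n] len_ch[OF True] n(1) unfolding rw n(2) by (auto simp: len_ch_idx nat_add_distrib simp flip: ch_nb)
  next
    case False
    \<comment> \<open>The range is left only from the longest element, and \<open>per + 1\<close> is
      the same chamber as \<open>1 - per\<close>.\<close>
    then have p: "per \<noteq> 0" "\<bar>nb i n\<bar> > int per" by auto
    have n': "- int per < n" "n \<le> int per" using n p by (auto simp: idx_def)
    have "\<bar>nb i n\<bar> = \<bar>n\<bar> + 1" using p n' abs_nb[of i n] by auto
    then have "n = int per" "nb i n = int per + 1" using p n' by (auto simp: nb_def split: if_splits)
    then have "refl i \<circ> w = ch (1 - int per)"
      unfolding rw by (simp add: ch_eq_iff)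
    then have "len (refl i \<circ> w) = per - 1" using len_ch[of "1 - int per"] p(1) by simp
    moreover have "len w = per" using n \<open>n = int per\<close> by (simp add: len_ch_idx)
    ultimately show ?thesis using p(1) by simp
  qed
qed

lemma len_eq_0: "w \<in> W \<Longrightarrow> len w = 0 \<Longrightarrow> w = id"
  by (metis W_idx_cases len_ch_idx ch_0 abs_eq_0 abs_ge_zero nat_0_le of_nat_0)

lemma len_eq_cases:
  assumes "w \<in> W" "len w = j"
  shows "w = ch (int j) \<or> w = ch (- int j)"
proof -
  obtain n where n: "n \<in> idx" "w = ch n" using W_idx_cases[OF assms(1)] .
  then have "j = nat \<bar>n\<bar>" using assms(2) by (simp add: len_ch_idx)
  then show ?thesis using n(2) by (cases "n \<ge> 0") simp_all
qed

lemma finite_len_less: "finite {w \<in> W. len w < j}"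
proof (rule finite_subset)
  show "{w \<in> W. len w < j} \<subseteq> ch ` {- int j..int j}"
    using len_eq_cases by force
qed simp

lemma W_len_induct [consumes 1, case_names id refl]:
  assumes "w \<in> W" "P id"
    and "\<And>i w. w \<in> W \<Longrightarrow> len (refl i \<circ> w) = len w + 1 \<Longrightarrow> P w \<Longrightarrow> P (refl i \<circ> w)"
  shows "P w"
  using assms(1)
proof (induction "len w" arbitrary: w)
  case 0
  then show ?case using assms(2) len_eq_0 by metis
next
  case (Suc j)
  obtain n where n: "n \<in> idx" "w = ch n" using W_idx_cases[OF Suc.prems] .
  have n0: "nat \<bar>n\<bar> = Suc j" using n Suc.hyps(2) by (simp add: len_ch_idx)
  \<comment> \<open>The type of the wall of the chamber \<open>n\<close> on the side of 0.\<close>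
  define i where "i = (if n > 0 then wall_label n else wall_label (n + 1))"
  have nb: "\<bar>nb i n\<bar> = \<bar>n\<bar> - 1"
    using n0 wall_label_eq_iff[of n "n + 1"] by (auto simp: nb_def i_def)
  define u where "u = refl i \<circ> w"
  have u: "u = ch (nb i n)" by (simp add: u_def n ch_nb)
  then have "len u = j" using len_ch[of "nb i n"] nb n(1) n0 by (auto simp: idx_def)
  moreover have "u \<in> W" by (simp add: u)
  moreover have w: "w = refl i \<circ> u" by (simp add: u_def)
  ultimately show ?case using Suc.hyps assms(3)[of u i] by simp
qed

subsection \<open>Roots and reflections\<close>

lemma refl_commute:
  assumes "A i j = 0"
  shows "refl i (refl j y) = refl j (refl i y)"
proof -
  have "pairing (\<alpha> i) (\<alpha>v j) = 0" "pairing (\<alpha> j) (\<alpha>v i) = 0"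
    using assms A_zero_iff by (simp_all add: pairing_roots)
  then show ?thesis by (simp add: refl_def pairing_diff algebra_simps)
qed

lemma conj_rotation:
  assumes "even k"
  shows "refl i \<circ> ch k \<circ> refl i = ch (- k)"
  using assms by (simp add: refl_eq_ch comp_assoc ch_mult_even ch_mult_odd)

text \<open>
  Each simple reflection inverts a rotation \<open>t\<close>. If \<open>t - 1\<close> has rank one, the reflection
  therefore fixes the line of \<open>\<gamma>\<close> and that of \<open>h\<close>, with opposite signs.
\<close>

lemma unipotent_rotation:
  assumes k: "even k" and N: "N \<noteq> 0" and h_add: "\<And>x y. h (x + y) = h x + h y"
    and t: "\<And>y. zscale N (ch k y - y) = zscale (h y) \<gamma>" and h\<gamma>: "h \<gamma> = 0"
  shows "ch k = id"
proof (rule ccontr)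
  assume "ch k \<noteq> id"
  then obtain y0 where "ch k y0 \<noteq> y0" by (auto simp: fun_eq_iff)
  then have "zscale (h y0) \<gamma> \<noteq> 0" using t[of y0] N by (metis right_minus_eq zscale_eq_0_iff)
  then have hy0: "h y0 \<noteq> 0" and \<gamma>: "\<gamma> \<noteq> 0" by auto
  have h_zscale: "h (zscale c y) = c * h y" for c y
    using zscale_hom[of h c y] h_add by simp
  have h_diff: "h (x - y) = h x - h y" for x y
    using h_add[of x "- y"] h_zscale[of "-1" y] by simp
  have h_inv: "h (ch k y) = h y" for y
  proof -
    have "N * (h (ch k y) - h y) = h (zscale N (ch k y - y))" by (simp add: h_zscale h_diff)
    also have "\<dots> = 0" by (simp add: t h_zscale h\<gamma>)
    finally show ?thesis using N by simp
  qed
  have t_inv: "zscale N (ch (- k) y - y) = - zscale (h y) \<gamma>" for y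
  proof -
    have "ch k (ch (- k) y) = y" using fun_cong[OF ch_mult_even[of "- k" k], of y] k by simp
    then show ?thesis using t[of "ch (- k) y"] h_inv[of "ch (- k) y"]
      by (metis minus_diff_eq zmod.scale_minus_right)
  qed
  \<comment> \<open>The rank one formula for \<open>ch k\<close>, conjugated by
    \<open>refl i\<close> and compared with the one for the inverse rotation.\<close>
  have star: "zscale (h (refl i y)) (refl i \<gamma>) = - zscale (h y) \<gamma>" for i y
  proof -
    have "zscale (h (refl i y)) (refl i \<gamma>) = refl i (zscale N (ch k (refl i y) - refl i y))"
      by (simp add: t W_zscale)
    also have "\<dots> = zscale N ((refl i \<circ> ch k \<circ> refl i) y - y)" by (simp add: W_zscale W_diff)
    finally show ?thesis using k by (simp only: conj_rotation t_inv)
  qed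
  have sign: "(refl i \<gamma> = \<gamma> \<and> (\<forall>y. h (refl i y) = - h y)) \<or> (refl i \<gamma> = - \<gamma> \<and> (\<forall>y. h (refl i y) = h y))" for i
  proof -
    have "zscale (h y0 * h y0) \<gamma> = - zscale (h y0) (zscale (h (refl i y0)) (refl i \<gamma>))"
      by (simp add: star zscale_mult)
    also have "\<dots> = zscale (h (refl i y0)) (- zscale (h (refl i (refl i y0))) (refl i \<gamma>))"
      by (simp add: zscale_mult mult.commute)
    also have "\<dots> = zscale (h (refl i y0) * h (refl i y0)) \<gamma>"
      by (simp only: star minus_minus zscale_mult)
    finally have "h y0 * h y0 = h (refl i y0) * h (refl i y0)"
      using \<gamma> zscale_eq_0_iff[of "h y0 * h y0 - h (refl i y0) * h (refl i y0)" \<gamma>]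
      by (simp add: zmod.scale_left_diff_distrib)
    then consider "h (refl i y0) = h y0" | "h (refl i y0) = - h y0"
      using square_eq_iff by metis
    then show ?thesis
    proof cases
      case 1
      then have "zscale (h y0) (refl i \<gamma>) = zscale (h y0) (- \<gamma>)" using star[of i y0] by simp
      then have *: "refl i \<gamma> = - \<gamma>" using hy0 by (simp only: zscale_cancel_left not_False_eq_True)
      have "zscale (h (refl i y) - h y) \<gamma> = 0" for y
        using star[of i y] by (simp add: * zmod.scale_left_diff_distrib)
      then show ?thesis using * \<gamma> by simp
    next
      case 2
      then have "zscale (- h y0) (refl i \<gamma>) = zscale (- h y0) \<gamma>" using star[of i y0] by simp
      then have *: "refl i \<gamma> = \<gamma>" using hy0 zscale_cancel_left[of "- h y0" "refl i \<gamma>" \<gamma>] by simp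
      have "zscale (h (refl i y) + h y) \<gamma> = 0" for y
        using star[of i y] by (simp add: * zmod.scale_left_distrib)
      then have "h (refl i y) = - h y" for y using \<gamma> by (metis add_eq_0_iff2 zscale_eq_0_iff)
      then show ?thesis using * by blast
    qed
  qed
  have sign1: "pairing (\<alpha> i) \<gamma> = 0" "2 * h y = h (\<alpha>v i) * pairing (\<alpha> i) y"
    if "refl i \<gamma> = \<gamma>" "\<forall>y. h (refl i y) = - h y" for i y
  proof -
    show "pairing (\<alpha> i) \<gamma> = 0" using that(1) by (simp add: refl_def)
    have "h (refl i y) = h y - pairing (\<alpha> i) y * h (\<alpha>v i)" by (simp add: refl_def h_diff h_zscale)
    then show "2 * h y = h (\<alpha>v i) * pairing (\<alpha> i) y" using that(2) by (simp add: mult.commute)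
  qed
  have sign2: "zscale 2 \<gamma> = zscale (pairing (\<alpha> i) \<gamma>) (\<alpha>v i)" if "refl i \<gamma> = - \<gamma>" for i
  proof -
    have "zscale 2 \<gamma> = \<gamma> + \<gamma>" using zscale_add_left[of 1 1 \<gamma>] by simp
    also have "\<dots> = zscale (pairing (\<alpha> i) \<gamma>) (\<alpha>v i)"
      using that by (simp add: refl_def algebra_simps)
    finally show ?thesis .
  qed
  \<comment> \<open>Different signs force the matrix entry to vanish, so the simple reflections
    commute and the rotation has square 1; but then \<open>t y - y\<close> would be its own
    negative.\<close>
  have mixed: False if ij: "i \<noteq> j" and i: "refl i \<gamma> = \<gamma>" "\<forall>y. h (refl i y) = - h y" and j: "refl j \<gamma> = - \<gamma>" for i j
  proof -
    have "pairing (\<alpha> i) (zscale 2 \<gamma>) = pairing (\<alpha> j) \<gamma> * A j i"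
      unfolding sign2[OF j] by (simp add: pairing_roots)
    then have "pairing (\<alpha> j) \<gamma> * A j i = 0" using sign1(1)[OF i] by simp
    moreover have "pairing (\<alpha> j) \<gamma> \<noteq> 0"
      using sign2[OF j] \<gamma> by (metis zmod.scale_zero_left zscale_eq_0_iff zero_neq_numeral)
    ultimately have "A j i = 0" by simp
    then have "A a b = 0" using ij cases_ab[of i] cases_ab[of j] A_zero_iff by metis
    then have comm: "refl a (refl b y) = refl b (refl a y)" for y by (rule refl_commute)
    have "ch 2 = refl b \<circ> refl a"
      using ch_step[of 2] ch_1 by (simp add: wall_label_def)
    then have "ch 2 \<circ> ch 2 = id" by (simp add: fun_eq_iff comm)
    then have "ch 4 = id" using ch_mult_even[of 2 2] by simp
    then have "2 * int per dvd 4" by (simp add: ch_eq_id_iff)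
    moreover have "4 dvd k + k" using k by auto
    ultimately have "ch (k + k) = id" unfolding ch_eq_id_iff by (rule dvd_trans)
    then have "ch k (ch k y) = y" for y using fun_cong[OF ch_mult_even[OF k, of k], of y] by simp
    then have "zscale N (ch k y0 - y0) = - zscale N (ch k (ch k y0) - ch k y0)"
      by (metis minus_diff_eq zmod.scale_minus_right)
    then have "zscale (h y0) \<gamma> = - zscale (h y0) \<gamma>" by (simp only: t h_inv)
    then have "zscale (h y0 + h y0) \<gamma> = 0" by (simp only: zscale_add_left) (metis add.right_inverse)
    then show False using hy0 \<gamma> by simp
  qed
  \<comment> \<open>Equal signs make \<open>h\<close> proportional to both simple roots, or \<gamma>
    proportional to both simple coroots, which freeness forbids.\<close>
  from sign[of a] sign[of b] mixed[of a b] mixed[of b a] a_neq_b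
  consider "refl a \<gamma> = \<gamma>" "\<forall>y. h (refl a y) = - h y" "refl b \<gamma> = \<gamma>" "\<forall>y. h (refl b y) = - h y"
    | "refl a \<gamma> = - \<gamma>" "refl b \<gamma> = - \<gamma>" by blast
  then show False
  proof cases
    case 1
    have "pairing (zscale (h (\<alpha>v a)) (\<alpha> a)) y = pairing (zscale (h (\<alpha>v b)) (\<alpha> b)) y" for y
      using sign1(2)[OF 1(1,2), of y] sign1(2)[OF 1(3,4), of y] by simp
    then have "zscale (h (\<alpha>v a)) (\<alpha> a) = zscale (h (\<alpha>v b)) (\<alpha> b)" by (rule pairing_eqI)
    then have "zscale (h (\<alpha>v a)) (\<alpha> a) + zscale (- h (\<alpha>v b)) (\<alpha> b) = 0" by simp
    then have "h (\<alpha>v a) = 0" using free_familyD(1)[OF roots_free a_neq_b] by blast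
    then show False using sign1(2)[OF 1(1,2), of y0] hy0 by simp
  next
    case 2
    have "zscale (pairing (\<alpha> a) \<gamma>) (\<alpha>v a) + zscale (- pairing (\<alpha> b) \<gamma>) (\<alpha>v b) = 0"
      using sign2[OF 2(1)] sign2[OF 2(2)] by simp
    then have "pairing (\<alpha> a) \<gamma> = 0" using free_familyD(1)[OF coroots_free a_neq_b] by blast
    then show False using sign2[OF 2(1)] \<gamma> by simp
  qed
qed

lemma conj_refl_self: "w \<in> W \<Longrightarrow> (w \<circ> refl i \<circ> inv_into UNIV w) \<circ> (w \<circ> refl i \<circ> inv_into UNIV w) = id"
  by (simp add: fun_eq_iff)

lemma conj_refl_mult_rotation:
  assumes "w \<in> W" "w' \<in> W"
  obtains k where "even k"
    "(w \<circ> refl i \<circ> inv_into UNIV w) \<circ> (w' \<circ> refl j \<circ> inv_into UNIV w') = ch k"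
proof -
  obtain d where d: "odd d" "w \<circ> refl i \<circ> inv_into UNIV w = ch d" using conj_refl_odd[OF assms(1)] .
  obtain d' where d': "odd d'" "w' \<circ> refl j \<circ> inv_into UNIV w' = ch d'" using conj_refl_odd[OF assms(2)] .
  show ?thesis using that[of "d' - d"] d d' by (simp add: ch_mult_odd)
qed

lemma involution_eqI:
  assumes "f \<circ> g = id" "g \<circ> g = id"
  shows "f = g"
proof -
  have "f = f \<circ> (g \<circ> g)" by (simp only: assms comp_id)
  also have "\<dots> = (f \<circ> g) \<circ> g" by (rule comp_assoc[symmetric])
  also have "\<dots> = g" by (simp only: assms id_comp)
  finally show ?thesis .
qed

text \<open>The product of the two reflections minus the identity has its image in the line of the
  common coroot and vanishes on it, so \<open>unipotent_rotation\<close> makes the product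
  trivial.\<close>

lemma coroot_determines_refl:
  assumes w: "w \<in> W" "w' \<in> W" and eq: "w (\<alpha>v i) = w' (\<alpha>v j)"
  shows "w \<circ> refl i \<circ> inv_into UNIV w = w' \<circ> refl j \<circ> inv_into UNIV w'"
proof -
  let ?f = "\<lambda>y. pairing (\<alpha> i) (inv_into UNIV w y)"
  let ?f' = "\<lambda>y. pairing (\<alpha> j) (inv_into UNIV w' y)"
  obtain k where k: "even k"
    "(w \<circ> refl i \<circ> inv_into UNIV w) \<circ> (w' \<circ> refl j \<circ> inv_into UNIV w') = ch k"
    using conj_refl_mult_rotation[OF w] .
  have f2: "?f (w (\<alpha>v i)) = 2" "?f' (w (\<alpha>v i)) = 2"
    using w by simp (simp add: eq w)
  have t: "zscale 1 (ch k y - y) = zscale (?f' y - ?f y) (w (\<alpha>v i))" for y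
  proof -
    have "ch k y = (y - zscale (?f' y) (w (\<alpha>v i))) - zscale (?f y - ?f' y * 2) (w (\<alpha>v i))"
      using w unfolding k(2)[symmetric] comp_apply[of "w \<circ> refl i \<circ> inv_into UNIV w"] conj_refl[OF w(1)] conj_refl[OF w(2)]
      by (simp add: W_diff W_inv W_zscale pairing_diff flip: eq)
    moreover have "zscale (?f y - ?f' y * 2) (w (\<alpha>v i)) =
        zscale (?f y) (w (\<alpha>v i)) - (zscale (?f' y) (w (\<alpha>v i)) + zscale (?f' y) (w (\<alpha>v i)))"
      by (simp only: zmod.scale_left_diff_distrib mult_2_right zmod.scale_left_distrib)
    ultimately show ?thesis by (simp add: zmod.scale_left_diff_distrib)
  qed
  have "ch k = id"
    by (rule unipotent_rotation[OF k(1) _ _ t])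
      (simp_all add: W_add W_inv w pairing_add_right f2)
  with k(2) have "(w \<circ> refl i \<circ> inv_into UNIV w) \<circ> (w' \<circ> refl j \<circ> inv_into UNIV w') = id"
    by (rule trans)
  then show ?thesis using conj_refl_self[OF w(2)] by (rule involution_eqI)
qed

text \<open>Conjugation by \<open>ch n\<close> changes the index of a simple reflection by an even
  shift, up to sign. Comparing indices modulo \<open>2 * per\<close> shows that \<open>per\<close>
  divides an odd number. This is the link to the hypothesis on the parameters.\<close>

lemma conj_simple_odd_per:
  assumes "w \<in> W" "w \<circ> refl i \<circ> inv_into UNIV w = refl j" "i \<noteq> j"
  shows "odd per"
proof -
  define e where "e = (if i = a then 1 else - 1 :: int)"
  have ri: "refl i = ch e" by (simp add: e_def refl_eq_ch)
  have "refl j = ch (- e)" using assms(3) cases_ab[of i] cases_ab[of j] by (auto simp: e_def refl_eq_ch)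
  moreover obtain n where n: "w = ch n" using assms(1) by (rule W_cases)
  ultimately have "ch (if even n then e - 2 * n else 2 * n - e) = ch (- e)"
    using assms(2) conj_ch[of n i] by (simp only: Let_def e_def)
  then have "2 * int per dvd (if even n then 2 * (e - n) else 2 * n)"
    by (simp add: ch_eq_iff algebra_simps split: if_splits)
  moreover have "(if even n then 2 * (e - n) else 2 * n) = 2 * (if even n then e - n else n)" by simp
  ultimately have "2 * int per dvd 2 * (if even n then e - n else n)" by (simp only:)
  then have "int per dvd (if even n then e - n else n)" by (simp only: dvd_times_left_cancel_iff)
  moreover have "odd (if even n then e - n else n)" by (simp add: e_def)
  ultimately show ?thesis using dvd_trans[of 2 "int per"] by auto
qed

text \<open>The product is the rotation of index 2 or -2, and \<open>ch\<close> has period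
  \<open>2 * per\<close>; the value 0 means infinite order on both sides.\<close>

lemma ord_refl_mult:
  assumes "i \<noteq> j"
  shows "group.ord (BijGroup UNIV) (refl i \<circ> refl j) = per"
proof -
  interpret B: group "BijGroup (UNIV :: 'y set)" by (rule group_BijGroup)
  define e where "e = (if i = a then - 2 else 2 :: int)"
  have e: "refl i \<circ> refl j = ch e"
    using assms cases_ab[of i] cases_ab[of j] by (auto simp: e_def refl_eq_ch ch_mult_odd)
  have bij: "bij (ch n)" for n by (rule W_subset_bij) simp
  have pow: "ch e [^]\<^bsub>BijGroup UNIV\<^esub> n = ch (int n * e)" for n :: nat
  proof (induction n)
    case 0
    then show ?case by (simp add: one_BijGroup)
  next
    case (Suc n)
    have "even e" by (simp add: e_def)
    then show ?case using Suc by (simp add: mult_BijGroup bij ch_mult_even algebra_simps)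
  qed
  have "B.ord (ch e) dvd n \<longleftrightarrow> per dvd n" for n
  proof -
    have "B.ord (ch e) dvd n \<longleftrightarrow> ch (int n * e) = id"
      using B.pow_eq_id[of "ch e" n] bij by (simp add: pow one_BijGroup)
    also have "\<dots> \<longleftrightarrow> 2 * int per dvd 2 * int n" by (simp add: ch_eq_id_iff e_def mult.commute)
    also have "\<dots> \<longleftrightarrow> per dvd n" by simp
    finally show ?thesis .
  qed
  then show ?thesis unfolding e by (metis dvd_antisym dvd_refl)
qed

lemma W_coroot_combination:
  assumes "w \<in> W"
  obtains k l where "w (\<alpha>v i) = zscale k (\<alpha>v a) + zscale l (\<alpha>v b)"
proof -
  have "\<exists>k l. w (\<alpha>v i) = zscale k (\<alpha>v a) + zscale l (\<alpha>v b)"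
    using assms
  proof (induction rule: W_induct)
    case id
    have "\<alpha>v a = zscale 1 (\<alpha>v a) + zscale 0 (\<alpha>v b)" "\<alpha>v b = zscale 0 (\<alpha>v a) + zscale 1 (\<alpha>v b)"
      by simp_all
    then show ?case using cases_ab[of i] by (metis id_apply)
  next
    case (refl j w)
    then obtain k l where kl: "w (\<alpha>v i) = zscale k (\<alpha>v a) + zscale l (\<alpha>v b)" by blast
    define m where "m = pairing (\<alpha> j) (w (\<alpha>v i))"
    have "(refl j \<circ> w) (\<alpha>v i) = zscale k (\<alpha>v a) + zscale l (\<alpha>v b) - zscale m (\<alpha>v j)"
      by (simp add: refl_def m_def kl)
    also have "\<dots> = zscale (if j = a then k - m else k) (\<alpha>v a) + zscale (if j = a then l else l - m) (\<alpha>v b)"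
      using cases_ab[of j] a_neq_b by (auto simp: zmod.scale_left_diff_distrib)
    finally show ?case by blast
  qed
  then show ?thesis using that by blast
qed

text \<open>The vector is negated by \<open>refl j\<close>, so its double is a multiple of the
  coroot; coordinates in the free family of simple coroots remove the factor 2.\<close>

lemma W_coroot_multiple:
  assumes w: "w \<in> W" and conj: "w \<circ> refl i \<circ> inv_into UNIV w = refl j"
  obtains k where "w (\<alpha>v i) = zscale k (\<alpha>v j)"
proof -
  have "refl j (w (\<alpha>v i)) = - w (\<alpha>v i)" using w by (simp add: W_minus flip: conj)
  then have two: "zscale 2 (w (\<alpha>v i)) = zscale (pairing (\<alpha> j) (w (\<alpha>v i))) (\<alpha>v j)"
    using zscale_add_left[of 1 1 "w (\<alpha>v i)"]
    by (simp add: refl_def algebra_simps)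
  obtain k l where kl: "w (\<alpha>v i) = zscale k (\<alpha>v a) + zscale l (\<alpha>v b)" using W_coroot_combination[OF w] .
  define m where "m = pairing (\<alpha> j) (w (\<alpha>v i))"
  have eq: "zscale (2 * k) (\<alpha>v a) + zscale (2 * l) (\<alpha>v b) - zscale m (\<alpha>v j) = 0"
    using two by (simp add: kl m_def zmod.scale_right_distrib)
  show ?thesis
  proof (cases "j = a")
    case True
    then have "zscale (2 * k - m) (\<alpha>v a) + zscale (2 * l) (\<alpha>v b) = 0"
      using eq by (simp add: zmod.scale_left_diff_distrib algebra_simps)
    then have "2 * l = 0" by (rule free_familyD(2)[OF coroots_free a_neq_b])
    then have "l = 0" by simp
    then show ?thesis using that[of k] kl True by simp
  next
    case False
    then have "j = b" using cases_ab by blast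
    then have "zscale (2 * k) (\<alpha>v a) + zscale (2 * l - m) (\<alpha>v b) = 0"
      using eq by (simp add: zmod.scale_left_diff_distrib algebra_simps)
    then have "2 * k = 0" by (rule free_familyD(1)[OF coroots_free a_neq_b])
    then have "k = 0" by simp
    then show ?thesis using that[of l] kl \<open>j = b\<close> by simp
  qed
qed

text \<open>Applied to \<open>w\<close> and to its inverse, \<open>W_coroot_multiple\<close> gives
  two integers with product 1.\<close>

lemma conj_simple_coroot:
  assumes w: "w \<in> W" and conj: "w \<circ> refl i \<circ> inv_into UNIV w = refl j"
  shows "w (\<alpha>v i) = \<alpha>v j \<or> w (\<alpha>v i) = - \<alpha>v j"
proof -
  have conj': "inv_into UNIV w \<circ> refl j \<circ> inv_into UNIV (inv_into UNIV w) = refl i"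
    using w by (simp add: fun_eq_iff flip: conj)
  obtain k where k: "w (\<alpha>v i) = zscale k (\<alpha>v j)" using W_coroot_multiple[OF w conj] .
  obtain l where l: "inv_into UNIV w (\<alpha>v j) = zscale l (\<alpha>v i)"
    using W_coroot_multiple[OF W_inv[OF w] conj'] .
  have "\<alpha>v i = inv_into UNIV w (w (\<alpha>v i))" using w by simp
  also have "\<dots> = zscale (k * l) (\<alpha>v i)" using w by (simp add: k W_zscale W_inv l zscale_mult)
  finally have "zscale (k * l - 1) (\<alpha>v i) = 0" by (simp add: zmod.scale_left_diff_distrib)
  then have "k * l = 1" by simp
  then have "k = 1 \<or> k = - 1" using zmult_eq_1_iff by blast
  then show ?thesis using k by auto
qed

text \<open>The roots of two different reflections are not proportional.\<close>

lemma ex_separating_coweight: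
  assumes v: "v \<in> W" "v' \<in> W"
    and neq: "inv_into UNIV v \<circ> refl i \<circ> v \<noteq> inv_into UNIV v' \<circ> refl j \<circ> v'"
  obtains \<nu> where "pairing (\<alpha> j) (v' \<nu>) = 0" "pairing (\<alpha> i) (v \<nu>) \<noteq> 0"
proof (rule ccontr)
  assume "\<not> thesis"
  then have ker: "pairing (\<alpha> i) (v \<nu>) = 0" if "pairing (\<alpha> j) (v' \<nu>) = 0" for \<nu>
    using that \<open>\<And>\<nu>. pairing (\<alpha> j) (v' \<nu>) = 0 \<Longrightarrow> pairing (\<alpha> i) (v \<nu>) \<noteq> 0 \<Longrightarrow> thesis\<close> by blast
  let ?f = "\<lambda>y. pairing (\<alpha> i) (v y)" and ?f' = "\<lambda>y. pairing (\<alpha> j) (v' y)"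
  define \<beta> \<beta>' where "\<beta> = inv_into UNIV v (\<alpha>v i)" and "\<beta>' = inv_into UNIV v' (\<alpha>v j)"
  have f2: "?f \<beta> = 2" "?f' \<beta>' = 2" using v by (simp_all add: \<beta>_def \<beta>'_def)
  \<comment> \<open>An inclusion of kernels makes the two roots proportional. The contradiction will
    be that the product of the reflections is then unipotent of rank one.\<close>
  have ratio: "2 * ?f y = ?f' y * ?f \<beta>'" for y
  proof -
    have "?f' (zscale 2 y - zscale (?f' y) \<beta>') = 0"
      using v f2 by (simp add: W_diff W_zscale pairing_diff)
    then have "?f (zscale 2 y - zscale (?f' y) \<beta>') = 0" by (rule ker)
    then show ?thesis using v by (simp add: W_diff W_zscale pairing_diff)
  qed
  have w: "inv_into UNIV v \<in> W" "inv_into UNIV v' \<in> W" using v by (simp_all add: W_inv)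
  obtain k where k: "even k" "(inv_into UNIV v \<circ> refl i \<circ> v) \<circ> (inv_into UNIV v' \<circ> refl j \<circ> v') = ch k"
    using conj_refl_mult_rotation[OF w, of i j] v by auto
  have refl1: "(inv_into UNIV v \<circ> refl i \<circ> v) y = y - zscale (?f y) \<beta>" for y
    using conj_refl[OF w(1), of i y] v by (simp add: \<beta>_def)
  have refl2: "(inv_into UNIV v' \<circ> refl j \<circ> v') y = y - zscale (?f' y) \<beta>'" for y
    using conj_refl[OF w(2), of j y] v by (simp add: \<beta>'_def)
  \<comment> \<open>The image of the rank one map; the factor 2 clears the denominator left by
    \<open>ratio\<close>.\<close>
  define \<gamma> where "\<gamma> = zscale (?f \<beta>') \<beta> - zscale 2 \<beta>'"
  have t: "zscale 2 (ch k y - y) = zscale (?f' y) \<gamma>" for y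
  proof -
    have "ch k y = (y - zscale (?f' y) \<beta>') - zscale (?f y - ?f' y * ?f \<beta>') \<beta>"
      unfolding k(2)[symmetric] comp_apply[of "inv_into UNIV v \<circ> refl i \<circ> v"] refl1 refl2
      using v by (simp add: W_diff W_zscale pairing_diff)
    moreover have "?f y - ?f' y * ?f \<beta>' = - ?f y" using ratio[of y] by linarith
    ultimately have "ch k y - y = - zscale (?f' y) \<beta>' + zscale (?f y) \<beta>" by simp
    then have "zscale 2 (ch k y - y) = zscale (2 * ?f y) \<beta> - zscale (?f' y) (zscale 2 \<beta>')"
      by (simp add: zmod.scale_right_diff_distrib zscale_mult mult.commute)
    then show ?thesis unfolding ratio by (simp add: \<gamma>_def zmod.scale_right_diff_distrib zscale_mult)
  qed
  have "?f \<beta>' * ?f' \<beta> = 4" using ratio[of \<beta>] f2 by (simp add: mult.commute)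
  then have "?f' \<gamma> = 0" using v f2 by (simp add: \<gamma>_def W_diff W_zscale pairing_diff)
  then have "ch k = id"
    by (intro unipotent_rotation[OF k(1) _ _ t]) (simp_all add: W_add v pairing_add_right)
  then have 1: "(inv_into UNIV v \<circ> refl i \<circ> v) \<circ> (inv_into UNIV v' \<circ> refl j \<circ> v') = id"
    using k(2) by (rule trans[rotated])
  have 2: "(inv_into UNIV v' \<circ> refl j \<circ> v') \<circ> (inv_into UNIV v' \<circ> refl j \<circ> v') = id"
    using conj_refl_self[OF w(2), of j] unfolding W_inv_inv[OF v(2)] .
  have "inv_into UNIV v \<circ> refl i \<circ> v = inv_into UNIV v' \<circ> refl j \<circ> v'"
    by (rule involution_eqI[OF 1 2])
  then show False using neq by contradiction
qed

end

section \<open>The group algebra\<close>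

lemma monomial_mult: "monomial c \<mu> * monomial d \<nu> = monomial (c * d) (\<mu> + \<nu>)"
  by transfer (rule mult_single)

lemma monomial_add: "monomial (c + d) \<mu> = monomial c \<mu> + monomial d \<mu>"
  by transfer (rule single_add)

lemma monomial_diff: "monomial (c - d) \<mu> = monomial c \<mu> - monomial d \<mu>"
  by transfer (rule single_diff)

lemma monomial_uminus: "monomial (- c) \<mu> = - monomial c \<mu>"
  by transfer (rule single_uminus)

lemma monomial_zero [simp]: "monomial 0 \<mu> = 0"
  by transfer simp

lemma monomial_1_0 [simp]: "monomial 1 0 = 1"
  by transfer simp

lemma coeff_at_add: "coeff_at (p + q) \<mu> = coeff_at p \<mu> + coeff_at q \<mu>"
  by transfer (rule lookup_add)

lemma coeff_at_monomial: "coeff_at (monomial c \<mu>) \<nu> = (if \<mu> = \<nu> then c else 0)"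
  by transfer (simp add: lookup_single when_def)

lemma coeff_at_0 [simp]: "coeff_at 0 \<mu> = 0"
  by transfer simp

lemma group_algebra_eqI: "(\<And>\<mu>. coeff_at p \<mu> = coeff_at q \<mu>) \<Longrightarrow> p = q"
  by transfer (rule poly_mapping_eqI)

lemma finite_support [simp]: "finite (support p)"
  by transfer simp

lemma in_support_iff: "\<mu> \<in> support p \<longleftrightarrow> coeff_at p \<mu> \<noteq> 0"
  by transfer (rule in_keys_iff)

lemma sum_support:
  assumes "finite K" "support p \<subseteq> K" "\<And>\<mu>. g 0 \<mu> = 0"
  shows "(\<Sum>\<mu>\<in>support p. g (coeff_at p \<mu>) \<mu>) = (\<Sum>\<mu>\<in>K. g (coeff_at p \<mu>) \<mu>)"
  by (rule sum.mono_neutral_left) (use assms in \<open>auto simp: in_support_iff\<close>)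

text \<open>Serves \<open>ev\<close>, \<open>act_algebra\<close> and \<open>of_algebra\<close> at
  once: all three are linear extensions written as sums over the support.\<close>

lemma sum_support_add:
  fixes g :: "complex \<Rightarrow> 'y::comm_monoid_add \<Rightarrow> 'a::comm_monoid_add"
  assumes "\<And>\<mu>. g 0 \<mu> = 0" "\<And>c d \<mu>. g (c + d) \<mu> = g c \<mu> + g d \<mu>"
  shows "(\<Sum>\<mu>\<in>support (p + q). g (coeff_at (p + q) \<mu>) \<mu>) =
    (\<Sum>\<mu>\<in>support p. g (coeff_at p \<mu>) \<mu>) + (\<Sum>\<mu>\<in>support q. g (coeff_at q \<mu>) \<mu>)"
proof -
  let ?K = "support p \<union> support q"
  have "support (p + q) \<subseteq> ?K" by (auto simp: in_support_iff coeff_at_add)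
  then have "(\<Sum>\<mu>\<in>support (p + q). g (coeff_at (p + q) \<mu>) \<mu>) = (\<Sum>\<mu>\<in>?K. g (coeff_at (p + q) \<mu>) \<mu>)"
    by (intro sum_support) (simp_all add: assms)
  moreover have "(\<Sum>\<mu>\<in>support p. g (coeff_at p \<mu>) \<mu>) = (\<Sum>\<mu>\<in>?K. g (coeff_at p \<mu>) \<mu>)"
      "(\<Sum>\<mu>\<in>support q. g (coeff_at q \<mu>) \<mu>) = (\<Sum>\<mu>\<in>?K. g (coeff_at q \<mu>) \<mu>)"
    by (intro sum_support; simp add: assms)+
  ultimately show ?thesis by (simp add: coeff_at_add assms sum.distrib)
qed

lemma sum_support_monomial:
  fixes g :: "complex \<Rightarrow> 'y::comm_monoid_add \<Rightarrow> 'a::comm_monoid_add"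
  assumes "\<And>\<mu>. g 0 \<mu> = 0"
  shows "(\<Sum>\<nu>\<in>support (monomial c \<mu>). g (coeff_at (monomial c \<mu>) \<nu>) \<nu>) = g c \<mu>"
proof -
  have "support (monomial c \<mu>) \<subseteq> {\<mu>}" by (auto simp: in_support_iff coeff_at_monomial split: if_splits)
  then show ?thesis using sum_support[of "{\<mu>}" "monomial c \<mu>" g] assms by (simp add: coeff_at_monomial)
qed

lemma group_algebra_expand: "p = (\<Sum>\<mu>\<in>support p. monomial (coeff_at p \<mu>) \<mu>)"
proof (rule group_algebra_eqI)
  fix \<nu>
  have "coeff_at (\<Sum>\<mu>\<in>K. g \<mu>) \<nu> = (\<Sum>\<mu>\<in>K. coeff_at (g \<mu>) \<nu>)" if "finite K" for K and g :: "'a \<Rightarrow> 'a group_algebra"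
    using that by (induction K) (simp_all add: coeff_at_add)
  then show "coeff_at p \<nu> = coeff_at (\<Sum>\<mu>\<in>support p. monomial (coeff_at p \<mu>) \<mu>) \<nu>"
    by (simp add: coeff_at_monomial in_support_iff)
qed

lemma group_algebra_induct [case_names monomial add]:
  fixes p :: "'y::comm_monoid_add group_algebra"
  assumes m: "\<And>c \<mu>. P (monomial c \<mu>)" and a: "\<And>p q. P p \<Longrightarrow> P q \<Longrightarrow> P (p + q)"
  shows "P p"
proof -
  have "P (\<Sum>\<mu>\<in>K. monomial (g \<mu>) \<mu>)" if "finite K" for K and g :: "'y \<Rightarrow> complex"
    using that by (induction K) (auto intro: a m simp flip: monomial_zero[of 0] simp del: monomial_zero)
  then show ?thesis using group_algebra_expand[of p] by (metis finite_support)
qed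

lemma ev_add: "ev \<tau> (p + q) = ev \<tau> p + ev \<tau> q"
  unfolding ev_def by (rule sum_support_add) (simp_all add: distrib_right)

lemma ev_monomial [simp]: "ev \<tau> (monomial c \<mu>) = c * \<tau> \<mu>" for \<mu> :: "'y::comm_monoid_add"
  using sum_support_monomial[of "\<lambda>c \<mu>. c * \<tau> \<mu>" c \<mu>] by (simp add: ev_def)

lemma ev_0 [simp]: "ev \<tau> 0 = 0"
  using ev_monomial[of \<tau> 0 undefined] by simp

lemma ev_uminus: "ev \<tau> (- p) = - ev \<tau> p"
  using ev_add[of \<tau> p "- p"] by (simp add: add_eq_0_iff)

lemma ev_diff: "ev \<tau> (p - q) = ev \<tau> p - ev \<tau> q"
  using ev_add[of \<tau> p "- q"] by (simp add: ev_uminus)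

lemma ev_1 [simp]: "\<tau> \<in> torus \<Longrightarrow> ev \<tau> 1 = 1"
  using ev_monomial[of \<tau> 1 0] by simp

lemma ev_mult: "\<tau> \<in> torus \<Longrightarrow> ev \<tau> (p * q) = ev \<tau> p * ev \<tau> q"
proof (induction p rule: group_algebra_induct)
  case (monomial c \<mu>)
  show ?case
    by (induction q rule: group_algebra_induct)
      (simp_all add: monomial monomial_mult torus_add distrib_left ev_add)
qed (simp_all add: distrib_right ev_add)

lemma ev_unit: "\<tau> \<in> torus \<Longrightarrow> is_unit p \<Longrightarrow> ev \<tau> p \<noteq> 0"
  by (metis dvdE ev_1 ev_mult mult_zero_left zero_neq_one)

lemma act_algebra_add: "act_algebra w (p + q) = act_algebra w p + act_algebra w q"
  unfolding act_algebra_def by (rule sum_support_add) (simp_all add: monomial_add)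

lemma act_algebra_monomial [simp]: "act_algebra w (monomial c \<mu>) = monomial c (w \<mu>)"
  unfolding act_algebra_def by (rule sum_support_monomial) simp

lemma act_algebra_0 [simp]: "act_algebra w 0 = 0"
  using act_algebra_monomial[of w 0 undefined] by simp

lemma act_algebra_uminus: "act_algebra w (- p) = - act_algebra w p"
  using act_algebra_add[of w p "- p"] by (simp add: add_eq_0_iff)

lemma act_algebra_diff: "act_algebra w (p - q) = act_algebra w p - act_algebra w q"
  using act_algebra_add[of w p "- q"] by (simp add: act_algebra_uminus)

lemma act_algebra_id [simp]: "act_algebra id p = p"
  by (induction p rule: group_algebra_induct) (simp_all add: act_algebra_add)

lemma act_algebra_comp: "act_algebra (v \<circ> w) p = act_algebra v (act_algebra w p)"
  by (induction p rule: group_algebra_induct) (simp_all add: act_algebra_add)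

lemma ev_act_algebra: "ev \<tau> (act_algebra w p) = ev (\<tau> \<circ> w) p"
  by (induction p rule: group_algebra_induct) (simp_all add: act_algebra_add ev_add)

lemma divide_unique: "q \<noteq> 0 \<Longrightarrow> q * p = q * p' \<Longrightarrow> p = p'"
  for p :: "'y::finite_free_ab_group group_algebra"
  by simp

section \<open>The action of the Weyl group on the group algebra and its fractions\<close>

context root_generating_system
begin

lemma act_algebra_1 [simp]: "w \<in> W \<Longrightarrow> act_algebra w 1 = 1"
  using act_algebra_monomial[of w 1 0] by simp

lemma act_algebra_mult: "w \<in> W \<Longrightarrow> act_algebra w (p * q) = act_algebra w p * act_algebra w q"
proof (induction p rule: group_algebra_induct)
  case (monomial c \<mu>)
  then show ?case
    by (induction q rule: group_algebra_induct)
      (simp_all add: monomial_mult W_add distrib_left act_algebra_add)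
qed (simp_all add: distrib_right act_algebra_add)

lemma act_algebra_inv [simp]:
  "w \<in> W \<Longrightarrow> act_algebra (inv_into UNIV w) (act_algebra w p) = p"
  "w \<in> W \<Longrightarrow> act_algebra w (act_algebra (inv_into UNIV w) p) = p"
  by (simp_all add: W_comp_inv flip: act_algebra_comp)

lemma act_algebra_refl_refl [simp]: "act_algebra (refl i) (act_algebra (refl i) p) = p"
  by (simp flip: act_algebra_comp)

lemma act_algebra_eq_0_iff [simp]: "w \<in> W \<Longrightarrow> act_algebra w p = 0 \<longleftrightarrow> p = 0"
  by (metis act_algebra_inv(1) act_algebra_0)

lemma ev_torus_act: "w \<in> W \<Longrightarrow> ev (torus_act w \<tau>) p = ev \<tau> (act_algebra (inv_into UNIV w) p)"
proof -
  have "torus_act w \<tau> = \<tau> \<circ> inv_into UNIV w" by (simp add: fun_eq_iff torus_act_def)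
  then show ?thesis by (simp add: ev_act_algebra)
qed

lemma ev_torus_act_refl: "ev (torus_act (refl i) \<tau>) p = ev \<tau> (act_algebra (refl i) p)"
  by (simp add: ev_torus_act)

lemma act_fract_Fract:
  assumes w: "w \<in> W" and q: "q \<noteq> 0"
  shows "act_fract w (Fract p q) = Fract (act_algebra w p) (act_algebra w q)"
  unfolding act_fract_def
proof (rule the_equality)
  fix z' assume "\<exists>p' q'. q' \<noteq> 0 \<and> Fract p q = Fract p' q' \<and> z' = Fract (act_algebra w p') (act_algebra w q')"
  then obtain p' q' where pq': "q' \<noteq> 0" "Fract p q = Fract p' q'"
    "z' = Fract (act_algebra w p') (act_algebra w q')" by blast
  have "p * q' = p' * q" using q pq' by (simp add: eq_fract)
  then have "act_algebra w p * act_algebra w q' = act_algebra w p' * act_algebra w q"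
    by (simp add: w flip: act_algebra_mult)
  then show "z' = Fract (act_algebra w p) (act_algebra w q)"
    using w q pq' by (simp add: eq_fract)
qed (use q in blast)

end


section \<open>Numerators and denominators\<close>

text \<open>
  With \<open>X = Z\<^bsup>-\<beta>\<^esup>\<close> the function \<open>\<zeta>\<close> of the coroot \<open>\<beta>\<close> with parameters \<open>s\<close>, \<open>s'\<close> is
  \<open>(1 - s s' X) (1 + s / s' X) / (1 - X\<^sup>2)\<close>, in which the factor \<open>1 + X\<close> cancels if \<open>s = s'\<close>.
\<close>

definition den_exp :: "complex \<Rightarrow> complex \<Rightarrow> int" where
  "den_exp s s' = (if s = s' then 1 else 2)"

definition den_at :: "complex \<Rightarrow> complex \<Rightarrow> 'y \<Rightarrow> 'y::finite_free_ab_group group_algebra" where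
  "den_at s s' \<beta> = 1 - monomial 1 (- zscale (den_exp s s') \<beta>)"

definition num_at :: "complex \<Rightarrow> complex \<Rightarrow> 'y \<Rightarrow> 'y::finite_free_ab_group group_algebra" where
  "num_at s s' \<beta> = (if s = s' then 1 - monomial (s\<^sup>2) (- \<beta>)
     else (1 - monomial (s * s') (- \<beta>)) * (1 + monomial (s / s') (- \<beta>)))"

lemma den_at_nonzero:
  assumes "\<beta> \<noteq> 0" shows "den_at s s' \<beta> \<noteq> 0"
proof
  assume "den_at s s' \<beta> = 0"
  then have "monomial 1 (- zscale (den_exp s s') \<beta>) = monomial 1 0" by (simp add: den_at_def)
  then have "coeff_at (monomial 1 (- zscale (den_exp s s') \<beta>)) 0 = coeff_at (monomial 1 (0 :: 'a)) 0"
    by (simp only:)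
  then show False using assms
    by (simp add: coeff_at_monomial den_exp_def del: monomial_1_0 split: if_splits)
qed

lemma monomial_square: "monomial 1 (- zscale 2 \<beta>) = monomial 1 (- \<beta>) * monomial 1 (- \<beta>)"
  for \<beta> :: "'y::finite_free_ab_group"
  using zscale_add_left[of 1 1 \<beta>] by (simp add: monomial_mult)

lemma monomial_const_mult: "monomial c \<mu> = monomial c 0 * monomial 1 \<mu>"
  by (simp add: monomial_mult)

lemma const_mult_inverse: "c \<noteq> 0 \<Longrightarrow> monomial c 0 * monomial (inverse c) 0 = 1"
  by (simp add: monomial_mult)

text \<open>The zeros of the numerator in \<open>X\<close> differ from those of the denominator by
  the conditions on the parameters. Unlike coprimality alone, the explicit identity survives
  evaluation at any character.\<close>

lemma num_den_bezout:
  fixes \<beta> :: "'y::finite_free_ab_group"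
  assumes s: "s \<noteq> 0" "s' \<noteq> 0" "norm s > 1" and gen: "s' \<notin> {inverse s, - s, - inverse s}"
  shows "\<exists>u v. u * num_at s s' \<beta> + v * den_at s s' \<beta> = 1"
proof (cases "s = s'")
  case True
  have "s\<^sup>2 \<noteq> 1"
    using s(3) by (auto simp: power2_eq_1_iff)
  then have c: "monomial (inverse (1 - s\<^sup>2)) 0 * (1 - monomial (s\<^sup>2) 0) = (1 :: 'y group_algebra)"
    using const_mult_inverse[of "1 - s\<^sup>2", where 'a = 'y]
    by (simp add: monomial_diff mult.commute)
  have "(1 - monomial (s\<^sup>2) (- \<beta>)) - monomial (s\<^sup>2) 0 * (1 - monomial 1 (- \<beta>)) = 1 - monomial (s\<^sup>2) 0"
    by (simp add: right_diff_distrib monomial_mult)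
  then have "monomial (inverse (1 - s\<^sup>2)) 0 * (num_at s s' \<beta> - monomial (s\<^sup>2) 0 * den_at s s' \<beta>) = 1"
    using c unfolding num_at_def den_at_def den_exp_def if_P[OF True] zmod.scale_one by (simp only:)
  then have "monomial (inverse (1 - s\<^sup>2)) 0 * num_at s s' \<beta> +
      (- monomial (inverse (1 - s\<^sup>2)) 0 * monomial (s\<^sup>2) 0) * den_at s s' \<beta> = 1"
    by (simp add: algebra_simps)
  then show ?thesis by blast
next
  case False
  define X where "X = monomial 1 (- \<beta>)"
  \<comment> \<open>With \<open>c\<close> the coefficient, \<open>(1 - c X) (1 + c X)\<close> and
    \<open>1 - X^2\<close> combine to the constant \<open>1 - c^2\<close>.\<close>
  have lin: "\<exists>u v. u * (1 - monomial c (- \<beta>)) + v * (1 - X * X) = 1" if c: "c * c \<noteq> 1" for c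
  proof -
    let ?k = "monomial (inverse (1 - c * c)) (0 :: 'y)"
    have X: "monomial c (- \<beta>) = monomial c 0 * X"
      unfolding X_def by (rule monomial_const_mult)
    have k: "?k * (1 - monomial c 0 * monomial c 0) = 1"
      using const_mult_inverse[of "1 - c * c", where 'a = 'y] c
      by (simp add: monomial_diff monomial_mult mult.commute)
    have "(?k * (1 + monomial c 0 * X)) * (1 - monomial c 0 * X)
        + (- ?k * monomial c 0 * monomial c 0) * (1 - X * X) = ?k * (1 - monomial c 0 * monomial c 0)"
      by (simp add: algebra_simps)
    then show ?thesis unfolding X k by blast
  qed
  \<comment> \<open>The first factor excludes two of the forbidden values of \<open>s'\<close>; the
    second one below excludes \<open>- s\<close>, and \<open>s\<close> itself by the case
    distinction.\<close>
  have "s * s' * (s * s') \<noteq> 1"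
  proof
    assume "s * s' * (s * s') = 1"
    then have "s * s' = 1 \<or> s * s' = - 1" by (simp add: square_eq_1_iff)
    then show False using gen s by (auto simp: field_simps)
  qed
  then obtain u1 v1 where 1: "u1 * (1 - monomial (s * s') (- \<beta>)) + v1 * (1 - X * X) = 1" using lin by blast
  have "(- (s / s')) * (- (s / s')) \<noteq> 1"
  proof
    assume "(- (s / s')) * (- (s / s')) = 1"
    then have "- (s / s') = 1 \<or> - (s / s') = - 1" by (simp only: square_eq_1_iff)
    then have "s / s' = - 1 \<or> s / s' = 1" by (metis add.inverse_inverse)
    then show False using gen s False by (auto simp: field_simps)
  qed
  then obtain u2 v2 where 2: "u2 * (1 - monomial (- (s / s')) (- \<beta>)) + v2 * (1 - X * X) = 1" using lin by blast
  define N1 N2 D where "N1 = 1 - monomial (s * s') (- \<beta>)" and "N2 = 1 - monomial (- (s / s')) (- \<beta>)"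
    and "D = 1 - X * X"
  have "(u1 * N1 + v1 * D) * (u2 * N2 + v2 * D) = 1" using 1 2 by (simp add: N1_def N2_def D_def)
  then have "(u1 * u2) * (N1 * N2) + (u1 * N1 * v2 + v1 * u2 * N2 + v1 * v2 * D) * D = 1"
    by (simp add: algebra_simps)
  moreover have "num_at s s' \<beta> = N1 * N2" "den_at s s' \<beta> = D"
    using False by (simp_all add: num_at_def den_at_def den_exp_def N1_def N2_def D_def X_def
        monomial_square monomial_uminus)
  ultimately show ?thesis by metis
qed

text \<open>Divided by the denominators: \<zeta> of the coroot plus \<zeta> of its negative is
  \<open>1 + s^2\<close>. This is what makes the square of the intertwiner lie in the group
  algebra.\<close>

lemma num_den_identity:
  fixes \<beta> :: "'y::finite_free_ab_group"
  assumes "s \<noteq> 0" "s' \<noteq> 0"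
  shows "den_at s s' (- \<beta>) * num_at s s' \<beta> + den_at s s' \<beta> * num_at s s' (- \<beta>)
    = monomial (1 + s\<^sup>2) 0 * (den_at s s' \<beta> * den_at s s' (- \<beta>))"
proof -
  define X X' where "X = monomial 1 (- \<beta>)" and "X' = monomial 1 \<beta>"
  have XX: "X * X' = 1" by (simp add: X_def X'_def monomial_mult)
  define S S' T' where "S = monomial s (0 :: 'y)" and "S' = monomial s' (0 :: 'y)" and "T' = monomial (inverse s') (0 :: 'y)"
  have ST: "S' * T' = 1" using assms by (simp add: S'_def T'_def monomial_mult)
  have mono: "monomial c (- \<beta>) = monomial c 0 * X" "monomial c \<beta> = monomial c 0 * X'" for c
    unfolding X_def X'_def by (rule monomial_const_mult)+
  have cst: "monomial (s\<^sup>2) 0 = S * S" "monomial (s * s') 0 = S * S'" "monomial (s / s') 0 = S * T'"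
    "monomial (1 + s\<^sup>2) 0 = 1 + S * S"
    by (simp_all add: S_def S'_def T'_def monomial_mult power2_eq_square divide_inverse monomial_add)
  have sq: "monomial 1 (- zscale 2 \<beta>) = X * X" "monomial 1 (zscale 2 \<beta>) = X' * X'"
    using monomial_square[of \<beta>] monomial_square[of "- \<beta>"] by (simp_all add: X_def X'_def)
  show ?thesis
  proof (cases "s = s'")
    case True
    have "(1 - X') * (1 - S * S * X) + (1 - X) * (1 - S * S * X') =
        (1 + S * S) * ((1 - X) * (1 - X')) + (S * S - 1) * (X * X' - 1)"
      by (simp add: algebra_simps)
    then show ?thesis
      unfolding num_at_def den_at_def den_exp_def if_P[OF True] by (simp add: mono cst XX)
  next
    case False
    have "(1 - X' * X') * ((1 - S * S' * X) * (1 + S * T' * X)) + (1 - X * X) * ((1 - S * S' * X') * (1 + S * T' * X')) =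
        (1 + S * S * (S' * T')) * ((1 - X * X) * (1 - X' * X')) + (1 - X * X') * ((S * T' - S * S') * (X + X'))
        + (S * S * (S' * T') - 1) * ((X * X') * (X * X') - 1)"
      by (simp add: algebra_simps)
    then show ?thesis
      using False unfolding num_at_def den_at_def den_exp_def XX ST by (simp add: mono cst sq)
  qed
qed

lemma ev_den_at: "\<tau> \<in> torus \<Longrightarrow> ev \<tau> (den_at s s' \<beta>) = 0 \<longleftrightarrow> \<tau> (zscale (den_exp s s') \<beta>) = 1"
  by (simp add: den_at_def ev_diff torus_minus)

lemma ev_den_at_minus: "\<tau> \<in> torus \<Longrightarrow> ev \<tau> (den_at s s' (- \<beta>)) = 0 \<longleftrightarrow> ev \<tau> (den_at s s' \<beta>) = 0"
  by (simp add: ev_den_at torus_minus)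

text \<open>For positive \<open>k\<close> the quotient is minus a geometric sum of \<open>k\<close>
  terms, each of value 1 where \<open>u\<close> has value 1.\<close>

lemma one_minus_monomial_dvd:
  fixes u :: "'y::finite_free_ab_group"
  obtains q where "(1 - monomial 1 u) * q = monomial 1 (zscale k u) - 1"
    "\<And>\<tau>. \<tau> \<in> torus \<Longrightarrow> \<tau> u = 1 \<Longrightarrow> ev \<tau> q = - of_int k"
proof -
  have "\<exists>q. (1 - monomial 1 u) * q = monomial 1 (zscale k u) - 1 \<and>
      (\<forall>\<tau>\<in>torus. \<tau> u = 1 \<longrightarrow> ev \<tau> q = - of_int k)"
  proof (induction k rule: int_induct[where k = 0])
    case base
    show ?case by (intro exI[of _ 0]) simp
  next
    case (step1 k)
    then obtain q where q: "(1 - monomial 1 u) * q = monomial 1 (zscale k u) - 1"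
      "\<forall>\<tau>\<in>torus. \<tau> u = 1 \<longrightarrow> ev \<tau> q = - of_int k" by blast
    have "(1 - monomial 1 u) * (monomial 1 u * q - 1) = monomial 1 u * ((1 - monomial 1 u) * q) - (1 - monomial 1 u)"
      by (simp add: algebra_simps)
    also have "\<dots> = monomial 1 (zscale (k + 1) u) - 1"
      unfolding q(1) by (simp add: algebra_simps monomial_mult zmod.scale_left_distrib)
    finally show ?case using q(2)
      by (intro exI[of _ "monomial 1 u * q - 1"]) (simp add: ev_diff ev_mult)
  next
    case (step2 k)
    then obtain q where q: "(1 - monomial 1 u) * q = monomial 1 (zscale k u) - 1"
      "\<forall>\<tau>\<in>torus. \<tau> u = 1 \<longrightarrow> ev \<tau> q = - of_int k" by blast
    have "(1 - monomial 1 u) * (monomial 1 (- u) * (q + 1)) =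
        monomial 1 (- u) * ((1 - monomial 1 u) * q + (1 - monomial 1 u))"
      by (simp add: algebra_simps)
    also have "\<dots> = monomial 1 (zscale (k - 1) u) - 1"
      unfolding q(1) by (simp add: algebra_simps monomial_mult zmod.scale_left_diff_distrib)
    finally show ?case using q(2)
      by (intro exI[of _ "monomial 1 (- u) * (q + 1)"]) (simp add: ev_add ev_mult torus_minus)
  qed
  then show ?thesis using that by blast
qed

context hecke_parameters
begin

definition den :: "'i \<Rightarrow> 'y group_algebra" where
  "den i = den_at (\<sigma> i) (\<sigma>' i) (\<alpha>v i)"

definition num :: "'i \<Rightarrow> 'y group_algebra" where
  "num i = num_at (\<sigma> i) (\<sigma>' i) (\<alpha>v i)"

lemma act_den_at: "w \<in> W \<Longrightarrow> act_algebra w (den_at s s' \<beta>) = den_at s s' (w \<beta>)"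
  by (simp add: den_at_def act_algebra_diff W_minus W_zscale)

lemma act_num_at: "w \<in> W \<Longrightarrow> act_algebra w (num_at s s' \<beta>) = num_at s s' (w \<beta>)"
  by (simp add: num_at_def act_algebra_diff act_algebra_add act_algebra_mult W_minus)

lemma den_nonzero [simp]: "den i \<noteq> 0"
  by (simp add: den_def den_at_nonzero)

lemma parameters_bezout: "\<exists>u v. u * num_at (\<sigma> i) (\<sigma>' i) \<beta> + v * den_at (\<sigma> i) (\<sigma>' i) \<beta> = 1"
  by (rule num_den_bezout) (use \<sigma>_nonzero \<sigma>'_nonzero \<sigma>_norm \<sigma>'_generic in auto)

lemma ev_num_nonzero_of_den:
  assumes "\<tau> \<in> torus" "ev \<tau> (den i) = 0"
  shows "ev \<tau> (num i) \<noteq> 0"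
proof
  assume n: "ev \<tau> (num i) = 0"
  obtain u v where "u * num i + v * den i = 1" using parameters_bezout unfolding num_def den_def by blast
  then have "ev \<tau> (u * num i + v * den i) = 1" using assms by simp
  then show False using assms n by (simp add: ev_add ev_mult)
qed

lemma num_den_refl_identity:
  "act_algebra (refl i) (den i) * num i + den i * act_algebra (refl i) (num i)
    = monomial (1 + (\<sigma> i)\<^sup>2) 0 * (den i * act_algebra (refl i) (den i))"
  using num_den_identity[OF \<sigma>_nonzero \<sigma>'_nonzero, of i i "\<alpha>v i"]
  by (simp add: num_def den_def act_den_at act_num_at)

lemma ev_act_refl_den:
  assumes "\<tau> \<in> torus"
  shows "ev (torus_act (refl i) \<tau>) (den i) = 0 \<longleftrightarrow> ev \<tau> (den i) = 0"
  using assms by (simp add: ev_torus_act_refl den_def act_den_at ev_den_at_minus)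

text \<open>The image of a simple root contains 2, its value at its own coroot. If it contained an
  odd number it would be everything, which forces equal parameters.\<close>

lemma den_exp_dvd_pairing: "den_exp (\<sigma> i) (\<sigma>' i) dvd pairing (\<alpha> i) y"
proof (cases "\<sigma> i = \<sigma>' i")
  case False
  have "even (pairing (\<alpha> i) y)"
  proof (rule ccontr)
    assume "odd (pairing (\<alpha> i) y)"
    then obtain k where k: "pairing (\<alpha> i) y = 2 * k + 1" by (auto elim: oddE)
    have "n \<in> range (pairing (\<alpha> i))" for n
    proof
      show "n = pairing (\<alpha> i) (zscale n (y - zscale k (\<alpha>v i)))" by (simp add: pairing_diff k)
    qed simp
    then show False using \<sigma>_eq_\<sigma>' False by blast
  qed
  then show ?thesis by (simp add: den_exp_def)
qed (simp add: den_exp_def)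

text \<open>\<open>refl i y - y\<close> is an integral multiple of \<open>den_exp\<close> times the
  coroot, and \<tau> has the value 1 there.\<close>

lemma torus_act_refl_eq:
  assumes "\<tau> \<in> torus" "ev \<tau> (den i) = 0"
  shows "torus_act (refl i) \<tau> = \<tau>"
proof
  fix y
  obtain k where k: "pairing (\<alpha> i) y = k * den_exp (\<sigma> i) (\<sigma>' i)"
    using den_exp_dvd_pairing by (metis dvdE mult.commute)
  have "\<tau> (zscale (pairing (\<alpha> i) y) (\<alpha>v i)) = 1"
    unfolding k zscale_mult[symmetric]
    by (rule torus_zscale_eq_1) (use assms in \<open>simp_all add: den_def ev_den_at\<close>)
  then show "torus_act (refl i) \<tau> y = \<tau> y"
    using assms by (simp add: torus_act_refl refl_def torus_diff)
qed

lemma ev_den_refl_fixed: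
  assumes "\<tau> \<in> torus" "ev \<tau> (den i) = 0"
  shows "ev \<tau> (act_algebra (refl i) p) = ev \<tau> p"
  using torus_act_refl_eq[OF assms] by (metis ev_torus_act_refl)

text \<open>The divided difference of a monomial. Its value at a zero of the denominator is, up to a
  constant, the root at \<mu> times the character, which is where roots enter the action of the
  group algebra.\<close>

lemma den_dvd_refl_diff:
  obtains q where "den i * q = monomial 1 (refl i \<mu>) - monomial 1 \<mu>"
    "\<And>\<tau>. \<tau> \<in> torus \<Longrightarrow> ev \<tau> (den i) = 0 \<Longrightarrow>
       ev \<tau> q = - of_int (pairing (\<alpha> i) \<mu> div den_exp (\<sigma> i) (\<sigma>' i)) * \<tau> \<mu>"
proof -
  let ?e = "den_exp (\<sigma> i) (\<sigma>' i)"
  define k where "k = pairing (\<alpha> i) \<mu> div ?e"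
  have k: "k * ?e = pairing (\<alpha> i) \<mu>" using den_exp_dvd_pairing by (simp add: k_def)
  obtain q where q: "(1 - monomial 1 (- zscale ?e (\<alpha>v i))) * q = monomial 1 (zscale k (- zscale ?e (\<alpha>v i))) - 1"
    "\<And>\<tau>. \<tau> \<in> torus \<Longrightarrow> \<tau> (- zscale ?e (\<alpha>v i)) = 1 \<Longrightarrow> ev \<tau> q = - of_int k"
    using one_minus_monomial_dvd[of "- zscale ?e (\<alpha>v i)" k] by blast
  show ?thesis
  proof
    have "den i * (monomial 1 \<mu> * q) = monomial 1 \<mu> * ((1 - monomial 1 (- zscale ?e (\<alpha>v i))) * q)"
      by (simp add: den_def den_at_def ac_simps)
    also have "\<dots> = monomial 1 (refl i \<mu>) - monomial 1 \<mu>"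
      unfolding q(1) by (simp add: refl_def right_diff_distrib monomial_mult zscale_mult k)
    finally show "den i * (monomial 1 \<mu> * q) = monomial 1 (refl i \<mu>) - monomial 1 \<mu>" .
    fix \<tau> :: "'y \<Rightarrow> complex" assume "\<tau> \<in> torus" "ev \<tau> (den i) = 0"
    then show "ev \<tau> (monomial 1 \<mu> * q) = - of_int (pairing (\<alpha> i) \<mu> div ?e) * \<tau> \<mu>"
      using q(2)[of \<tau>] by (simp add: ev_mult den_def ev_den_at torus_minus k_def)
  qed
qed

text \<open>The definition of \<zeta>, with \<open>num / den\<close> substituted for it and
  denominators cleared.\<close>

lemma Q_times_den:
  "to_fract (den i) * (const_fract (\<sigma> i) * Q i) = to_fract (monomial ((\<sigma> i)\<^sup>2) 0 * den i - num i)"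
proof -
  define s s' where "s = \<sigma> i" and "s' = \<sigma>' i"
  have nz: "s \<noteq> 0" "s' \<noteq> 0" by (simp_all add: s_def s'_def \<sigma>_nonzero \<sigma>'_nonzero)
  define X where "X = monomial 1 (- \<alpha>v i)"
  define S T S' T' where "S = monomial s (0 :: 'y)" and "T = monomial (inverse s) (0 :: 'y)"
    and "S' = monomial s' (0 :: 'y)" and "T' = monomial (inverse s') (0 :: 'y)"
  have ST: "S * T = 1" "S' * T' = 1" using nz by (simp_all add: S_def T_def S'_def T'_def monomial_mult)
  have sq: "monomial 1 (- zscale 2 (\<alpha>v i)) = X * X"
    using monomial_square[of "\<alpha>v i"] by (simp add: X_def)
  \<comment> \<open>The parameters 0 and 1 only serve to be distinct, so that the exponent in
    \<open>den_at\<close> is 2.\<close>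
  have D: "1 - X * X \<noteq> 0" using den_at_nonzero[of "\<alpha>v i" 0 1] by (simp add: den_at_def den_exp_def sq)
  then have D': "to_fract (1 - X * X) \<noteq> 0" by (metis to_fract_eq_0_iff)
  have cst: "monomial (s\<^sup>2) 0 = S * S" "monomial (s - inverse s) 0 = S - T" "monomial (s' - inverse s') 0 = S' - T'"
    by (simp_all add: S_def S'_def T_def T'_def monomial_mult power2_eq_square monomial_diff)
  have mono: "monomial c (- \<alpha>v i) = monomial c 0 * X" for c
    unfolding X_def by (rule monomial_const_mult)
  have cst': "monomial (s * s') 0 = S * S'" "monomial (s / s') 0 = S * T'"
    by (simp_all add: S_def S'_def T'_def monomial_mult divide_inverse)
  have "Q i = to_fract ((S - T) + (S' - T') * X) / to_fract (1 - X * X)"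
    unfolding Q_def const_fract_def Z_fract_def X_def[symmetric] s_def[symmetric] s'_def[symmetric] cst
    by (simp add: sq)
  then have "Q i * to_fract (1 - X * X) = to_fract ((S - T) + (S' - T') * X)"
    using D' by (simp del: to_fract_diff to_fract_add)
  then have Q: "const_fract s * Q i * to_fract (1 - X * X) = to_fract (S * ((S - T) + (S' - T') * X))"
    by (simp add: const_fract_def S_def ac_simps)
  have "den i * (S * ((S - T) + (S' - T') * X)) = (S * S * den i - num i) * (1 - X * X)"
  proof (cases "s = s'")
    case True
    then have eq: "S' = S" "T' = T" by (simp_all add: S_def S'_def T_def T'_def)
    have "(1 - X) * (S * ((S - T) + (S - T) * X)) =
        (S * S * (1 - X) - (1 - S * S * X)) * (1 - X * X) + (1 - S * T) * (1 - X * X)"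
      by (simp add: algebra_simps)
    then show ?thesis
      unfolding den_def num_def s_def[symmetric] s'_def[symmetric] den_at_def num_at_def den_exp_def if_P[OF True]
      by (simp add: mono cst X_def[symmetric] ST eq)
  next
    case False
    have "(1 - X * X) * (S * ((S - T) + (S' - T') * X)) =
        (S * S * (1 - X * X) - (1 - S * S' * X) * (1 + S * T' * X)) * (1 - X * X)
        + (1 - X * X) * ((1 - S * T) + S * S * X * X * (1 - S' * T'))"
      by (simp add: algebra_simps)
    then show ?thesis using False
      unfolding den_def num_def s_def[symmetric] s'_def[symmetric] den_at_def num_at_def den_exp_def ST
      by (simp add: mono cst cst' sq)
  qed
  then have "to_fract (den i) * (const_fract s * Q i) * to_fract (1 - X * X) =
      to_fract (S * S * den i - num i) * to_fract (1 - X * X)"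
    by (simp only: mult.assoc Q[unfolded mult.assoc] flip: to_fract_mult)
  then show ?thesis using D' by (simp add: s_def[symmetric] cst)
qed

lemma \<zeta>_simple_eq: "\<zeta>_simple i = Fract (num i) (den i)"
proof -
  have "to_fract (den i) * \<zeta>_simple i = to_fract (num i)"
  proof -
    have "to_fract (den i) * \<zeta>_simple i =
        to_fract (den i) * const_fract ((\<sigma> i)\<^sup>2) - to_fract (den i) * (const_fract (\<sigma> i) * Q i)"
      by (simp add: \<zeta>_simple_def algebra_simps)
    then show ?thesis unfolding Q_times_den by (simp add: const_fract_def mult.commute)
  qed
  then have "\<zeta>_simple i = to_fract (num i) / to_fract (den i)"
    by (simp add: field_simps)
  then show ?thesis by (simp add: Fract_conv_to_fract)
qed

end

text \<open>Compares an arbitrary choice of coprime numerator and denominator with the explicit one: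
  the Bezout identity makes \<open>D\<close> divide \<open>d\<close>, and coprimality makes the
  cofactor a unit.\<close>

lemma coprime_fraction_unique:
  fixes N D n d u v :: "'a::algebraic_semidom"
  assumes "u * N + v * D = 1" "D \<noteq> 0" "coprime n d" "n * D = N * d"
  obtains e where "is_unit e" "n = N * e" "d = D * e"
proof -
  have "D dvd u * (N * d) + v * D * d" using assms(4)[symmetric] by simp
  also have "u * (N * d) + v * D * d = (u * N + v * D) * d" by (simp add: algebra_simps)
  finally have "D dvd d" using assms(1) by simp
  then obtain e where d: "d = D * e" by blast
  have "D * n = D * (N * e)" using assms(4) by (simp add: d ac_simps)
  then have n: "n = N * e" using assms(2) by simp
  have "is_unit e" using assms(3) by (rule coprime_common_divisor) (simp_all add: n d)
  then show ?thesis using that n d by blast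
qed

section \<open>The two conditions of the theorem in terms of simple numerators and
  denominators\<close>

locale rank_two_parameters = hecke_parameters A pairing \<alpha> \<alpha>v \<sigma> \<sigma>' + rank_two_system A pairing \<alpha> \<alpha>v a b
  for A :: "'i::finite \<Rightarrow> 'i \<Rightarrow> int"
    and pairing :: "'x::finite_free_ab_group \<Rightarrow> 'y::finite_free_ab_group \<Rightarrow> int"
    and \<alpha> :: "'i \<Rightarrow> 'x"
    and \<alpha>v :: "'i \<Rightarrow> 'y"
    and \<sigma> \<sigma>' :: "'i \<Rightarrow> complex"
    and a b :: 'i
begin

lemma conj_parameters:
  assumes "w \<in> W" "w \<circ> refl i \<circ> inv_into UNIV w = refl j"
  shows "\<sigma> i = \<sigma> j" "\<sigma>' i = \<sigma>' j"
proof -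
  have "\<sigma> i = \<sigma> j \<and> \<sigma>' i = \<sigma>' j"
  proof (cases "i = j")
    case False
    then have "odd (group.ord (BijGroup UNIV) (refl i \<circ> refl j))"
      using ord_refl_mult conj_simple_odd_per[OF assms] by simp
    then show ?thesis using \<sigma>_odd_order[OF False] by metis
  qed simp
  then show "\<sigma> i = \<sigma> j" "\<sigma>' i = \<sigma>' j" by simp_all
qed

lemma conj_refl_transfer:
  assumes w: "w \<in> W" "w' \<in> W"
    and eq: "w \<circ> refl i \<circ> inv_into UNIV w = w' \<circ> refl j \<circ> inv_into UNIV w'"
  shows "(inv_into UNIV w' \<circ> w) \<circ> refl i \<circ> inv_into UNIV (inv_into UNIV w' \<circ> w) = refl j"
proof -
  have "(inv_into UNIV w' \<circ> w) \<circ> refl i \<circ> inv_into UNIV (inv_into UNIV w' \<circ> w) =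
      inv_into UNIV w' \<circ> (w \<circ> refl i \<circ> inv_into UNIV w) \<circ> w'"
    using w by (simp add: o_inv_distrib W_subset_bij W_inv comp_assoc)
  also have "\<dots> = refl j" unfolding eq using w by (simp add: fun_eq_iff)
  finally show ?thesis .
qed

lemma coroot_parameters:
  assumes "w \<in> W" "w' \<in> W" "w (\<alpha>v i) = w' (\<alpha>v j)"
  shows "\<sigma> i = \<sigma> j" "\<sigma>' i = \<sigma>' j"
  using conj_parameters[OF _ conj_refl_transfer[OF assms(1,2) coroot_determines_refl[OF assms]]] assms
  by (simp_all add: W_comp W_inv)

text \<open>Independence of the presentation of the coroot: two presentations belong to conjugate
  simple reflections, hence to equal parameters, and \<open>num_at\<close>, \<open>den_at\<close>
  depend on nothing but the parameters and the coroot.\<close>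

lemma \<zeta>_eq:
  assumes "w \<in> W"
  shows "\<zeta> (w (\<alpha>v i)) = Fract (act_algebra w (num i)) (act_algebra w (den i))"
  unfolding \<zeta>_def
proof (rule the_equality)
  show "\<exists>w'\<in>W. \<exists>j. w (\<alpha>v i) = w' (\<alpha>v j) \<and>
      Fract (act_algebra w (num i)) (act_algebra w (den i)) = act_fract w' (\<zeta>_simple j)"
    using assms by (intro bexI[of _ w] exI[of _ i]) (simp_all add: \<zeta>_simple_eq act_fract_Fract)
  fix z assume "\<exists>w'\<in>W. \<exists>j. w (\<alpha>v i) = w' (\<alpha>v j) \<and> z = act_fract w' (\<zeta>_simple j)"
  then obtain w' j where w': "w' \<in> W" "w (\<alpha>v i) = w' (\<alpha>v j)" "z = act_fract w' (\<zeta>_simple j)" by blast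
  have "\<sigma> i = \<sigma> j" "\<sigma>' i = \<sigma>' j" using coroot_parameters assms w' by blast+
  moreover have "z = Fract (act_algebra w' (num j)) (act_algebra w' (den j))"
    using w' by (simp add: \<zeta>_simple_eq act_fract_Fract)
  ultimately show "z = Fract (act_algebra w (num i)) (act_algebra w (den i))"
    using w' assms by (simp add: num_def den_def act_num_at act_den_at)
qed

lemma \<zeta>_num_den_eq:
  assumes w: "w \<in> W"
  obtains e where "is_unit e" "\<zeta>_num (w (\<alpha>v i)) = act_algebra w (num i) * e"
    "\<zeta>_den (w (\<alpha>v i)) = act_algebra w (den i) * e"
proof -
  let ?N = "act_algebra w (num i)" and ?D = "act_algebra w (den i)"
  have D: "?D \<noteq> 0" using w by simp
  obtain u v where uv: "u * ?N + v * ?D = 1"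
    using parameters_bezout[of i "w (\<alpha>v i)"] w unfolding num_def den_def by (auto simp: act_num_at act_den_at)
  have "coprime ?N ?D"
  proof (rule coprimeI)
    fix c assume "c dvd ?N" "c dvd ?D"
    then have "c dvd u * ?N + v * ?D" by simp
    then show "is_unit c" by (simp only: uv)
  qed
  then have "\<exists>p. case p of (n, d) \<Rightarrow> d \<noteq> 0 \<and> coprime n d \<and> \<zeta> (w (\<alpha>v i)) = Fract n d"
    using D \<zeta>_eq[OF w] by (intro exI[of _ "(?N, ?D)"]) simp
  then have "case \<zeta>_num_den (w (\<alpha>v i)) of (n, d) \<Rightarrow> d \<noteq> 0 \<and> coprime n d \<and> \<zeta> (w (\<alpha>v i)) = Fract n d"
    unfolding \<zeta>_num_den_def by (rule someI_ex)
  then have nd: "\<zeta>_den (w (\<alpha>v i)) \<noteq> 0" "coprime (\<zeta>_num (w (\<alpha>v i))) (\<zeta>_den (w (\<alpha>v i)))"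
    "Fract ?N ?D = Fract (\<zeta>_num (w (\<alpha>v i))) (\<zeta>_den (w (\<alpha>v i)))"
    using \<zeta>_eq[OF w] by (simp_all add: \<zeta>_num_def \<zeta>_den_def split_beta)
  have "\<zeta>_num (w (\<alpha>v i)) * ?D = ?N * \<zeta>_den (w (\<alpha>v i))"
    using nd(3) D nd(1) by (simp add: eq_fract)
  with coprime_fraction_unique[OF uv D nd(2)] that show ?thesis by metis
qed

lemma ev_\<zeta>_num: "\<tau> \<in> torus \<Longrightarrow> w \<in> W \<Longrightarrow>
    ev \<tau> (\<zeta>_num (w (\<alpha>v i))) = 0 \<longleftrightarrow> ev (torus_act (inv_into UNIV w) \<tau>) (num i) = 0"
  and ev_\<zeta>_den: "\<tau> \<in> torus \<Longrightarrow> w \<in> W \<Longrightarrow>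
    ev \<tau> (\<zeta>_den (w (\<alpha>v i))) = 0 \<longleftrightarrow> ev (torus_act (inv_into UNIV w) \<tau>) (den i) = 0"
  by (rule \<zeta>_num_den_eq[of w i]; simp add: ev_mult ev_unit ev_torus_act W_inv)+

text \<open>The Weyl group element moves from the coroot to the character, the form in which the
  intertwiners meet the condition.\<close>

lemma U_set_iff:
  assumes "\<tau> \<in> torus"
  shows "\<tau> \<in> U_set \<longleftrightarrow> (\<forall>w\<in>W. \<forall>i. ev (torus_act w \<tau>) (num i) \<noteq> 0)"
proof -
  have "\<tau> \<in> U_set \<longleftrightarrow> (\<forall>w\<in>W. \<forall>i. ev \<tau> (\<zeta>_num (w (\<alpha>v i))) \<noteq> 0)"
    using assms unfolding U_set_def coroots_def by blast
  also have "\<dots> \<longleftrightarrow> (\<forall>w\<in>W. \<forall>i. ev (torus_act (inv_into UNIV w) \<tau>) (num i) \<noteq> 0)"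
    using assms by (simp add: ev_\<zeta>_num)
  also have "\<dots> \<longleftrightarrow> (\<forall>w\<in>W. \<forall>i. ev (torus_act w \<tau>) (num i) \<noteq> 0)"
    using W_inv W_inv_inv by metis
  finally show ?thesis .
qed

lemma coroot_refl_eq:
  assumes "w \<in> W"
  shows "coroot_refl (w (\<alpha>v i)) = w \<circ> refl i \<circ> inv_into UNIV w"
  unfolding coroot_refl_def
proof (rule the_equality)
  fix r assume "\<exists>w'\<in>W. \<exists>j. w (\<alpha>v i) = w' (\<alpha>v j) \<and> r = w' \<circ> refl j \<circ> inv_into UNIV w'"
  then show "r = w \<circ> refl i \<circ> inv_into UNIV w"
    using coroot_determines_refl[OF assms] by metis
qed (use assms in blast)

lemma W_paren_eq:
  assumes "\<tau> \<in> torus"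
  shows "W_paren \<tau> = generate (BijGroup UNIV)
    {inv_into UNIV w \<circ> refl i \<circ> w |w i. w \<in> W \<and> ev (torus_act w \<tau>) (den i) = 0}"
proof -
  have "coroot_refl ` {\<beta> \<in> coroots. ev \<tau> (\<zeta>_den \<beta>) = 0} =
      {w \<circ> refl i \<circ> inv_into UNIV w |w i. w \<in> W \<and> ev (torus_act (inv_into UNIV w) \<tau>) (den i) = 0}"
    using assms by (force simp: coroots_def ev_\<zeta>_den coroot_refl_eq)
  also have "\<dots> = {inv_into UNIV w \<circ> refl i \<circ> w |w i. w \<in> W \<and> ev (torus_act w \<tau>) (den i) = 0}"
    using W_inv W_inv_inv by (intro Collect_cong) metis
  finally show ?thesis by (simp add: W_paren_def)
qed

end

section \<open>The Bernstein--Lusztig--Hecke algebra in rank two\<close>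

locale rank_two_hecke =
  BL_Hecke_algebra A pairing \<alpha> \<alpha>v \<sigma> \<sigma>' scl ZH + rank_two_parameters A pairing \<alpha> \<alpha>v \<sigma> \<sigma>' a b
  for A :: "'i::finite \<Rightarrow> 'i \<Rightarrow> int"
    and pairing :: "'x::finite_free_ab_group \<Rightarrow> 'y::finite_free_ab_group \<Rightarrow> int"
    and \<alpha> :: "'i \<Rightarrow> 'x"
    and \<alpha>v :: "'i \<Rightarrow> 'y"
    and \<sigma> \<sigma>' :: "'i \<Rightarrow> complex"
    and scl :: "complex \<Rightarrow> 'h::ring_1 \<Rightarrow> 'h"
    and ZH :: "'y \<Rightarrow> ('y \<Rightarrow> 'y) \<Rightarrow> 'h"
    and a b :: 'i
begin

abbreviation H :: "('y \<Rightarrow> 'y) \<Rightarrow> 'h" where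
  "H w \<equiv> ZH 0 w"

abbreviation sact :: "'i \<Rightarrow> 'y group_algebra \<Rightarrow> 'y group_algebra" where
  "sact i \<equiv> act_algebra (refl i)"

lemma ZH_eq: "w \<in> W \<Longrightarrow> ZH \<mu> w = ZH \<mu> id * H w"
  by (simp add: Z_mult_H)

lemma H_id [simp]: "H id = 1"
proof -
  define e where "e = H id"
  have "e * x = x" for x
  proof -
    have "x \<in> span (case_prod ZH ` (UNIV \<times> W))" by (simp add: basis_span)
    then show ?thesis
    proof (induction rule: span_induct_alt)
      case (step c y z)
      then obtain \<mu> w where y: "y = ZH \<mu> w" "w \<in> W" by auto
      have "e * y = y"
        by (simp add: e_def y ZH_eq[OF y(2), of \<mu>] Z_mult_Z flip: mult.assoc)
      then show ?case using step by (simp add: distrib_left scl_mult_right)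
    qed simp
  qed
  from this[of 1] show ?thesis by (simp add: e_def)
qed

lemma of_algebra_add: "of_algebra (p + q) = of_algebra p + of_algebra q"
  unfolding of_algebra_def evaluate_def
  by (rule sum_support_add[of "\<lambda>c \<mu>. scl c (ZH \<mu> id)"]) (simp_all add: scale_left_distrib)

lemma of_algebra_monomial: "of_algebra (monomial c \<mu>) = scl c (ZH \<mu> id)"
  unfolding of_algebra_def evaluate_def
  by (rule sum_support_monomial[of "\<lambda>c \<mu>. scl c (ZH \<mu> id)"]) simp

lemma of_algebra_0 [simp]: "of_algebra 0 = 0"
  using of_algebra_add[of 0 0] by simp

lemma of_algebra_1 [simp]: "of_algebra 1 = 1"
  using of_algebra_monomial[of 1 0] by simp

lemma of_algebra_uminus: "of_algebra (- p) = - of_algebra p"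
  using of_algebra_add[of p "- p"] by (simp add: add_eq_0_iff)

lemma of_algebra_diff: "of_algebra (p - q) = of_algebra p - of_algebra q"
  using of_algebra_add[of p "- q"] by (simp add: of_algebra_uminus)

lemma of_algebra_mult: "of_algebra (p * q) = of_algebra p * of_algebra q"
proof (induction p rule: group_algebra_induct)
  case (monomial c \<mu>)
  show ?case
    by (induction q rule: group_algebra_induct)
      (simp_all add: monomial_mult of_algebra_monomial Z_mult_Z scl_mult_left scl_mult_right
        distrib_left of_algebra_add)
qed (simp_all add: distrib_right of_algebra_add)

lemma of_algebra_const: "of_algebra (monomial c 0) = scl c 1"
  by (simp add: of_algebra_monomial)

lemma scl_eq_mult: "scl c x = of_algebra (monomial c 0) * x"
  by (simp add: of_algebra_const scl_mult_left)

lemma scl_of_algebra: "scl c (of_algebra p) = of_algebra (monomial c 0 * p)"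
  by (simp add: scl_eq_mult of_algebra_mult)

lemma of_algebra_commute: "of_algebra p * of_algebra q = of_algebra q * of_algebra p"
  by (metis mult.commute of_algebra_mult)

lemma left_basis_independent:
  assumes S: "finite S" "S \<subseteq> W" and zero: "(\<Sum>w\<in>S. of_algebra (q w) * H w) = 0" and w: "w \<in> S"
  shows "q w = 0"
proof (rule group_algebra_eqI)
  fix \<mu>
  let ?Z = "case_prod ZH"
  \<comment> \<open>The index \<mu> is added so that the coefficient in question occurs even when it
    lies outside the support.\<close>
  let ?T = "(\<lambda>(w, \<mu>). (\<mu>, w)) ` (SIGMA w:S. insert \<mu> (support (q w)))"
  define u where "u v = (case inv_into (UNIV \<times> W) ?Z v of (\<mu>, w) \<Rightarrow> coeff_at (q w) \<mu>)" for v
  have u: "u (ZH \<mu> w) = coeff_at (q w) \<mu>" if "w \<in> W" for \<mu> w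
    using inv_into_f_f[OF basis_inj, of "(\<mu>, w)"] that by (simp add: u_def)
  have T: "finite ?T" "?T \<subseteq> UNIV \<times> W" using S by auto
  have "(\<Sum>v\<in>?Z ` ?T. scl (u v) v) = (\<Sum>x\<in>?T. scl (u (?Z x)) (?Z x))"
    using basis_inj T(2) by (subst sum.reindex) (auto intro: inj_on_subset)
  also have "\<dots> = (\<Sum>(w, \<mu>)\<in>(SIGMA w:S. insert \<mu> (support (q w))). scl (u (ZH \<mu> w)) (ZH \<mu> w))"
    by (subst sum.reindex) (auto simp: inj_on_def case_prod_unfold)
  also have "\<dots> = (\<Sum>w\<in>S. \<Sum>\<mu>'\<in>insert \<mu> (support (q w)). scl (coeff_at (q w) \<mu>') (ZH \<mu>' w))"
    using S by (subst sum.Sigma[symmetric]) (auto simp: u subset_iff intro!: sum.cong)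
  also have "\<dots> = (\<Sum>w\<in>S. of_algebra (q w) * H w)"
  proof (rule sum.cong)
    fix w assume "w \<in> S"
    then have w: "w \<in> W" using S by blast
    have "(\<Sum>\<mu>'\<in>insert \<mu> (support (q w)). scl (coeff_at (q w) \<mu>') (ZH \<mu>' w)) =
        (\<Sum>\<mu>'\<in>support (q w). scl (coeff_at (q w) \<mu>') (ZH \<mu>' w))"
      by (rule sum.mono_neutral_right) (auto simp: in_support_iff)
    also have "\<dots> = of_algebra (q w) * H w"
      by (simp add: of_algebra_def evaluate_def sum_distrib_right scl_mult_left Z_mult_H[OF w])
    finally show "(\<Sum>\<mu>'\<in>insert \<mu> (support (q w)). scl (coeff_at (q w) \<mu>') (ZH \<mu>' w)) = of_algebra (q w) * H w" .
  qed simp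
  finally have sum: "(\<Sum>v\<in>?Z ` ?T. scl (u v) v) = 0" using zero by simp
  have "ZH \<mu> w \<in> ?Z ` ?T" using w by force
  then have "u (ZH \<mu> w) = 0"
    using independentD[OF basis_independent _ _ sum] T by blast
  then show "coeff_at (q w) \<mu> = coeff_at 0 \<mu>" using u w S by auto
qed


subsection \<open>Rescaled generators and intertwiners\<close>

text \<open>The quadratic relation for \<open>H (refl i)\<close> has the roots
  \<open>\<sigma> i\<close> and minus its inverse; rescaling and shifting turn them into 0 and
  \<open>- (1 + (\<sigma> i)^2)\<close>.\<close>

definition Kop :: "'i \<Rightarrow> 'h" where
  "Kop i = scl (\<sigma> i) (H (refl i)) - scl ((\<sigma> i)\<^sup>2) 1"

text \<open>The classical intertwiner \<open>Kop i\<close> plus \<zeta>, multiplied by the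
  denominator of \<zeta>.\<close>

definition Fop :: "'i \<Rightarrow> 'h" where
  "Fop i = of_algebra (den i) * Kop i + of_algebra (num i)"

lemma H_refl_mult:
  assumes "w \<in> W"
  shows "H (refl i) * H w = H (refl i \<circ> w) \<or>
    H (refl i) * H w = scl (\<sigma> i - inverse (\<sigma> i)) (H w) + H (refl i \<circ> w)"
  using len_refl_comp[OF assms, of i] H_mult_H_up[OF assms, of i] H_mult_H_down[OF assms, of i] by auto

lemma H_refl_square: "H (refl i) * H (refl i) = scl (\<sigma> i - inverse (\<sigma> i)) (H (refl i)) + 1"
  using H_mult_H_down[of "refl i" i] by simp

lemma Kop_square: "Kop i * Kop i = - scl (1 + (\<sigma> i)\<^sup>2) (Kop i)"
proof -
  define s T where "s = \<sigma> i" and "T = H (refl i)"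
  have K: "Kop i = scl s T - scl (s * s) 1" by (simp add: Kop_def s_def T_def power2_eq_square)
  have s: "s * (s - inverse s) - s * s = - 1"
    using \<sigma>_nonzero[of i] by (simp add: s_def right_diff_distrib)
  have "T * Kop i = scl s (T * T) - scl (s * s) T"
    by (simp add: K right_diff_distrib scl_mult_right)
  also have "\<dots> = scl (s * (s - inverse s) - s * s) T + scl s 1"
    unfolding T_def H_refl_square s_def
    by (simp add: scale_right_distrib scale_right_diff_distrib scale_left_diff_distrib right_diff_distrib)
  finally have "T * Kop i = - T + scl s 1" unfolding s by simp
  moreover have "Kop i * Kop i = scl s (T * Kop i) - scl (s * s) (Kop i)"
    by (subst K) (simp add: left_diff_distrib scl_mult_left)
  ultimately have "Kop i * Kop i = - (scl s T - scl (s * s) 1) - scl (s * s) (Kop i)"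
    by (simp add: scale_right_diff_distrib)
  then show ?thesis
    unfolding K[symmetric] by (simp add: scale_left_distrib s_def power2_eq_square)
qed

text \<open>The Bernstein--Lusztig relation for \<open>Kop i\<close>: the error \<open>e\<close> is
  \<zeta> times the difference of the reflected \<open>p\<close> and \<open>p\<close>, stated
  without fractions.\<close>

lemma ex_Kop_commute:
  "\<exists>e. Kop i * of_algebra p = of_algebra (sact i p) * Kop i + of_algebra e \<and> den i * e = num i * (sact i p - p)"
proof (induction p rule: group_algebra_induct)
  case (monomial c \<mu>)
  obtain p where p: "to_fract p = Q i * (Z_fract \<mu> - Z_fract (refl i \<mu>))"
    "H (refl i) * ZH \<mu> id - ZH (refl i \<mu>) id * H (refl i) = of_algebra p"
    using Bernstein_Lusztig unfolding of_algebra_def by blast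
  define d where "d = monomial 1 \<mu> - monomial 1 (refl i \<mu>)"
  define e where "e = monomial (\<sigma> i) 0 * p - monomial ((\<sigma> i)\<^sup>2) 0 * d"
  have od: "of_algebra d = ZH \<mu> id - ZH (refl i \<mu>) id"
    by (simp add: d_def of_algebra_diff of_algebra_monomial)
  have "to_fract (den i * e) = to_fract (den i) * (const_fract (\<sigma> i) * Q i) * to_fract d
      - to_fract (den i * (monomial ((\<sigma> i)\<^sup>2) 0 * d))"
    by (simp add: e_def d_def p(1) const_fract_def Z_fract_def algebra_simps)
  also have "\<dots> = to_fract (- num i * d)"
    unfolding Q_times_den by (simp add: algebra_simps)
  finally have e1: "den i * e = - num i * d" by (simp only: to_fract_eq_iff)
  have H: "H (refl i) * ZH \<mu> id = ZH (refl i \<mu>) id * H (refl i) + of_algebra p"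
    using p(2) by (simp add: algebra_simps)
  have e2: "Kop i * ZH \<mu> id = ZH (refl i \<mu>) id * Kop i + of_algebra e"
    by (simp add: Kop_def e_def H od left_diff_distrib right_diff_distrib scl_mult_left scl_mult_right
      scale_right_distrib of_algebra_diff scale_right_diff_distrib flip: scl_of_algebra)
  show ?case
  proof (intro exI conjI)
    show "Kop i * of_algebra (monomial c \<mu>) =
        of_algebra (sact i (monomial c \<mu>)) * Kop i + of_algebra (monomial c 0 * e)"
      by (simp add: of_algebra_monomial scl_mult_left scl_mult_right e2 scale_right_distrib
        flip: scl_of_algebra)
    show "den i * (monomial c 0 * e) = num i * (sact i (monomial c \<mu>) - monomial c \<mu>)"
    proof -
      have "monomial c 0 * d = monomial c \<mu> - monomial c (refl i \<mu>)"
        by (simp add: d_def right_diff_distrib monomial_mult)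
      moreover have "den i * (monomial c 0 * e) = monomial c 0 * (den i * e)" by (rule mult.left_commute)
      ultimately show ?thesis
        unfolding e1 by (simp add: mult.left_commute[of _ "num i"]) (simp add: right_diff_distrib)
    qed
  qed
next
  case (add p q)
  then obtain e f where ef: "Kop i * of_algebra p = of_algebra (sact i p) * Kop i + of_algebra e"
    "den i * e = num i * (sact i p - p)"
    "Kop i * of_algebra q = of_algebra (sact i q) * Kop i + of_algebra f"
    "den i * f = num i * (sact i q - q)" by blast
  show ?case
    by (rule exI[of _ "e + f"])
      (simp add: ef of_algebra_add act_algebra_add distrib_left distrib_right right_diff_distrib)
qed

text \<open>The choice is harmless: the second clause determines \<open>e\<close>, since
  \<open>den i\<close> is nonzero in a domain.\<close>

definition eta :: "'i \<Rightarrow> 'y group_algebra \<Rightarrow> 'y group_algebra" where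
  "eta i p = (SOME e. Kop i * of_algebra p = of_algebra (sact i p) * Kop i + of_algebra e \<and>
     den i * e = num i * (sact i p - p))"

lemma Kop_mult_of: "Kop i * of_algebra p = of_algebra (sact i p) * Kop i + of_algebra (eta i p)"
  and den_mult_eta: "den i * eta i p = num i * (sact i p - p)"
  using someI_ex[OF ex_Kop_commute, of i p] by (simp_all add: eta_def)

lemma eta_sact: "eta i (sact i p) = - eta i p"
proof (rule divide_unique[OF den_nonzero])
  have "den i * eta i (sact i p) = - (num i * (sact i p - p))"
    by (simp add: den_mult_eta algebra_simps)
  then show "den i * eta i (sact i p) = den i * - eta i p" by (simp add: den_mult_eta)
qed

lemma of_mult_Kop: "of_algebra p * Kop i = Kop i * of_algebra (sact i p) + of_algebra (eta i p)"
  using Kop_mult_of[of i "sact i p"] by (simp add: eta_sact of_algebra_uminus)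

text \<open>The error of \<open>Kop i\<close> and the commutator of \<zeta> cancel, so that
  \<open>Fop i\<close> permutes weights.\<close>

lemma Fop_mult_of: "Fop i * of_algebra p = of_algebra (sact i p) * Fop i"
proof -
  have "Fop i * of_algebra p = of_algebra (den i * sact i p) * Kop i + of_algebra (den i * eta i p + num i * p)"
    by (simp add: Fop_def distrib_right mult.assoc Kop_mult_of distrib_left of_algebra_mult of_algebra_add)
  also have "den i * eta i p + num i * p = sact i p * num i"
    unfolding den_mult_eta by (simp add: algebra_simps)
  finally show ?thesis
    by (simp add: Fop_def distrib_left of_algebra_mult mult.commute[of "den i"] mult.assoc)
qed

lemma of_mult_Fop: "of_algebra p * Fop i = Fop i * of_algebra (sact i p)"
  by (simp add: Fop_mult_of)

text \<open>By \<open>Kop_square\<close> the product is linear in \<open>Kop i\<close>, and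
  \<open>num_den_refl_identity\<close> says that its coefficient vanishes.\<close>

lemma Fop_square: "Fop i * Fop i = of_algebra (num i * sact i (num i))"
proof -
  have "Fop i * Kop i = of_algebra (num i - monomial (1 + (\<sigma> i)\<^sup>2) 0 * den i) * Kop i"
    by (simp add: Fop_def distrib_right mult.assoc Kop_square of_algebra_diff left_diff_distrib
      of_algebra_mult scl_eq_mult) (simp add: of_algebra_commute flip: mult.assoc)
  moreover have "Fop i * (of_algebra (den i) * Kop i + of_algebra (num i)) =
      of_algebra (sact i (den i)) * (Fop i * Kop i) + of_algebra (sact i (num i)) * Fop i"
    by (simp add: distrib_left Fop_mult_of flip: mult.assoc)
  ultimately have "Fop i * Fop i = of_algebra (sact i (den i)) * (of_algebra (num i - monomial (1 + (\<sigma> i)\<^sup>2) 0 * den i) * Kop i)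
      + of_algebra (sact i (num i)) * (of_algebra (den i) * Kop i + of_algebra (num i))"
    by (simp only: Fop_def[symmetric])
  also have "of_algebra (sact i (den i)) * (of_algebra (num i - monomial (1 + (\<sigma> i)\<^sup>2) 0 * den i) * Kop i) =
      of_algebra (sact i (den i) * num i - monomial (1 + (\<sigma> i)\<^sup>2) 0 * (den i * sact i (den i))) * Kop i"
    unfolding mult.assoc[symmetric] of_algebra_mult[symmetric] by (simp add: right_diff_distrib ac_simps)
  also have "of_algebra (sact i (num i)) * (of_algebra (den i) * Kop i + of_algebra (num i)) =
      of_algebra (den i * sact i (num i)) * Kop i + of_algebra (num i * sact i (num i))"
    unfolding distrib_left mult.assoc[symmetric] of_algebra_mult[symmetric] by (simp add: ac_simps)
  also have "of_algebra (sact i (den i) * num i - monomial (1 + (\<sigma> i)\<^sup>2) 0 * (den i * sact i (den i))) * Kop i +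
      (of_algebra (den i * sact i (num i)) * Kop i + of_algebra (num i * sact i (num i))) =
      of_algebra (sact i (den i) * num i + den i * sact i (num i)
      - monomial (1 + (\<sigma> i)\<^sup>2) 0 * (den i * sact i (den i))) * Kop i + of_algebra (num i * sact i (num i))"
    by (simp add: of_algebra_add of_algebra_diff distrib_right left_diff_distrib)
  finally show ?thesis using num_den_refl_identity[of i] by simp
qed

subsection \<open>The algebra as a free right module\<close>

definition Wl :: "nat \<Rightarrow> ('y \<Rightarrow> 'y) set" where
  "Wl j = {w \<in> W. len w < j}"

text \<open>The tensor product needs coefficients on the right, whereas the given basis carries them
  on the left. This filtration by length and its left analogue \<open>Llow\<close> are compared by
  moving coefficients across \<open>H w\<close> modulo shorter terms.\<close>

definition Rlow :: "nat \<Rightarrow> 'h set" where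
  "Rlow j = {\<Sum>w\<in>Wl j. H w * of_algebra (q w) |q. True}"

definition Llow :: "nat \<Rightarrow> 'h set" where
  "Llow j = {\<Sum>w\<in>Wl j. of_algebra (q w) * H w |q. True}"

lemma finite_Wl [simp]: "finite (Wl j)"
  unfolding Wl_def by (rule finite_len_less)

lemma Wl_mono: "j \<le> k \<Longrightarrow> Wl j \<subseteq> Wl k"
  by (auto simp: Wl_def)

lemma Rlow_0 [simp]: "0 \<in> Rlow j"
  unfolding Rlow_def by (rule CollectI, rule exI[of _ "\<lambda>_. 0"]) simp

lemma Rlow_add: "x \<in> Rlow j \<Longrightarrow> y \<in> Rlow j \<Longrightarrow> x + y \<in> Rlow j"
  unfolding Rlow_def
proof clarify
  fix q q'
  show "\<exists>q''. (\<Sum>w\<in>Wl j. H w * of_algebra (q w)) + (\<Sum>w\<in>Wl j. H w * of_algebra (q' w)) =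
      (\<Sum>w\<in>Wl j. H w * of_algebra (q'' w)) \<and> True"
    by (rule exI[of _ "\<lambda>w. q w + q' w"]) (simp add: of_algebra_add distrib_left sum.distrib)
qed

lemma Rlow_sum: "(\<And>s. s \<in> S \<Longrightarrow> f s \<in> Rlow j) \<Longrightarrow> sum f S \<in> Rlow j"
  by (induction S rule: infinite_finite_induct) (auto intro: Rlow_add)

lemma Rlow_single: "w \<in> Wl j \<Longrightarrow> H w * of_algebra p \<in> Rlow j"
  unfolding Rlow_def
proof (rule CollectI, rule exI[of _ "\<lambda>u. if u = w then p else 0"])
  assume "w \<in> Wl j"
  moreover have "H u * of_algebra (if u = w then p else 0) = (if u = w then H w * of_algebra p else 0)" for u
    by simp
  ultimately show "H w * of_algebra p = (\<Sum>u\<in>Wl j. H u * of_algebra (if u = w then p else 0)) \<and> True"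
    by simp
qed

lemma Rlow_induct [consumes 1, case_names zero single add]:
  assumes "h \<in> Rlow j" "P 0" "\<And>w p. w \<in> Wl j \<Longrightarrow> P (H w * of_algebra p)"
    "\<And>x y. P x \<Longrightarrow> P y \<Longrightarrow> P (x + y)"
  shows "P h"
proof -
  obtain q where h: "h = (\<Sum>w\<in>Wl j. H w * of_algebra (q w))" using assms(1) by (auto simp: Rlow_def)
  have "P (\<Sum>w\<in>S. H w * of_algebra (q w))" if "finite S" "S \<subseteq> Wl j" for S
    using that by (induction S) (auto intro: assms)
  then show ?thesis unfolding h by simp
qed

lemma Rlow_mono: "h \<in> Rlow j \<Longrightarrow> j \<le> k \<Longrightarrow> h \<in> Rlow k"
  by (induction rule: Rlow_induct) (auto intro: Rlow_add Rlow_single dest: Wl_mono)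

lemma Rlow_mult_of: "h \<in> Rlow j \<Longrightarrow> h * of_algebra p \<in> Rlow j"
  by (induction rule: Rlow_induct)
    (auto intro: Rlow_add Rlow_single simp: distrib_right mult.assoc simp flip: of_algebra_mult)

lemma Rlow_scl: "h \<in> Rlow j \<Longrightarrow> scl c h \<in> Rlow j"
  using Rlow_mult_of[of h j "monomial c 0"] by (simp add: of_algebra_const scl_mult_right)

lemma Rlow_uminus: "h \<in> Rlow j \<Longrightarrow> - h \<in> Rlow j"
  using Rlow_scl[of h j "- 1"] by simp

lemma H_refl_Rlow: "h \<in> Rlow j \<Longrightarrow> H (refl i) * h \<in> Rlow (Suc j)"
proof (induction rule: Rlow_induct)
  case (single w p)
  then have w: "w \<in> W" "len w < j" by (auto simp: Wl_def)
  then have "refl i \<circ> w \<in> Wl (Suc j)" "w \<in> Wl (Suc j)"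
    using len_refl_comp[OF w(1), of i] by (auto simp: Wl_def W_comp)
  moreover have "H (refl i) * (H w * of_algebra p) = H (refl i \<circ> w) * of_algebra p \<or>
      H (refl i) * (H w * of_algebra p) = scl (\<sigma> i - inverse (\<sigma> i)) (H w * of_algebra p) + H (refl i \<circ> w) * of_algebra p"
    using H_refl_mult[OF w(1), of i] by (auto simp: distrib_right scl_mult_left simp flip: mult.assoc)
  ultimately show ?case by (metis Rlow_single Rlow_add Rlow_scl)
qed (auto simp: distrib_left intro: Rlow_add)

lemma of_mult_H_refl:
  "\<exists>e. of_algebra p * H (refl i) = H (refl i) * of_algebra (sact i p) + of_algebra e"
proof -
  have H: "H (refl i) = scl (inverse (\<sigma> i)) (Kop i + scl ((\<sigma> i)\<^sup>2) 1)"
    using \<sigma>_nonzero[of i] by (simp add: Kop_def)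
  show ?thesis
    by (rule exI[of _ "monomial (inverse (\<sigma> i)) 0 * (eta i p + monomial ((\<sigma> i)\<^sup>2) 0 * (p - sact i p))"])
      (simp add: H distrib_left distrib_right scl_mult_left scl_mult_right of_mult_Kop scale_right_distrib
        of_algebra_add of_algebra_diff scale_right_diff_distrib flip: scl_of_algebra)
qed

text \<open>Induction along a reduced word: passing a letter leaves an error in which this letter is
  missing.\<close>

lemma of_mult_H:
  assumes "w \<in> W"
  shows "of_algebra p * H w - H w * of_algebra (act_algebra (inv_into UNIV w) p) \<in> Rlow (len w)"
  using assms
proof (induction arbitrary: p rule: W_len_induct)
  case id
  have "of_algebra p * H id - H id * of_algebra (act_algebra (inv_into UNIV id) p) = 0" by simp
  then show ?case by (metis Rlow_0)
next
  case (refl i w)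
  obtain e where e: "of_algebra p * H (refl i) = H (refl i) * of_algebra (sact i p) + of_algebra e"
    using of_mult_H_refl by blast
  define x where "x = of_algebra (sact i p) * H w - H w * of_algebra (act_algebra (inv_into UNIV w) (sact i p))"
  define y where "y = of_algebra e * H w - H w * of_algebra (act_algebra (inv_into UNIV w) e)"
  have x: "of_algebra (sact i p) * H w = H w * of_algebra (act_algebra (inv_into UNIV w) (sact i p)) + x"
    and y: "of_algebra e * H w = H w * of_algebra (act_algebra (inv_into UNIV w) e) + y"
    by (simp_all add: x_def y_def)
  have Hsw: "H (refl i \<circ> w) = H (refl i) * H w" using refl by (simp add: H_mult_H_up)
  have "of_algebra p * H (refl i \<circ> w) = H (refl i) * (of_algebra (sact i p) * H w) + of_algebra e * H w"
    unfolding Hsw by (simp add: e distrib_right flip: mult.assoc)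
  then have eq: "of_algebra p * H (refl i \<circ> w) - H (refl i \<circ> w) * of_algebra (act_algebra (inv_into UNIV (refl i \<circ> w)) p)
      = H (refl i) * x + (H w * of_algebra (act_algebra (inv_into UNIV w) e) + y)"
    unfolding x y inv_refl_comp[OF refl(1)] act_algebra_comp Hsw by (simp add: distrib_left mult.assoc)
  have "H (refl i) * x \<in> Rlow (Suc (len w))" unfolding x_def by (rule H_refl_Rlow) (rule refl)
  moreover have "H w * of_algebra (act_algebra (inv_into UNIV w) e) \<in> Rlow (Suc (len w))"
    by (rule Rlow_single) (simp add: Wl_def refl)
  moreover have "y \<in> Rlow (Suc (len w))"
    unfolding y_def by (rule Rlow_mono[OF refl.IH]) simp
  ultimately show ?case unfolding eq refl(2) by (auto intro: Rlow_add)
qed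

lemma of_mult_H_Rlow: "w \<in> W \<Longrightarrow> of_algebra p * H w \<in> Rlow (Suc (len w))"
proof -
  assume w: "w \<in> W"
  have "H w * of_algebra (act_algebra (inv_into UNIV w) p) \<in> Rlow (Suc (len w))"
    by (rule Rlow_single) (simp add: w Wl_def)
  from Rlow_add[OF this Rlow_mono[OF of_mult_H[OF w, of p]]] show ?thesis by simp
qed

lemma ex_Rlow: "\<exists>j. h \<in> Rlow j"
proof -
  have "h \<in> span (case_prod ZH ` (UNIV \<times> W))" by (simp add: basis_span)
  then show ?thesis
  proof (induction rule: span_induct_alt)
    case base
    show ?case using Rlow_0 by blast
  next
    case (step c y z)
    then obtain \<mu> w where y: "y = ZH \<mu> w" "w \<in> W" by auto
    then have "y = of_algebra (monomial 1 \<mu>) * H w" by (simp add: of_algebra_monomial Z_mult_H)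
    then have "y \<in> Rlow (Suc (len w))" using of_mult_H_Rlow y by metis
    moreover obtain k where "z \<in> Rlow k" using step by blast
    ultimately have "scl c y \<in> Rlow (Suc (len w) + k)" "z \<in> Rlow (Suc (len w) + k)"
      by (auto intro: Rlow_mono[OF Rlow_scl] elim: Rlow_mono)
    then show ?case using Rlow_add by blast
  qed
qed

lemma Llow_0 [simp]: "0 \<in> Llow j"
  unfolding Llow_def by (rule CollectI, rule exI[of _ "\<lambda>_. 0"]) simp

lemma Llow_add: "x \<in> Llow j \<Longrightarrow> y \<in> Llow j \<Longrightarrow> x + y \<in> Llow j"
  unfolding Llow_def
proof clarify
  fix q q'
  show "\<exists>q''. (\<Sum>w\<in>Wl j. of_algebra (q w) * H w) + (\<Sum>w\<in>Wl j. of_algebra (q' w) * H w) =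
      (\<Sum>w\<in>Wl j. of_algebra (q'' w) * H w) \<and> True"
    by (rule exI[of _ "\<lambda>w. q w + q' w"]) (simp add: of_algebra_add distrib_right sum.distrib)
qed

lemma Llow_single: "w \<in> Wl j \<Longrightarrow> of_algebra p * H w \<in> Llow j"
  unfolding Llow_def
proof (rule CollectI, rule exI[of _ "\<lambda>u. if u = w then p else 0"])
  assume "w \<in> Wl j"
  moreover have "of_algebra (if u = w then p else 0) * H u = (if u = w then of_algebra p * H w else 0)" for u
    by simp
  ultimately show "of_algebra p * H w = (\<Sum>u\<in>Wl j. of_algebra (if u = w then p else 0) * H u) \<and> True"
    by simp
qed

lemma Llow_mono: "x \<in> Llow j \<Longrightarrow> j \<le> k \<Longrightarrow> x \<in> Llow k"
proof -
  assume x: "x \<in> Llow j" and jk: "j \<le> k"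
  obtain q where q: "x = (\<Sum>w\<in>Wl j. of_algebra (q w) * H w)" using x by (auto simp: Llow_def)
  have "(\<Sum>w\<in>S. of_algebra (q w) * H w) \<in> Llow k" if "finite S" "S \<subseteq> Wl j" for S
    using that Wl_mono[OF jk] by (induction S) (auto intro: Llow_add Llow_single)
  then show ?thesis unfolding q by simp
qed

lemma H_mult_of:
  assumes w: "w \<in> W"
  shows "H w * of_algebra p - of_algebra (act_algebra w p) * H w \<in> Rlow (len w)"
  using Rlow_uminus[OF of_mult_H[OF w, of "act_algebra w p"]] w by simp

lemma Rlow_subset_Llow: "h \<in> Rlow j \<Longrightarrow> h \<in> Llow j"
proof (induction j arbitrary: h rule: less_induct)
  case (less j)
  from less.prems show ?case
  proof (induction rule: Rlow_induct)
    case (single w p)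
    then have w: "w \<in> W" "len w < j" by (auto simp: Wl_def)
    have "H w * of_algebra p - of_algebra (act_algebra w p) * H w \<in> Llow j"
      by (rule Llow_mono[OF less.IH[OF w(2) H_mult_of[OF w(1)]]]) (use w in simp)
    from Llow_add[OF this Llow_single[OF single, of "act_algebra w p"]] show ?case by simp
  qed (auto intro: Llow_add)
qed

lemma Wl_Suc: "Wl (Suc j) = Wl j \<union> {w \<in> W. len w = j}" "Wl j \<inter> {w \<in> W. len w = j} = {}"
  by (auto simp: Wl_def)

text \<open>Moved to the left, the coefficients of greatest length change only by the Weyl group and
  by shorter terms, so they vanish by \<open>left_basis_independent\<close>; the remaining ones
  follow by induction.\<close>

lemma right_basis_independent:
  "(\<Sum>w\<in>Wl j. H w * of_algebra (q w)) = 0 \<Longrightarrow> w \<in> Wl j \<Longrightarrow> q w = 0"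
proof (induction j arbitrary: w)
  case 0
  then show ?case by (simp add: Wl_def)
next
  case (Suc j)
  let ?T = "{w \<in> W. len w = j}"
  have T: "finite ?T" using finite_Wl[of "Suc j"] by (simp add: Wl_Suc)
  define low where "low = (\<Sum>w\<in>?T. H w * of_algebra (q w) - of_algebra (act_algebra w (q w)) * H w)"
  define r where "r = (\<Sum>w\<in>Wl j. H w * of_algebra (q w))"
  have "low \<in> Rlow j"
    unfolding low_def using H_mult_of by (auto intro!: Rlow_sum)
  moreover have "r \<in> Rlow j" unfolding r_def Rlow_def by blast
  ultimately have "low + r \<in> Llow j" by (intro Rlow_subset_Llow Rlow_add)
  then obtain q' where q': "low + r = (\<Sum>w\<in>Wl j. of_algebra (q' w) * H w)" by (auto simp: Llow_def)
  define q'' where "q'' w = (if len w = j then act_algebra w (q w) else q' w)" for w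
  have "(\<Sum>w\<in>Wl (Suc j). of_algebra (q'' w) * H w) =
      (\<Sum>w\<in>Wl j. of_algebra (q' w) * H w) + (\<Sum>w\<in>?T. of_algebra (act_algebra w (q w)) * H w)"
    unfolding Wl_Suc(1) using T Wl_Suc(2)
    by (subst sum.union_disjoint) (auto simp: q''_def intro!: sum.cong arg_cong2[where f = "(+)"], auto simp: Wl_def)
  also have "\<dots> = r + (\<Sum>w\<in>?T. H w * of_algebra (q w))"
    unfolding q'[symmetric] low_def by (simp add: sum_subtractf)
  also have "\<dots> = (\<Sum>w\<in>Wl (Suc j). H w * of_algebra (q w))"
    unfolding Wl_Suc(1) r_def using T Wl_Suc(2) by (subst sum.union_disjoint) auto
  finally have "(\<Sum>w\<in>Wl (Suc j). of_algebra (q'' w) * H w) = 0" using Suc.prems by simp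
  then have q''0: "q'' w = 0" if "w \<in> Wl (Suc j)" for w
    using left_basis_independent[OF finite_Wl] that by (auto simp: Wl_def)
  have top: "q w = 0" if "w \<in> ?T" for w
    using q''0[of w] that act_algebra_eq_0_iff[of w "q w"] by (auto simp: q''_def Wl_def)
  show ?case
  proof (cases "len w = j")
    case True
    then show ?thesis using top Suc.prems by (auto simp: Wl_def)
  next
    case False
    have "(\<Sum>w\<in>Wl (Suc j). H w * of_algebra (q w)) = (\<Sum>w\<in>Wl j. H w * of_algebra (q w))"
      by (rule sum.mono_neutral_right) (auto simp: Wl_Suc(1) top T)
    then show ?thesis using Suc.IH[of w] Suc.prems False by (auto simp: Wl_def)
  qed
qed

text \<open>Vanishing outside a finite set of short elements makes \<open>q\<close> unique as a
  total function, also when the Weyl group is infinite.\<close>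

definition expands :: "(('y \<Rightarrow> 'y) \<Rightarrow> 'y group_algebra) \<Rightarrow> 'h \<Rightarrow> bool" where
  "expands q h \<longleftrightarrow> (\<exists>j. (\<forall>w. q w \<noteq> 0 \<longrightarrow> w \<in> Wl j) \<and> h = (\<Sum>w\<in>Wl j. H w * of_algebra (q w)))"

definition rc :: "'h \<Rightarrow> ('y \<Rightarrow> 'y) \<Rightarrow> 'y group_algebra" where
  "rc h = (THE q. expands q h)"

lemma expands_sum: 
  assumes "\<And>w. q w \<noteq> 0 \<Longrightarrow> w \<in> Wl j" "j \<le> k"
  shows "(\<Sum>w\<in>Wl k. H w * of_algebra (q w)) = (\<Sum>w\<in>Wl j. H w * of_algebra (q w))"
  by (rule sum.mono_neutral_right) (use assms Wl_mono in \<open>auto, metis of_algebra_0 mult_zero_right\<close>)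

lemma expands_add:
  assumes "expands q x" "expands q' y"
  shows "expands (\<lambda>w. q w + q' w) (x + y)"
proof -
  obtain j where j: "\<And>w. q w \<noteq> 0 \<Longrightarrow> w \<in> Wl j" "x = (\<Sum>w\<in>Wl j. H w * of_algebra (q w))"
    using assms(1) by (auto simp: expands_def)
  obtain k where k: "\<And>w. q' w \<noteq> 0 \<Longrightarrow> w \<in> Wl k" "y = (\<Sum>w\<in>Wl k. H w * of_algebra (q' w))"
    using assms(2) by (auto simp: expands_def)
  have "x = (\<Sum>w\<in>Wl (max j k). H w * of_algebra (q w))" "y = (\<Sum>w\<in>Wl (max j k). H w * of_algebra (q' w))"
    using expands_sum[OF j(1), where k = "max j k"] expands_sum[OF k(1), where k = "max j k"] j k by simp_all
  then have "x + y = (\<Sum>w\<in>Wl (max j k). H w * of_algebra (q w + q' w))"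
    by (simp add: of_algebra_add distrib_left sum.distrib)
  moreover have "w \<in> Wl (max j k)" if "q w + q' w \<noteq> 0" for w
  proof -
    have "q w \<noteq> 0 \<or> q' w \<noteq> 0" using that by auto
    then show ?thesis using j(1)[of w] k(1)[of w] by (auto simp: Wl_def)
  qed
  ultimately show ?thesis unfolding expands_def by blast
qed

lemma expands_mult_of: "expands q x \<Longrightarrow> expands (\<lambda>w. q w * p) (x * of_algebra p)"
  unfolding expands_def
  by (auto simp: sum_distrib_right mult.assoc of_algebra_mult)

lemma expands_0: "expands (\<lambda>_. 0) 0"
  by (simp add: expands_def)

lemma expands_zero_unique:
  assumes "expands q 0"
  shows "q w = 0"
proof -
  obtain j where j: "\<And>w. q w \<noteq> 0 \<Longrightarrow> w \<in> Wl j" "0 = (\<Sum>w\<in>Wl j. H w * of_algebra (q w))"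
    using assms by (auto simp: expands_def)
  then show ?thesis using right_basis_independent[OF j(2)[symmetric], of w] by blast
qed

lemma expands_unique:
  assumes "expands q x" "expands q' x"
  shows "q = q'"
proof
  fix w
  have "expands (\<lambda>w. q' w * (- 1)) (x * of_algebra (- 1))" by (rule expands_mult_of[OF assms(2)])
  from expands_add[OF assms(1) this] have "expands (\<lambda>w. q w - q' w) 0"
    by (simp add: of_algebra_uminus)
  then have "q w - q' w = 0" by (rule expands_zero_unique)
  then show "q w = q' w" by simp
qed

lemma expands_single: "w \<in> W \<Longrightarrow> expands (\<lambda>u. if u = w then p else 0) (H w * of_algebra p)"
proof -
  assume w: "w \<in> W"
  have "H u * of_algebra (if u = w then p else 0) = (if u = w then H w * of_algebra p else 0)" for u
    by simp
  moreover have "w \<in> Wl (Suc (len w))" using w by (simp add: Wl_def)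
  ultimately show ?thesis unfolding expands_def by (intro exI[of _ "Suc (len w)"]) simp
qed

lemma ex_expands: "\<exists>q. expands q h"
proof -
  obtain j where "h \<in> Rlow j" using ex_Rlow by blast
  then show ?thesis
  proof (induction rule: Rlow_induct)
    case zero
    show ?case using expands_0 by blast
  next
    case (single w p)
    then show ?case using expands_single[of w p] by (auto simp: Wl_def)
  next
    case (add x y)
    then show ?case using expands_add by blast
  qed
qed

lemma rc_eqI: "expands q h \<Longrightarrow> rc h = q"
  unfolding rc_def using expands_unique by blast

lemma expands_rc: "expands (rc h) h"
  using ex_expands rc_eqI by metis

lemma rc_Rlow: "h \<in> Rlow j \<Longrightarrow> rc h w \<noteq> 0 \<Longrightarrow> w \<in> Wl j"
proof (induction rule: Rlow_induct)
  case zero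
  then show ?case by (simp add: rc_eqI[OF expands_0])
next
  case (single u p)
  then show ?case using rc_eqI[OF expands_single[of u p]] by (auto simp: Wl_def split: if_splits)
next
  case (add x y)
  then have "rc x w \<noteq> 0 \<or> rc y w \<noteq> 0"
    using rc_eqI[OF expands_add[OF expands_rc expands_rc, of x y]] by auto
  then show ?case using add by blast
qed


subsection \<open>Coordinates of the principal series representation\<close>

text \<open>The coordinate of the image of \<open>h\<close> in the principal series representation
  along the image of \<open>H w\<close>.\<close>

definition co :: "('y \<Rightarrow> complex) \<Rightarrow> 'h \<Rightarrow> ('y \<Rightarrow> 'y) \<Rightarrow> complex" where
  "co \<tau> h w = ev \<tau> (rc h w)"

text \<open>The left ideal generated by all \<open>p - \<tau>(p)\<close>, hence the annihilator of
  the canonical generator of the module.\<close>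

definition J :: "('y \<Rightarrow> complex) \<Rightarrow> 'h set" where
  "J \<tau> = {h. \<forall>w. co \<tau> h w = 0}"

lemma co_add: "co \<tau> (x + y) w = co \<tau> x w + co \<tau> y w"
  by (simp add: co_def rc_eqI[OF expands_add[OF expands_rc expands_rc]] ev_add)

lemma co_0 [simp]: "co \<tau> 0 w = 0"
  using co_add[of \<tau> 0 0 w] by simp

lemma co_mult_of: "\<tau> \<in> torus \<Longrightarrow> co \<tau> (x * of_algebra p) w = co \<tau> x w * ev \<tau> p"
  by (simp add: co_def rc_eqI[OF expands_mult_of[OF expands_rc]] ev_mult)

lemma co_scl: "\<tau> \<in> torus \<Longrightarrow> co \<tau> (scl c x) w = c * co \<tau> x w"
  using co_mult_of[of \<tau> x "monomial c 0" w] by (simp add: of_algebra_const scl_mult_right)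

lemma co_uminus: "co \<tau> (- x) w = - co \<tau> x w"
  using co_add[of \<tau> x "- x" w] by (simp add: add_eq_0_iff)

lemma co_diff: "co \<tau> (x - y) w = co \<tau> x w - co \<tau> y w"
  using co_add[of \<tau> x "- y" w] by (simp add: co_uminus)

lemma co_sum: "co \<tau> (\<Sum>x\<in>S. f x) w = (\<Sum>x\<in>S. co \<tau> (f x) w)"
  by (induction S rule: infinite_finite_induct) (simp_all add: co_add)

lemma co_H: "\<tau> \<in> torus \<Longrightarrow> w \<in> W \<Longrightarrow> co \<tau> (H w) u = (if u = w then 1 else 0)"
  using rc_eqI[OF expands_single[of w 1]] by (simp add: co_def)

lemma co_1: "\<tau> \<in> torus \<Longrightarrow> co \<tau> 1 id = 1"
  using co_H[of \<tau> id id] by simp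

lemma co_Rlow: "h \<in> Rlow j \<Longrightarrow> co \<tau> h w \<noteq> 0 \<Longrightarrow> w \<in> Wl j"
  using rc_Rlow unfolding co_def by (metis ev_0)

lemma co_level: "\<exists>j. \<forall>w. co \<tau> h w \<noteq> 0 \<longrightarrow> w \<in> Wl j"
  using ex_Rlow co_Rlow by metis

lemma co_in_W: "co \<tau> h w \<noteq> 0 \<Longrightarrow> w \<in> W"
  using co_level[of \<tau> h] by (auto simp: Wl_def)

lemma J_0 [simp]: "0 \<in> J \<tau>"
  by (simp add: J_def)

lemma J_add: "x \<in> J \<tau> \<Longrightarrow> y \<in> J \<tau> \<Longrightarrow> x + y \<in> J \<tau>"
  by (simp add: J_def co_add)

lemma J_uminus: "x \<in> J \<tau> \<Longrightarrow> - x \<in> J \<tau>"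
  by (simp add: J_def co_uminus)

lemma J_diff: "x \<in> J \<tau> \<Longrightarrow> y \<in> J \<tau> \<Longrightarrow> x - y \<in> J \<tau>"
  by (simp add: J_def co_diff)

lemma J_sum: "(\<And>s. s \<in> S \<Longrightarrow> f s \<in> J \<tau>) \<Longrightarrow> sum f S \<in> J \<tau>"
  by (simp add: J_def co_sum)

lemma J_ev: "\<tau> \<in> torus \<Longrightarrow> x * of_algebra p - scl (ev \<tau> p) x \<in> J \<tau>"
  by (simp add: J_def co_diff co_mult_of co_scl)

lemma J_expand:
  assumes "h \<in> J \<tau>"
  obtains j q where "h = (\<Sum>w\<in>Wl j. H w * of_algebra (q w))" "\<And>w. ev \<tau> (q w) = 0"
proof -
  obtain j where "h = (\<Sum>w\<in>Wl j. H w * of_algebra (rc h w))"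
    using expands_rc[of h] by (auto simp: expands_def)
  then show ?thesis using that assms by (simp add: J_def co_def)
qed

lemma J_mult:
  assumes \<tau>: "\<tau> \<in> torus" and x: "x \<in> J \<tau>"
  shows "h * x \<in> J \<tau>"
proof -
  obtain j q where jq: "x = (\<Sum>w\<in>Wl j. H w * of_algebra (q w))" "\<And>w. ev \<tau> (q w) = 0"
    using J_expand[OF x] by blast
  have "h * (H w * of_algebra (q w)) \<in> J \<tau>" for w
    using \<tau> by (simp add: J_def co_mult_of jq(2) flip: mult.assoc)
  then show ?thesis unfolding jq(1) sum_distrib_left by (intro J_sum)
qed

lemma J_scl: "\<tau> \<in> torus \<Longrightarrow> x \<in> J \<tau> \<Longrightarrow> scl c x \<in> J \<tau>"
  by (simp add: J_def co_scl)

lemma J_scl_iff: "\<tau> \<in> torus \<Longrightarrow> c \<noteq> 0 \<Longrightarrow> scl c x \<in> J \<tau> \<longleftrightarrow> x \<in> J \<tau>"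
  by (simp add: J_def co_scl)

lemma one_notin_J: "\<tau> \<in> torus \<Longrightarrow> 1 \<notin> J \<tau>"
  using co_1[of \<tau>] by (auto simp: J_def intro!: exI[of _ id])

text \<open>The representative of \<open>h\<close> modulo \<open>J \<tau>\<close> with constant
  coefficients.\<close>

definition red :: "('y \<Rightarrow> complex) \<Rightarrow> 'h \<Rightarrow> 'h" where
  "red \<tau> h = (\<Sum>w | co \<tau> h w \<noteq> 0. scl (co \<tau> h w) (H w))"

lemma finite_co_support: "finite {w. co \<tau> h w \<noteq> 0}"
proof -
  obtain j where "\<forall>w. co \<tau> h w \<noteq> 0 \<longrightarrow> w \<in> Wl j" using co_level by blast
  then have "{w. co \<tau> h w \<noteq> 0} \<subseteq> Wl j" by blast
  then show ?thesis using finite_Wl finite_subset by blast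
qed

lemma co_red: "\<tau> \<in> torus \<Longrightarrow> co \<tau> (red \<tau> h) w = co \<tau> h w"
proof -
  assume \<tau>: "\<tau> \<in> torus"
  have "co \<tau> (red \<tau> h) w = (\<Sum>u | co \<tau> h u \<noteq> 0. if w = u then co \<tau> h w else 0)"
    unfolding red_def co_sum by (rule sum.cong) (auto simp: co_scl co_H \<tau> co_in_W)
  also have "\<dots> = co \<tau> h w" using finite_co_support[of \<tau> h] by simp
  finally show ?thesis .
qed

lemma red_cong: "\<tau> \<in> torus \<Longrightarrow> h - red \<tau> h \<in> J \<tau>"
  by (simp add: J_def co_diff co_red)

section \<open>Leading terms with respect to the length\<close>

lemma co_of_mult_H:
  assumes "\<tau> \<in> torus" "w \<in> W" "len w \<le> len u"
  shows "co \<tau> (of_algebra p * H w) u = (if u = w then ev (torus_act w \<tau>) p else 0)"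
proof -
  define x where "x = of_algebra p * H w - H w * of_algebra (act_algebra (inv_into UNIV w) p)"
  have "co \<tau> x u = 0"
    using co_Rlow[OF of_mult_H[OF assms(2), of p], of \<tau> u] assms(3) unfolding x_def by (auto simp: Wl_def)
  moreover have "of_algebra p * H w = H w * of_algebra (act_algebra (inv_into UNIV w) p) + x"
    by (simp add: x_def)
  ultimately show ?thesis
    using assms by (simp add: co_add co_mult_of co_H ev_torus_act)
qed

lemma co_mult_cong: "\<tau> \<in> torus \<Longrightarrow> x - y \<in> J \<tau> \<Longrightarrow> co \<tau> (h * x) w = co \<tau> (h * y) w"
  using J_mult[of \<tau> "x - y" h] by (simp add: J_def co_diff right_diff_distrib)

lemma co_mult_expand:
  assumes "\<tau> \<in> torus"
  shows "co \<tau> (h * x) w = (\<Sum>u | co \<tau> x u \<noteq> 0. co \<tau> x u * co \<tau> (h * H u) w)"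
  using assms by (subst co_mult_cong[OF assms red_cong[OF assms]])
    (simp add: red_def sum_distrib_left co_sum scl_mult_right co_scl)

lemma co_of_mult_top:
  assumes \<tau>: "\<tau> \<in> torus" and top: "\<And>u. co \<tau> x u \<noteq> 0 \<Longrightarrow> len u \<le> len w"
  shows "co \<tau> (of_algebra p * x) w = ev (torus_act w \<tau>) p * co \<tau> x w"
proof -
  have "co \<tau> (of_algebra p * x) w = (\<Sum>u | co \<tau> x u \<noteq> 0. if w = u then ev (torus_act w \<tau>) p * co \<tau> x w else 0)"
    unfolding co_mult_expand[OF \<tau>, of _ x]
    by (rule sum.cong) (use top in \<open>auto simp: co_of_mult_H \<tau> co_in_W\<close>)
  also have "\<dots> = ev (torus_act w \<tau>) p * co \<tau> x w" using finite_co_support[of \<tau> x] by simp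
  finally show ?thesis .
qed

lemma co_H_refl_mult_H:
  assumes "\<tau> \<in> torus" "u \<in> W" "co \<tau> (H (refl i) * H u) w \<noteq> 0"
  shows "w = u \<or> w = refl i \<circ> u"
  using H_refl_mult[OF assms(2), of i] assms
  by (auto simp: co_add co_scl co_H W_comp split: if_splits)

definition lead :: "('y \<Rightarrow> complex) \<Rightarrow> ('y \<Rightarrow> 'y) \<Rightarrow> 'h \<Rightarrow> bool" where
  "lead \<tau> w x \<longleftrightarrow> w \<in> W \<and> co \<tau> x w \<noteq> 0 \<and> (\<forall>u. co \<tau> x u \<noteq> 0 \<longrightarrow> u = w \<or> len u < len w)"

lemma lead_1: "\<tau> \<in> torus \<Longrightarrow> lead \<tau> id 1"
  using co_H[of \<tau> id] by (simp add: lead_def)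

lemma lead_notin_J: "lead \<tau> w x \<Longrightarrow> x \<notin> J \<tau>"
  by (auto simp: lead_def J_def)

lemma co_of_mult_level:
  assumes \<tau>: "\<tau> \<in> torus" and top: "\<And>u. co \<tau> x u \<noteq> 0 \<Longrightarrow> len u < j" and w: "co \<tau> (of_algebra p * x) w \<noteq> 0"
  shows "len w < j"
proof (rule ccontr)
  assume "\<not> len w < j"
  then have "co \<tau> x u \<noteq> 0 \<Longrightarrow> len u \<le> len w" for u using top[of u] by simp
  then have "co \<tau> (of_algebra p * x) w = ev (torus_act w \<tau>) p * co \<tau> x w"
    by (rule co_of_mult_top[OF \<tau>])
  then show False using w top[of w] \<open>\<not> len w < j\<close> by auto
qed

text \<open>Only the term of \<open>w\<close> can be raised above the length of \<open>w\<close>,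
  and it is raised to \<open>refl i \<circ> w\<close> alone.\<close>

lemma lead_Kop:
  assumes \<tau>: "\<tau> \<in> torus" and x: "lead \<tau> w x" and len: "len (refl i \<circ> w) = len w + 1"
  shows "lead \<tau> (refl i \<circ> w) (Kop i * x)"
proof -
  have w: "w \<in> W" "co \<tau> x w \<noteq> 0" and low: "\<And>u. co \<tau> x u \<noteq> 0 \<Longrightarrow> u = w \<or> len u < len w"
    using x by (auto simp: lead_def)
  have neq: "refl i \<circ> w \<noteq> w" using len by auto
  have HH: "co \<tau> (H (refl i) * H u) v = 0"
    if "co \<tau> x u \<noteq> 0" "u \<noteq> w" "len w < len v" for u v
  proof (rule ccontr)
    assume *: "co \<tau> (H (refl i) * H u) v \<noteq> 0"
    have u: "u \<in> W" "len u < len w" using co_in_W low that by blast+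
    then have "v = u \<or> v = refl i \<circ> u" using co_H_refl_mult_H[OF \<tau> _ *] by blast
    then show False using that u len_refl_comp[OF u(1), of i] by auto
  qed
  have Hw: "H (refl i) * H w = H (refl i \<circ> w)" using w len by (simp add: H_mult_H_up)
  have Hx: "co \<tau> (H (refl i) * x) v = (if v = refl i \<circ> w then co \<tau> x w else 0)" if v: "len w < len v" for v
  proof -
    have "co \<tau> (H (refl i) * x) v = (\<Sum>u | co \<tau> x u \<noteq> 0. if u = w then co \<tau> x w * co \<tau> (H (refl i \<circ> w)) v else 0)"
      unfolding co_mult_expand[OF \<tau>, of _ x]
      by (rule sum.cong) (use HH v in \<open>auto simp: Hw\<close>)
    also have "\<dots> = (if v = refl i \<circ> w then co \<tau> x w else 0)"
      using finite_co_support[of \<tau> x] w by (simp add: co_H \<tau> W_comp)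
    finally show ?thesis .
  qed
  have Kx: "co \<tau> (Kop i * x) v = \<sigma> i * co \<tau> (H (refl i) * x) v - (\<sigma> i)\<^sup>2 * co \<tau> x v" for v
    by (simp add: Kop_def left_diff_distrib scl_mult_left co_diff co_scl \<tau>)
  have x0: "co \<tau> x v = 0" if "len w < len v" for v using low[of v] that by auto
  show ?thesis unfolding lead_def
  proof (intro conjI allI impI)
    show "refl i \<circ> w \<in> W" using w by (simp add: W_comp)
    show "co \<tau> (Kop i * x) (refl i \<circ> w) \<noteq> 0"
      using Hx[of "refl i \<circ> w"] x0[of "refl i \<circ> w"] len w \<sigma>_nonzero[of i] unfolding Kx by simp
    fix v assume v: "co \<tau> (Kop i * x) v \<noteq> 0"
    show "v = refl i \<circ> w \<or> len v < len (refl i \<circ> w)"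
    proof (rule ccontr)
      assume *: "\<not> ?thesis"
      then have "len w < len v" using len by auto
      then show False using v * Hx[of v] x0[of v] unfolding Kx by auto
    qed
  qed
qed

text \<open>The factor \<open>den i\<close> multiplies the leading coefficient by its value at the
  reflected weight, which vanishes only if the value at the old weight does.\<close>

lemma lead_Fop:
  assumes \<tau>: "\<tau> \<in> torus" and x: "lead \<tau> w x" and len: "len (refl i \<circ> w) = len w + 1"
    and d: "ev (torus_act w \<tau>) (den i) \<noteq> 0"
  shows "lead \<tau> (refl i \<circ> w) (Fop i * x)"
proof -
  have K: "lead \<tau> (refl i \<circ> w) (Kop i * x)" by (rule lead_Kop[OF \<tau> x len])
  have w: "w \<in> W" using x by (simp add: lead_def)
  have F: "Fop i * x = of_algebra (den i) * (Kop i * x) + of_algebra (num i) * x"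
    by (simp add: Fop_def distrib_right mult.assoc)
  have xlow: "len u < Suc (len w)" if "co \<tau> x u \<noteq> 0" for u
    using x that by (auto simp: lead_def)
  have n0: "co \<tau> (of_algebra (num i) * x) v = 0" if "len w < len v" for v
    using co_of_mult_level[OF \<tau> xlow, where p = "num i" and w = v] that by auto
  have d': "ev (torus_act (refl i \<circ> w) \<tau>) (den i) \<noteq> 0"
    using d ev_act_refl_den[of "torus_act w \<tau>" i] w \<tau> by (simp add: torus_act_refl_comp torus_act_in_torus)
  show ?thesis unfolding lead_def
  proof (intro conjI allI impI)
    show "refl i \<circ> w \<in> W" using w by (simp add: W_comp)
    have "co \<tau> (of_algebra (den i) * (Kop i * x)) (refl i \<circ> w) =
        ev (torus_act (refl i \<circ> w) \<tau>) (den i) * co \<tau> (Kop i * x) (refl i \<circ> w)"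
      using K by (intro co_of_mult_top[OF \<tau>]) (auto simp: lead_def)
    then show "co \<tau> (Fop i * x) (refl i \<circ> w) \<noteq> 0"
      using K d' n0[of "refl i \<circ> w"] len unfolding F by (simp add: co_add lead_def)
    fix v assume v: "co \<tau> (Fop i * x) v \<noteq> 0"
    show "v = refl i \<circ> w \<or> len v < len (refl i \<circ> w)"
    proof (rule ccontr)
      assume *: "\<not> ?thesis"
      then have "len w < len v" using len by auto
      then have nz: "co \<tau> (of_algebra (den i) * (Kop i * x)) v \<noteq> 0" using v n0[of v] unfolding F by (simp add: co_add)
      have "co \<tau> (of_algebra (den i) * (Kop i * x)) v = ev (torus_act v \<tau>) (den i) * co \<tau> (Kop i * x) v"
        using K * by (intro co_of_mult_top[OF \<tau>]) (auto simp: lead_def)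
      then show False using nz K * by (auto simp: lead_def)
    qed
  qed
qed

subsection \<open>Irreducibility as maximality of a left ideal\<close>

definition left_ideal :: "'h set \<Rightarrow> bool" where
  "left_ideal L \<longleftrightarrow> 0 \<in> L \<and> (\<forall>x\<in>L. \<forall>y\<in>L. x + y \<in> L) \<and> (\<forall>h. \<forall>x\<in>L. h * x \<in> L)"

definition maximal :: "('y \<Rightarrow> complex) \<Rightarrow> bool" where
  "maximal \<tau> \<longleftrightarrow> (\<forall>L. left_ideal L \<and> J \<tau> \<subseteq> L \<longrightarrow> L = J \<tau> \<or> L = UNIV)"

lemma left_ideal_add: "left_ideal L \<Longrightarrow> x \<in> L \<Longrightarrow> y \<in> L \<Longrightarrow> x + y \<in> L"
  and left_ideal_mult: "left_ideal L \<Longrightarrow> x \<in> L \<Longrightarrow> h * x \<in> L"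
  by (simp_all add: left_ideal_def)

lemma left_ideal_diff: "left_ideal L \<Longrightarrow> x \<in> L \<Longrightarrow> y \<in> L \<Longrightarrow> x - y \<in> L"
  using left_ideal_add[of L x "- y"] left_ideal_mult[of L y "- 1"] by simp

lemma left_ideal_scl: "left_ideal L \<Longrightarrow> x \<in> L \<Longrightarrow> scl c x \<in> L"
  using left_ideal_mult[of L x "scl c 1"] by (simp add: scl_mult_left)

lemma left_ideal_UNIV_iff: "left_ideal L \<Longrightarrow> L = UNIV \<longleftrightarrow> 1 \<in> L"
  using left_ideal_mult[of L 1] by force

section \<open>The tensor product as the quotient of the algebra by \<open>J\<close>\<close>

definition contract :: "('h \<times> complex \<Rightarrow>\<^sub>0 int) \<Rightarrow> 'h" where
  "contract u = (\<Sum>k\<in>Poly_Mapping.keys u. of_int (Poly_Mapping.lookup u k) * scl (snd k) (fst k))"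

lemma contract_eq_sum:
  assumes "finite K" "Poly_Mapping.keys u \<subseteq> K"
  shows "contract u = (\<Sum>k\<in>K. of_int (Poly_Mapping.lookup u k) * scl (snd k) (fst k))"
  unfolding contract_def by (rule sum.mono_neutral_left) (use assms in \<open>auto simp: in_keys_iff\<close>)

lemma contract_add: "contract (u + v) = contract u + contract v"
proof -
  let ?K = "Poly_Mapping.keys u \<union> Poly_Mapping.keys v"
  have "Poly_Mapping.keys (u + v) \<subseteq> ?K" by (rule Poly_Mapping.keys_add)
  then show ?thesis
    by (simp add: contract_eq_sum[of ?K] lookup_add distrib_right sum.distrib)
qed

lemma contract_0 [simp]: "contract 0 = 0"
  by (simp add: contract_def)

lemma contract_uminus: "contract (- u) = - contract u"
  using contract_add[of u "- u"] by (simp add: add_eq_0_iff)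

lemma contract_diff: "contract (u - v) = contract u - contract v"
  using contract_add[of u "- v"] by (simp add: contract_uminus)

lemma contract_frag_of [simp]: "contract (frag_of (x, c)) = scl c x"
  by (simp add: contract_def)

abbreviation relations :: "('y \<Rightarrow> complex) \<Rightarrow> ('h \<times> complex \<Rightarrow>\<^sub>0 int) set" where
  "relations \<tau> \<equiv> tensor_relations (\<lambda>h p. h * of_algebra p) (\<lambda>p c. ev \<tau> p * c)"

abbreviation frags :: "('h \<times> complex \<Rightarrow>\<^sub>0 int) monoid" where
  "frags \<equiv> free_Abelian_group UNIV"

lemma subgroup_relations: "subgroup (relations \<tau>) frags"
  unfolding tensor_relations_def by (rule group.generate_is_subgroup) auto

lemma relations_add: "u \<in> relations \<tau> \<Longrightarrow> v \<in> relations \<tau> \<Longrightarrow> u + v \<in> relations \<tau>"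
  using subgroup.m_closed[OF subgroup_relations, of u \<tau> v] by simp

lemma relations_uminus: "u \<in> relations \<tau> \<Longrightarrow> - u \<in> relations \<tau>"
  using subgroup.m_inv_closed[OF subgroup_relations, of u] by simp

lemma relations_diff: "u \<in> relations \<tau> \<Longrightarrow> v \<in> relations \<tau> \<Longrightarrow> u - v \<in> relations \<tau>"
  using relations_add[of u \<tau> "- v"] relations_uminus[of v] by simp

lemma relations_left: "frag_of (x + x', y) - frag_of (x, y) - frag_of (x', y) \<in> relations \<tau>"
  and relations_right: "frag_of (x, y + y') - frag_of (x, y) - frag_of (x, y') \<in> relations \<tau>"
  and relations_balance: "frag_of (x * of_algebra p, y) - frag_of (x, ev \<tau> p * y) \<in> relations \<tau>"
  unfolding tensor_relations_def by (rule generate.incl, blast)+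

lemma contract_relations:
  assumes \<tau>: "\<tau> \<in> torus" and u: "u \<in> relations \<tau>"
  shows "contract u \<in> J \<tau>"
  using u unfolding tensor_relations_def
proof (induction rule: generate.induct)
  have gen: "contract h \<in> J \<tau>"
    if "h \<in> {frag_of (x + x', y) - frag_of (x, y) - frag_of (x', y) | x x' y. True} \<union>
      {frag_of (x, y + y') - frag_of (x, y) - frag_of (x, y') | x y y'. True} \<union>
      {frag_of (x * of_algebra r, y) - frag_of (x, ev \<tau> r * y) | x r y. True}" for h
    using that
  proof (elim UnE CollectE exE conjE)
    fix x r y assume h: "h = frag_of (x * of_algebra r, y) - frag_of (x, ev \<tau> r * y)"
    have "contract h = scl y (x * of_algebra r - scl (ev \<tau> r) x)"
      by (simp add: h contract_diff scale_right_diff_distrib mult.commute)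
    then show ?thesis by (simp add: J_scl J_ev \<tau>)
  qed (simp_all add: contract_diff scale_right_distrib scale_left_distrib)
  show "contract h \<in> J \<tau>" if "h \<in> {frag_of (x + x', y) - frag_of (x, y) - frag_of (x', y) | x x' y. True} \<union>
      {frag_of (x, y + y') - frag_of (x, y) - frag_of (x, y') | x y y'. True} \<union>
      {frag_of (x * of_algebra r, y) - frag_of (x, ev \<tau> r * y) | x r y. True}" for h
    using that by (rule gen)
  show "contract (inv\<^bsub>frags\<^esub> h) \<in> J \<tau>" if "h \<in> {frag_of (x + x', y) - frag_of (x, y) - frag_of (x', y) | x x' y. True} \<union>
      {frag_of (x, y + y') - frag_of (x, y) - frag_of (x, y') | x y y'. True} \<union>
      {frag_of (x * of_algebra r, y) - frag_of (x, ev \<tau> r * y) | x r y. True}" for h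
    using gen[OF that] by (simp add: contract_uminus J_uminus)
qed (simp_all add: contract_add J_add)

text \<open>Every tensor is a pure tensor with second factor 1, because constants can be moved
  across by the balancing relation.\<close>

lemma diff_contract_relations:
  assumes \<tau>: "\<tau> \<in> torus"
  shows "u - frag_of (contract u, 1) \<in> relations \<tau>"
proof -
  have zero_rel: "frag_of (0, 1) \<in> relations \<tau>"
    using relations_uminus[OF relations_left[of 0 0 1]] by simp
  have "Poly_Mapping.keys u \<subseteq> UNIV" by simp
  then show ?thesis
  proof (induction u rule: frag_induction)
    case zero
    show ?case using relations_uminus[OF zero_rel] by simp
  next
    case (one k)
    obtain x c where k: "k = (x, c)" by (cases k)
    have "frag_of (scl c x, 1) - frag_of (x, c) \<in> relations \<tau>"
      using relations_balance[of x "monomial c 0" 1 \<tau>] \<tau> by (simp add: of_algebra_const scl_mult_right)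
    from relations_uminus[OF this] show ?case by (simp add: k)
  next
    case (diff u v)
    have "(u - frag_of (contract u, 1)) - (v - frag_of (contract v, 1)) +
        (frag_of (contract (u - v) + contract v, 1) - frag_of (contract (u - v), 1) - frag_of (contract v, 1)) \<in> relations \<tau>"
      by (intro relations_add relations_diff diff relations_left)
    then show ?case by (simp add: contract_diff algebra_simps)
  qed
qed

lemma relations_frag_of_J:
  assumes "h \<in> J \<tau>"
  shows "frag_of (h, 1) \<in> relations \<tau>"
proof -
  obtain j q where h: "h = (\<Sum>w\<in>Wl j. H w * of_algebra (q w))" "\<And>w. ev \<tau> (q w) = 0"
    using J_expand[OF assms] by blast
  have zero: "frag_of (0, 1) \<in> relations \<tau>"
    using relations_uminus[OF relations_left[of 0 0 1]] by simp
  have zero': "frag_of (x, 0) \<in> relations \<tau>" for x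
    using relations_uminus[OF relations_right[of x 0 0]] by simp
  have single: "frag_of (H w * of_algebra (q w), 1) \<in> relations \<tau>" for w
    using relations_add[OF relations_balance[of "H w" "q w" 1] zero'[of "H w"]] h(2) by simp
  have "frag_of (\<Sum>w\<in>S. H w * of_algebra (q w), 1) \<in> relations \<tau>" if "finite S" for S
    using that
  proof (induction S)
    case (insert w S)
    let ?x = "H w * of_algebra (q w)" and ?y = "\<Sum>w\<in>S. H w * of_algebra (q w)"
    have "(frag_of (?x + ?y, 1) - frag_of (?x, 1) - frag_of (?y, 1)) + (frag_of (?x, 1) + frag_of (?y, 1)) \<in> relations \<tau>"
      by (intro relations_add relations_left single insert.IH)
    then show ?case using insert.hyps by simp
  qed (simp add: zero)
  then show ?thesis unfolding h(1) by simp
qed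

text \<open>Thus \<open>contract\<close> induces an isomorphism from the tensor product onto the
  quotient by \<open>J \<tau>\<close>.\<close>

lemma relations_iff:
  assumes "\<tau> \<in> torus"
  shows "u \<in> relations \<tau> \<longleftrightarrow> contract u \<in> J \<tau>"
  using contract_relations[OF assms, of u]
    relations_add[OF diff_contract_relations[OF assms, of u] relations_frag_of_J[of "contract u" \<tau>]]
  by auto

definition tensor_class :: "('y \<Rightarrow> complex) \<Rightarrow> 'h \<Rightarrow> ('h \<times> complex \<Rightarrow>\<^sub>0 int) set" where
  "tensor_class \<tau> h = {v. contract v - h \<in> J \<tau>}"

lemma r_coset_relations:
  assumes "\<tau> \<in> torus"
  shows "relations \<tau> #>\<^bsub>frags\<^esub> u = tensor_class \<tau> (contract u)"
proof (intro equalityI subsetI)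
  fix v assume "v \<in> relations \<tau> #>\<^bsub>frags\<^esub> u"
  then obtain r where "r \<in> relations \<tau>" "v = r + u" by (auto simp: r_coset_def)
  then show "v \<in> tensor_class \<tau> (contract u)"
    by (simp add: tensor_class_def contract_add relations_iff[OF assms])
next
  fix v assume "v \<in> tensor_class \<tau> (contract u)"
  then have "v - u \<in> relations \<tau>" by (simp add: tensor_class_def contract_diff relations_iff[OF assms])
  then have "v \<in> (\<Union>r\<in>relations \<tau>. {r + u})" by (intro UN_I[of "v - u"]) simp_all
  then show "v \<in> relations \<tau> #>\<^bsub>frags\<^esub> u" by (simp add: r_coset_def)
qed

lemma tensor_class_eq_iff:
  assumes "\<tau> \<in> torus"
  shows "tensor_class \<tau> h = tensor_class \<tau> h' \<longleftrightarrow> h - h' \<in> J \<tau>"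
proof
  assume "tensor_class \<tau> h = tensor_class \<tau> h'"
  moreover have "frag_of (h, 1) \<in> tensor_class \<tau> h" by (simp add: tensor_class_def)
  ultimately show "h - h' \<in> J \<tau>" by (auto simp: tensor_class_def)
next
  assume *: "h - h' \<in> J \<tau>"
  have "v - h \<in> J \<tau> \<longleftrightarrow> v - h' \<in> J \<tau>" for v
    using J_add[OF _ *, of "v - h"] J_diff[OF _ *, of "v - h'"] by auto
  then show "tensor_class \<tau> h = tensor_class \<tau> h'" by (simp add: tensor_class_def)
qed

lemma normal_relations: "relations \<tau> \<lhd> frags"
  by (rule comm_group.normal_iff_subgroup[THEN iffD2])
    (simp_all add: abelian_free_Abelian_group subgroup_relations)

lemma I_carrier_eq: "I_carrier \<tau> = frags Mod relations \<tau>"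
  by (simp add: I_carrier_def tensor_product_def)

lemma group_I_carrier: "group (I_carrier \<tau>)"
  unfolding I_carrier_eq by (rule normal.factorgroup_is_group[OF normal_relations])

lemma carrier_I: "\<tau> \<in> torus \<Longrightarrow> carrier (I_carrier \<tau>) = range (tensor_class \<tau>)"
proof -
  assume \<tau>: "\<tau> \<in> torus"
  have "carrier (I_carrier \<tau>) = range (\<lambda>u. tensor_class \<tau> (contract u))"
    unfolding I_carrier_eq carrier_FactGroup by (auto simp: r_coset_relations[OF \<tau>])
  also have "\<dots> = range (tensor_class \<tau>)"
  proof (intro equalityI subsetI)
    fix t assume "t \<in> range (tensor_class \<tau>)"
    then obtain h where "t = tensor_class \<tau> h" by blast
    then show "t \<in> range (\<lambda>u. tensor_class \<tau> (contract u))"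
      by (intro range_eqI[of _ _ "frag_of (h, 1)"]) simp
  qed auto
  finally show ?thesis .
qed

lemma one_I: "\<tau> \<in> torus \<Longrightarrow> \<one>\<^bsub>I_carrier \<tau>\<^esub> = tensor_class \<tau> 0"
  using relations_iff by (auto simp: I_carrier_eq tensor_class_def)

lemma mult_I:
  assumes \<tau>: "\<tau> \<in> torus"
  shows "tensor_class \<tau> x \<otimes>\<^bsub>I_carrier \<tau>\<^esub> tensor_class \<tau> y = tensor_class \<tau> (x + y)"
proof -
  have "tensor_class \<tau> x \<otimes>\<^bsub>I_carrier \<tau>\<^esub> tensor_class \<tau> y =
      (relations \<tau> #>\<^bsub>frags\<^esub> frag_of (x, 1)) <#>\<^bsub>frags\<^esub> (relations \<tau> #>\<^bsub>frags\<^esub> frag_of (y, 1))"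
    by (simp add: I_carrier_eq r_coset_relations[OF \<tau>])
  also have "\<dots> = relations \<tau> #>\<^bsub>frags\<^esub> (frag_of (x, 1) + frag_of (y, 1))"
    using normal.rcos_sum[OF normal_relations, of "frag_of (x, 1)" "frag_of (y, 1)" \<tau>] by simp
  finally show ?thesis by (simp add: r_coset_relations[OF \<tau>] contract_add)
qed

lemma inv_I:
  assumes \<tau>: "\<tau> \<in> torus"
  shows "inv\<^bsub>I_carrier \<tau>\<^esub> (tensor_class \<tau> x) = tensor_class \<tau> (- x)"
  by (rule group.inv_equality[OF group_I_carrier]) (simp_all add: mult_I one_I carrier_I \<tau>)

lemma I_act_eq:
  assumes \<tau>: "\<tau> \<in> torus"
  shows "I_act \<tau> h (tensor_class \<tau> x) = tensor_class \<tau> (h * x)"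
proof -
  have ext: "contract (frag_extend (\<lambda>(x, y). frag_of (h * x, y)) u) = h * contract u" for u :: "'h \<times> complex \<Rightarrow>\<^sub>0 int"
  proof -
    have "Poly_Mapping.keys u \<subseteq> UNIV" by simp
    then show ?thesis
    proof (induction u rule: frag_induction)
      case (one k)
      show ?case by (cases k) (simp add: scl_mult_right)
    next
      case (diff u v)
      then show ?case by (simp add: frag_extend_diff contract_diff right_diff_distrib)
    qed simp_all
  qed
  \<comment> \<open>All members of the union that defines \<open>tensor_act\<close> are the same
    coset, as \<open>J \<tau>\<close> is a left ideal.\<close>
  have "relations \<tau> #>\<^bsub>frags\<^esub> frag_extend (\<lambda>(x, y). frag_of (h * x, y)) u = tensor_class \<tau> (h * x)"
    if "u \<in> tensor_class \<tau> x" for u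
    using J_mult[OF \<tau>, of "contract u - x" h] that
    by (simp add: r_coset_relations[OF \<tau>] ext tensor_class_eq_iff[OF \<tau>] right_diff_distrib)
      (simp add: tensor_class_def)
  moreover have "frag_of (x, 1) \<in> tensor_class \<tau> x" by (simp add: tensor_class_def)
  ultimately show ?thesis unfolding I_act_def tensor_act_def by blast
qed

text \<open>Submodules correspond to the left ideals above \<open>J \<tau>\<close> by image and
  preimage, and the module is nonzero because 1 is not in \<open>J \<tau>\<close>.\<close>

lemma irreducible_iff_maximal:
  assumes \<tau>: "\<tau> \<in> torus"
  shows "irreducible_module (I_carrier \<tau>) (I_act \<tau>) \<longleftrightarrow> maximal \<tau>"
proof
  assume irr: "irreducible_module (I_carrier \<tau>) (I_act \<tau>)"
  show "maximal \<tau>" unfolding maximal_def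
  proof (intro allI impI, elim conjE)
    fix L assume L: "left_ideal L" "J \<tau> \<subseteq> L"
    have "submodule_of (I_carrier \<tau>) (I_act \<tau>) (tensor_class \<tau> ` L)"
      unfolding submodule_of_def
    proof (intro conjI allI ballI group.subgroupI[OF group_I_carrier])
      show "tensor_class \<tau> ` L \<subseteq> carrier (I_carrier \<tau>)" by (auto simp: carrier_I \<tau>)
      show "tensor_class \<tau> ` L \<noteq> {}" using L by (auto simp: left_ideal_def)
      show "inv\<^bsub>I_carrier \<tau>\<^esub> x \<in> tensor_class \<tau> ` L" if "x \<in> tensor_class \<tau> ` L" for x
        using that left_ideal_mult[OF L(1), of _ "- 1"] by (auto simp: inv_I \<tau>)
      show "x \<otimes>\<^bsub>I_carrier \<tau>\<^esub> y \<in> tensor_class \<tau> ` L"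
        if "x \<in> tensor_class \<tau> ` L" "y \<in> tensor_class \<tau> ` L" for x y
        using that left_ideal_add[OF L(1)] by (auto simp: mult_I \<tau>)
      show "I_act \<tau> h x \<in> tensor_class \<tau> ` L" if "x \<in> tensor_class \<tau> ` L" for h x
        using that left_ideal_mult[OF L(1)] by (auto simp: I_act_eq \<tau>)
    qed
    then have "tensor_class \<tau> ` L = {\<one>\<^bsub>I_carrier \<tau>\<^esub>} \<or> tensor_class \<tau> ` L = carrier (I_carrier \<tau>)"
      using irr unfolding irreducible_module_def by blast
    then consider "tensor_class \<tau> ` L = {tensor_class \<tau> 0}" | "tensor_class \<tau> ` L = range (tensor_class \<tau>)"
      unfolding one_I[OF \<tau>] carrier_I[OF \<tau>] by blast
    then show "L = J \<tau> \<or> L = UNIV"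
    proof cases
      case 1
      then have "x \<in> J \<tau>" if "x \<in> L" for x
        using that tensor_class_eq_iff[OF \<tau>, of x 0] by auto
      then show ?thesis using L by blast
    next
      case 2
      have "x \<in> L" for x
      proof -
        obtain y where "y \<in> L" "tensor_class \<tau> x = tensor_class \<tau> y" using 2 by (metis imageE rangeI)
        then have "x - y \<in> L" "y \<in> L" using tensor_class_eq_iff[OF \<tau>] L by auto
        then show ?thesis using left_ideal_add[OF L(1), of "x - y" y] by simp
      qed
      then show ?thesis by blast
    qed
  qed
next
  assume max: "maximal \<tau>"
  show "irreducible_module (I_carrier \<tau>) (I_act \<tau>)"
    unfolding irreducible_module_def
  proof (intro conjI allI impI)
    have "tensor_class \<tau> 1 \<noteq> tensor_class \<tau> 0"
      using one_notin_J[OF \<tau>] by (simp add: tensor_class_eq_iff \<tau>)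
    then show "carrier (I_carrier \<tau>) \<noteq> {\<one>\<^bsub>I_carrier \<tau>\<^esub>}" by (auto simp: carrier_I one_I \<tau>)
    fix N assume N: "submodule_of (I_carrier \<tau>) (I_act \<tau>) N"
    then have sub: "subgroup N (I_carrier \<tau>)" by (simp add: submodule_of_def)
    define L where "L = {h. tensor_class \<tau> h \<in> N}"
    have "left_ideal L" unfolding left_ideal_def
    proof (intro conjI ballI allI)
      show "0 \<in> L" using subgroup.one_closed[OF sub] by (simp add: L_def one_I \<tau>)
      show "x + y \<in> L" if "x \<in> L" "y \<in> L" for x y
        using subgroup.m_closed[OF sub] that by (simp add: L_def mult_I[OF \<tau>, symmetric])
      show "h * x \<in> L" if "x \<in> L" for h x
        using N that by (simp add: L_def submodule_of_def I_act_eq[OF \<tau>, symmetric])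
    qed
    moreover have "J \<tau> \<subseteq> L"
    proof
      fix x assume "x \<in> J \<tau>"
      then have "tensor_class \<tau> x = tensor_class \<tau> 0" by (simp add: tensor_class_eq_iff \<tau>)
      then show "x \<in> L" using subgroup.one_closed[OF sub] by (simp add: L_def one_I \<tau>)
    qed
    ultimately consider "L = J \<tau>" | "L = UNIV" using max by (auto simp: maximal_def)
    moreover have N_eq: "N = tensor_class \<tau> ` L"
      using subgroup.subset[OF sub] by (auto simp: L_def carrier_I \<tau>)
    ultimately show "N = {\<one>\<^bsub>I_carrier \<tau>\<^esub>} \<or> N = carrier (I_carrier \<tau>)"
    proof cases
      case 1
      have "tensor_class \<tau> x = tensor_class \<tau> 0" if "x \<in> J \<tau>" for x
        using that by (simp add: tensor_class_eq_iff \<tau>)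
      then have "N = {tensor_class \<tau> 0}" unfolding N_eq 1 using J_0[of \<tau>] by blast
      then show ?thesis by (simp add: one_I \<tau>)
    next
      case 2
      then show ?thesis by (simp add: N_eq carrier_I \<tau>)
    qed
  qed
qed

subsection \<open>Weight vectors\<close>

definition weight_vector :: "('y \<Rightarrow> complex) \<Rightarrow> ('y \<Rightarrow> complex) \<Rightarrow> 'h \<Rightarrow> bool" where
  "weight_vector \<tau> \<omega> x \<longleftrightarrow> (\<forall>p. of_algebra p * x - scl (ev \<omega> p) x \<in> J \<tau>)"

lemma weight_vectorD: "weight_vector \<tau> \<omega> x \<Longrightarrow> of_algebra p * x - scl (ev \<omega> p) x \<in> J \<tau>"
  by (simp add: weight_vector_def)

lemma weight_vector_1: "\<tau> \<in> torus \<Longrightarrow> weight_vector \<tau> \<tau> 1"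
  unfolding weight_vector_def using J_ev[of \<tau> 1] by simp

lemma weight_vector_diff_scl:
  assumes "\<tau> \<in> torus" "weight_vector \<tau> \<omega> x" "weight_vector \<tau> \<omega> y"
  shows "weight_vector \<tau> \<omega> (x - scl c y)"
  unfolding weight_vector_def
proof
  fix p
  have "of_algebra p * (x - scl c y) - scl (ev \<omega> p) (x - scl c y) =
      (of_algebra p * x - scl (ev \<omega> p) x) - scl c (of_algebra p * y - scl (ev \<omega> p) y)"
    by (simp add: right_diff_distrib scl_mult_right scale_right_diff_distrib mult.commute)
  then show "of_algebra p * (x - scl c y) - scl (ev \<omega> p) (x - scl c y) \<in> J \<tau>"
    using J_diff[OF weight_vectorD[OF assms(2)] J_scl[OF assms(1) weight_vectorD[OF assms(3)]]] by simp
qed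

text \<open>Frobenius reciprocity: right multiplication by a weight vector of weight \<omega> is a
  homomorphism from the module of \<omega> to that of \<tau>.\<close>

lemma J_mult_weight_vector:
  assumes "\<tau> \<in> torus" "weight_vector \<tau> \<omega> x" "h \<in> J \<omega>"
  shows "h * x \<in> J \<tau>"
proof -
  obtain j q where jq: "h = (\<Sum>w\<in>Wl j. H w * of_algebra (q w))" "\<And>w. ev \<omega> (q w) = 0"
    using J_expand[OF assms(3)] by blast
  have "of_algebra (q w) * x \<in> J \<tau>" for w
    using weight_vectorD[OF assms(2), of "q w"] by (simp add: jq(2))
  then show ?thesis
    unfolding jq(1) sum_distrib_right mult.assoc by (intro J_sum) (rule J_mult[OF assms(1)])
qed

lemma weight_vector_Fop:
  assumes "\<tau> \<in> torus" "weight_vector \<tau> \<omega> x"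
  shows "weight_vector \<tau> (torus_act (refl i) \<omega>) (Fop i * x)"
  unfolding weight_vector_def
proof
  fix p
  have "of_algebra p * (Fop i * x) - scl (ev (torus_act (refl i) \<omega>) p) (Fop i * x) =
      Fop i * (of_algebra (sact i p) * x - scl (ev \<omega> (sact i p)) x)"
    by (simp add: right_diff_distrib scl_mult_right ev_torus_act_refl of_mult_Fop flip: mult.assoc)
  then show "of_algebra p * (Fop i * x) - scl (ev (torus_act (refl i) \<omega>) p) (Fop i * x) \<in> J \<tau>"
    using J_mult[OF assms(1) weight_vectorD[OF assms(2)]] by simp
qed

lemma weight_vector_Fop_Fop:
  assumes "weight_vector \<tau> \<omega> x"
  shows "Fop i * (Fop i * x) - scl (ev \<omega> (num i * sact i (num i))) x \<in> J \<tau>"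
  using weight_vectorD[OF assms, of "num i * sact i (num i)"] by (simp add: Fop_square flip: mult.assoc)

lemma ev_torus_act_refl_refl: "torus_act (refl i) (torus_act (refl i) \<omega>) = \<omega>"
  by (simp add: torus_act_refl_comp[symmetric])

lemma left_ideal_right_image:
  assumes \<tau>: "\<tau> \<in> torus"
  shows "left_ideal {z. \<exists>h. z - h * y \<in> J \<tau>}"
  unfolding left_ideal_def
proof (intro conjI ballI allI)
  show "0 \<in> {z. \<exists>h. z - h * y \<in> J \<tau>}" by (rule CollectI, rule exI[of _ 0]) simp
  show "x + x' \<in> {z. \<exists>h. z - h * y \<in> J \<tau>}"
    if xx: "x \<in> {z. \<exists>h. z - h * y \<in> J \<tau>}" "x' \<in> {z. \<exists>h. z - h * y \<in> J \<tau>}" for x x'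
  proof -
    obtain h h' where "x - h * y \<in> J \<tau>" "x' - h' * y \<in> J \<tau>" using xx by blast
    then have "(x - h * y) + (x' - h' * y) \<in> J \<tau>" by (rule J_add)
    then show ?thesis by (intro CollectI exI[of _ "h + h'"]) (simp add: algebra_simps)
  qed
  show "g * x \<in> {z. \<exists>h. z - h * y \<in> J \<tau>}" if xx: "x \<in> {z. \<exists>h. z - h * y \<in> J \<tau>}" for g x
  proof -
    obtain h where "x - h * y \<in> J \<tau>" using xx by blast
    then have "g * (x - h * y) \<in> J \<tau>" by (rule J_mult[OF \<tau>])
    then show ?thesis by (intro CollectI exI[of _ "g * h"]) (simp add: right_diff_distrib mult.assoc)
  qed
qed

lemma maximal_generate:
  assumes \<tau>: "\<tau> \<in> torus" and max: "maximal \<tau>" and y: "y \<notin> J \<tau>"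
  obtains h where "h * y - 1 \<in> J \<tau>"
proof -
  let ?L = "{z. \<exists>h. z - h * y \<in> J \<tau>}"
  have "J \<tau> \<subseteq> ?L" by (auto intro: exI[of _ 0])
  moreover have "y \<in> ?L" by (rule CollectI, rule exI[of _ 1]) simp
  ultimately have "?L = UNIV" using max left_ideal_right_image[OF \<tau>] y unfolding maximal_def by blast
  then obtain h where "1 - h * y \<in> J \<tau>" by blast
  from J_uminus[OF this] show ?thesis using that[of h] by simp
qed

text \<open>Right multiplication by \<open>y\<close> is a nonzero endomorphism of an irreducible
  module; its kernel is a proper submodule, hence zero.\<close>

lemma maximal_right_cancel:
  assumes \<tau>: "\<tau> \<in> torus" and max: "maximal \<tau>" and y: "weight_vector \<tau> \<tau> y" "y \<notin> J \<tau>"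
    and h: "h * y \<in> J \<tau>"
  shows "h \<in> J \<tau>"
proof -
  let ?L = "{z. z * y \<in> J \<tau>}"
  have "left_ideal ?L" unfolding left_ideal_def by (auto simp: distrib_right mult.assoc intro: J_add J_mult[OF \<tau>])
  moreover have "J \<tau> \<subseteq> ?L" using J_mult_weight_vector[OF \<tau> y(1)] by blast
  moreover have "1 \<notin> ?L" using y(2) by simp
  ultimately have "?L = J \<tau>" using max unfolding maximal_def by blast
  then show ?thesis using h by blast
qed

lemma Fop_notin_J:
  assumes "\<tau> \<in> torus" "ev \<tau> (den i) \<noteq> 0"
  shows "Fop i \<notin> J \<tau>"
  using lead_notin_J[OF lead_Fop[OF assms(1) lead_1[OF assms(1)], of i]] assms by simp


text \<open>Take \<open>x\<close> of the least length bound and, among these, with the fewest terms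
  of greatest length. Subtracting the eigenvalue of one such term removes it without creating
  others, so by minimality the result lies in \<open>J \<tau>\<close>.\<close>

lemma ex_weight_vector:
  assumes \<tau>: "\<tau> \<in> torus" and L: "left_ideal L" and sub: "\<not> L \<subseteq> J \<tau>"
  obtains w x where "w \<in> W" "x \<in> L" "x \<notin> J \<tau>" "weight_vector \<tau> (torus_act w \<tau>) x"
proof -
  define bounded where "bounded j x \<longleftrightarrow> (\<forall>u. co \<tau> x u \<noteq> 0 \<longrightarrow> len u < j)" for j x
  obtain x0 j0 where "x0 \<in> L - J \<tau>" "\<forall>w. co \<tau> x0 w \<noteq> 0 \<longrightarrow> w \<in> Wl j0"
    using sub co_level[of \<tau>] by blast
  then have "\<exists>j. \<exists>x\<in>L - J \<tau>. bounded j x"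
    unfolding bounded_def Wl_def by blast
  then obtain j where j: "\<exists>x\<in>L - J \<tau>. bounded j x"
    and least: "\<And>i. i < j \<Longrightarrow> \<not> (\<exists>x\<in>L - J \<tau>. bounded i x)"
    using exists_least_iff[of "\<lambda>j. \<exists>x\<in>L - J \<tau>. bounded j x"] by blast
  define top where "top x = {u. co \<tau> x u \<noteq> 0 \<and> Suc (len u) = j}" for x
  have fin: "finite (top x)" for x
    unfolding top_def by (rule finite_subset[OF _ finite_co_support[of \<tau> x]]) auto
  obtain x where x: "x \<in> L" "x \<notin> J \<tau>" "bounded j x"
    and card: "\<And>y. y \<in> L - J \<tau> \<Longrightarrow> bounded j y \<Longrightarrow> card (top x) \<le> card (top y)"
    using ex_has_least_nat[of "\<lambda>x. x \<in> L - J \<tau> \<and> bounded j x" _ "\<lambda>x. card (top x)"] j by blast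
  define shift where "shift \<omega> p = of_algebra p * x - scl (ev \<omega> p) x" for \<omega> p
  have shift_L: "shift \<omega> p \<in> L" for \<omega> p
    unfolding shift_def by (intro left_ideal_diff[OF L] left_ideal_mult[OF L] left_ideal_scl[OF L] x)
  have shift_bounded: "bounded j (shift \<omega> p)" for \<omega> p
    unfolding bounded_def
  proof (intro allI impI)
    fix u assume "co \<tau> (shift \<omega> p) u \<noteq> 0"
    then consider "co \<tau> (of_algebra p * x) u \<noteq> 0" | "co \<tau> x u \<noteq> 0"
      by (cases "co \<tau> x u = 0") (simp_all add: shift_def co_diff co_scl[OF \<tau>])
    then show "len u < j"
    proof cases
      case 1
      then show ?thesis using co_of_mult_level[OF \<tau>, of x j p u] x(3) by (simp add: bounded_def)
    qed (use x(3) in \<open>simp add: bounded_def\<close>)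
  qed
  have shift_top: "co \<tau> (shift \<omega> p) u = (ev (torus_act u \<tau>) p - ev \<omega> p) * co \<tau> x u" if "Suc (len u) = j" for \<omega> p u
  proof -
    have "co \<tau> (of_algebra p * x) u = ev (torus_act u \<tau>) p * co \<tau> x u"
      using x(3) that by (intro co_of_mult_top[OF \<tau>]) (auto simp: bounded_def)
    then show ?thesis by (simp add: shift_def co_diff co_scl[OF \<tau>] algebra_simps)
  qed
  have "top x \<noteq> {}"
  proof
    assume "top x = {}"
    then have "bounded (j - 1) x" using x(3) by (fastforce simp: bounded_def top_def)
    moreover have "j > 0"
    proof (rule ccontr)
      assume "\<not> j > 0"
      then show False using x(2,3) by (simp add: bounded_def J_def)
    qed
    ultimately show False using least[of "j - 1"] x(1,2) by auto
  qed
  then obtain w where w: "w \<in> top x" by blast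
  have w': "Suc (len w) = j" "co \<tau> x w \<noteq> 0" using w by (auto simp: top_def)
  have top_shift: "top (shift (torus_act w \<tau>) p) \<subseteq> top x - {w}" for p
    using shift_top[of _ "torus_act w \<tau>" p] by (auto simp: top_def)
  have J: "shift (torus_act w \<tau>) p \<in> J \<tau>" for p
  proof (rule ccontr)
    assume "shift (torus_act w \<tau>) p \<notin> J \<tau>"
    then have "card (top x) \<le> card (top (shift (torus_act w \<tau>) p))"
      using card[of "shift (torus_act w \<tau>) p"] shift_L shift_bounded by blast
    also have "\<dots> \<le> card (top x - {w})" by (rule card_mono[OF _ top_shift]) (simp add: fin)
    also have "\<dots> < card (top x)" by (rule card_Diff1_less[OF fin w])
    finally show False by simp
  qed
  have "weight_vector \<tau> (torus_act w \<tau>) x"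
    unfolding weight_vector_def using J by (simp add: shift_def)
  moreover have "w \<in> W" using w' by (auto intro: co_in_W)
  ultimately show ?thesis using that x by blast
qed


subsection \<open>Maximality forces the numerators not to vanish\<close>

text \<open>At a zero of the denominator the Bezout identity suffices. Otherwise
  \<open>Fop i\<close> is nonzero in both directions between \<tau> and its reflection; if its
  square vanished, the relation \<open>h * Fop i = 1\<close> modulo \<open>J \<tau>\<close> would
  kill the returning one.\<close>

lemma maximal_num_nonzero:
  assumes \<tau>: "\<tau> \<in> torus" and max: "maximal \<tau>"
  shows "ev \<tau> (num i * sact i (num i)) \<noteq> 0"
proof (cases "ev \<tau> (den i) = 0")
  case True
  then show ?thesis
    using ev_num_nonzero_of_den[OF \<tau>] by (simp add: ev_mult \<tau> ev_den_refl_fixed[OF \<tau> True])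
next
  case False
  let ?\<tau> = "torus_act (refl i) \<tau>"
  have \<tau>': "?\<tau> \<in> torus" using \<tau> by (simp add: torus_act_in_torus)
  have F: "weight_vector ?\<tau> \<tau> (Fop i)"
    using weight_vector_Fop[OF \<tau>' weight_vector_1[OF \<tau>'], of i] by (simp add: ev_torus_act_refl_refl)
  show ?thesis
  proof
    assume zero: "ev \<tau> (num i * sact i (num i)) = 0"
    obtain h where "h * Fop i - 1 \<in> J \<tau>" using maximal_generate[OF \<tau> max Fop_notin_J[OF \<tau> False]] .
    then have "(h * Fop i - 1) * Fop i \<in> J ?\<tau>" by (rule J_mult_weight_vector[OF \<tau>' F])
    moreover have "ev ?\<tau> (num i * sact i (num i)) = 0"
      using zero by (simp add: ev_torus_act_refl act_algebra_mult mult.commute)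
    then have "h * (Fop i * Fop i) \<in> J ?\<tau>"
      using J_ev[OF \<tau>', of h "num i * sact i (num i)"] by (simp add: Fop_square)
    ultimately have "h * (Fop i * Fop i) - (h * Fop i - 1) * Fop i \<in> J ?\<tau>" by (intro J_diff)
    then have "Fop i \<in> J ?\<tau>" by (simp add: left_diff_distrib mult.assoc)
    then show False using Fop_notin_J[OF \<tau>'] False ev_act_refl_den[OF \<tau>] by blast
  qed
qed

text \<open>Either the reflection fixes \<tau>, or right multiplication by \<open>Fop i\<close> is
  invertible up to a nonzero scalar and identifies the two modules.\<close>

lemma maximal_torus_act_refl:
  assumes \<tau>: "\<tau> \<in> torus" and max: "maximal \<tau>"
  shows "maximal (torus_act (refl i) \<tau>)"
proof (cases "ev \<tau> (den i) = 0")
  case True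
  then show ?thesis using max by (simp add: torus_act_refl_eq[OF \<tau>])
next
  case False
  let ?\<tau> = "torus_act (refl i) \<tau>" and ?g = "num i * sact i (num i)"
  have \<tau>': "?\<tau> \<in> torus" using \<tau> by (simp add: torus_act_in_torus)
  have F: "weight_vector \<tau> ?\<tau> (Fop i)" "weight_vector ?\<tau> \<tau> (Fop i)"
    using weight_vector_Fop[OF \<tau>' weight_vector_1[OF \<tau>'], of i]
      weight_vector_Fop[OF \<tau> weight_vector_1[OF \<tau>], of i] by (simp_all add: ev_torus_act_refl_refl)
  have g: "ev ?\<tau> ?g \<noteq> 0"
    using maximal_num_nonzero[OF \<tau> max, of i] by (simp add: ev_torus_act_refl act_algebra_mult mult.commute)
  have FF: "h * Fop i * Fop i - scl (ev ?\<tau> ?g) h \<in> J ?\<tau>" for h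
    using J_ev[OF \<tau>', of h ?g] by (simp add: Fop_square mult.assoc)
  show ?thesis unfolding maximal_def
  proof (intro allI impI, elim conjE)
    fix L assume L: "left_ideal L" "J ?\<tau> \<subseteq> L"
    define L' where "L' = {h. h * Fop i \<in> L}"
    have "left_ideal L'"
      unfolding left_ideal_def L'_def using L(1)
      by (auto simp: distrib_right mult.assoc intro: left_ideal_add left_ideal_mult) (simp add: left_ideal_def)
    moreover have "J \<tau> \<subseteq> L'" using J_mult_weight_vector[OF \<tau>' F(2)] L(2) by (auto simp: L'_def)
    ultimately consider "L' = J \<tau>" | "L' = UNIV" using max by (auto simp: maximal_def)
    then show "L = J ?\<tau> \<or> L = UNIV"
    proof cases
      case 1
      have "x \<in> J ?\<tau>" if x: "x \<in> L" for x
      proof -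
        have "x * Fop i * Fop i - scl (ev ?\<tau> ?g) x \<in> L" using FF L by blast
        then have "x * Fop i * Fop i \<in> L"
          using left_ideal_add[OF L(1) _ left_ideal_scl[OF L(1) x, of "ev ?\<tau> ?g"],
              of "x * Fop i * Fop i - scl (ev ?\<tau> ?g) x"] by simp
        then have "x * Fop i \<in> J \<tau>" using 1 by (auto simp: L'_def)
        then have "x * Fop i * Fop i \<in> J ?\<tau>" by (rule J_mult_weight_vector[OF \<tau>' F(2)])
        then have "x * Fop i * Fop i - (x * Fop i * Fop i - scl (ev ?\<tau> ?g) x) \<in> J ?\<tau>"
          using FF by (rule J_diff)
        then show ?thesis using J_scl_iff[OF \<tau>' g] by simp
      qed
      then show ?thesis using L by blast
    next
      case 2
      then have "1 * Fop i * Fop i \<in> L" using left_ideal_mult[OF L(1)] by (auto simp: L'_def)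
      then have "1 * Fop i * Fop i - (1 * Fop i * Fop i - scl (ev ?\<tau> ?g) 1) \<in> L"
        using FF[of 1] L(2) by (rule left_ideal_diff[OF L(1) _ set_mp[rotated]])
      then have "scl (inverse (ev ?\<tau> ?g)) (scl (ev ?\<tau> ?g) 1) \<in> L"
        unfolding diff_diff_eq2 add_diff_cancel_left' by (rule left_ideal_scl[OF L(1)])
      then show ?thesis using g left_ideal_UNIV_iff[OF L(1)] by simp
    qed
  qed
qed

lemma maximal_torus_act:
  assumes "w \<in> W" "\<tau> \<in> torus" "maximal \<tau>"
  shows "maximal (torus_act w \<tau>)"
  using assms(1)
proof (induction rule: W_induct)
  case id
  have "maximal (torus_act id \<tau>)" using assms by simp
  then show ?case .
next
  case (refl i w)
  have "maximal (torus_act (refl i) (torus_act w \<tau>))"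
    by (rule maximal_torus_act_refl) (use refl assms(2) in \<open>simp_all add: torus_act_in_torus\<close>)
  then show ?case unfolding torus_act_refl_comp[OF refl(1)] .
qed

lemma maximal_imp_U_set:
  assumes "\<tau> \<in> torus" "maximal \<tau>"
  shows "\<tau> \<in> U_set"
  unfolding U_set_iff[OF assms(1)]
proof (intro ballI allI)
  fix w i assume w: "w \<in> W"
  then show "ev (torus_act w \<tau>) (num i) \<noteq> 0"
    using maximal_num_nonzero[OF torus_act_in_torus[OF w assms(1)] maximal_torus_act[OF w assms], of i]
    by (auto simp: ev_mult torus_act_in_torus[OF w assms(1)])
qed


subsection \<open>Schur's lemma\<close>

text \<open>
  Amitsur's trick: if no \<open>x - c\<close> lay in the ideal, the inverses of the \<open>x - c\<close> for uncountably
  many \<open>c\<close> would be linearly independent in a space of countable dimension.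
\<close>

definition eval_at :: "'h \<Rightarrow> complex poly \<Rightarrow> 'h" where
  "eval_at x r = fold_coeffs (\<lambda>c h. scl c 1 + h * x) r 0"

lemma eval_at_0 [simp]: "eval_at x 0 = 0"
  by (simp add: eval_at_def)

lemma eval_at_pCons: "eval_at x (pCons c r) = scl c 1 + eval_at x r * x"
  by (cases "r = 0 \<and> c = 0") (auto simp: eval_at_def)

lemma eval_at_add: "eval_at x (r + r') = eval_at x r + eval_at x r'"
  by (induction r r' rule: poly_induct2) (simp_all add: eval_at_pCons scale_left_distrib distrib_right)

lemma eval_at_smult: "eval_at x (Polynomial.smult c r) = scl c (eval_at x r)"
  by (induction r) (simp_all add: eval_at_pCons scale_right_distrib scl_mult_left)

lemma eval_at_commute: "eval_at x r * x = x * eval_at x r"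
  by (induction r) (simp_all add: eval_at_pCons distrib_left distrib_right scl_mult_left scl_mult_right mult.assoc)

lemma eval_at_mult: "eval_at x (r * r') = eval_at x r * eval_at x r'"
proof (induction r)
  case (pCons c r)
  have "eval_at x (pCons c r * r') = scl c (eval_at x r') + eval_at x r * eval_at x r' * x"
    using pCons.IH by (simp add: mult_pCons_left eval_at_add eval_at_smult eval_at_pCons)
  also have "\<dots> = eval_at x (pCons c r) * eval_at x r'"
    by (simp add: eval_at_pCons distrib_right scl_mult_left mult.assoc eval_at_commute[of x r'])
  finally show ?case .
qed simp

lemma eval_at_sum: "eval_at x (sum f S) = (\<Sum>s\<in>S. eval_at x (f s))"
  by (induction S rule: infinite_finite_induct) (simp_all add: eval_at_add)

lemma eval_at_linear: "eval_at x [:- c, 1:] = x - scl c 1"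
  by (simp add: eval_at_pCons)

lemma J_mult_eval_at:
  assumes \<tau>: "\<tau> \<in> torus" and x: "weight_vector \<tau> \<tau> x" and h: "h \<in> J \<tau>"
  shows "h * eval_at x r \<in> J \<tau>"
proof (induction r)
  case (pCons c r)
  have "h * eval_at x r * x \<in> J \<tau>" by (rule J_mult_weight_vector[OF \<tau> x pCons.IH])
  then show ?case
    using J_scl[OF \<tau> h, of c] by (simp add: eval_at_pCons distrib_left scl_mult_right J_add flip: mult.assoc)
qed simp

text \<open>Over the complex numbers the polynomial splits into linear factors, each of which can be
  cancelled.\<close>

lemma maximal_eval_at_cancel:
  assumes \<tau>: "\<tau> \<in> torus" and max: "maximal \<tau>" and x: "weight_vector \<tau> \<tau> x"
    and nonscalar: "\<And>c. x - scl c 1 \<notin> J \<tau>"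
  shows "r \<noteq> 0 \<Longrightarrow> h * eval_at x r \<in> J \<tau> \<Longrightarrow> h \<in> J \<tau>"
proof (induction "degree r" arbitrary: r h)
  case 0
  then obtain c where "r = [:c:]" "c \<noteq> 0" by (metis degree_eq_zeroE pCons_0_0)
  then show ?case using 0 J_scl_iff[OF \<tau>] by (simp add: eval_at_pCons scl_mult_right)
next
  case (Suc n)
  then have "\<not> constant (poly r)" by (simp add: constant_degree)
  then obtain e where "poly r e = 0" using fundamental_theorem_of_algebra by blast
  then obtain r' where r': "r = [:- e, 1:] * r'" by (auto simp: poly_eq_0_iff_dvd)
  then have "r' \<noteq> 0" using Suc.prems by auto
  then have "degree r = Suc (degree r')" unfolding r' by (subst degree_mult_eq) auto
  then have deg: "n = degree r'" using Suc.hyps by simp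
  have "eval_at x r = eval_at x r' * (x - scl e 1)"
    unfolding r' by (subst mult.commute) (simp only: eval_at_mult eval_at_linear)
  then have "h * eval_at x r' * (x - scl e 1) \<in> J \<tau>" using Suc.prems by (simp add: mult.assoc)
  then have "h * eval_at x r' \<in> J \<tau>"
    by (rule maximal_right_cancel[OF \<tau> max weight_vector_diff_scl[OF \<tau> x weight_vector_1[OF \<tau>]] nonscalar])
  then show ?case using Suc.hyps(1)[OF deg \<open>r' \<noteq> 0\<close>] by blast
qed

text \<open>Partial fractions: multiplied by the product of all \<open>x - d\<close>, the
  combination becomes a polynomial in \<open>x\<close> that is nonzero at \<open>c0\<close>, since
  every other summand contains the factor vanishing there.\<close>

lemma resolvents_independent:
  assumes \<tau>: "\<tau> \<in> torus" and max: "maximal \<tau>" and x: "weight_vector \<tau> \<tau> x"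
    and nonscalar: "\<And>c. x - scl c 1 \<notin> J \<tau>"
    and g: "\<And>c. g c * (x - scl c 1) - 1 \<in> J \<tau>"
    and F: "finite F" and zero: "(\<Sum>c\<in>F. scl (u c) (g c)) \<in> J \<tau>" and c0: "c0 \<in> F"
  shows "u c0 = 0"
proof (rule ccontr)
  assume u0: "u c0 \<noteq> 0"
  define P where "P c = (\<Prod>d\<in>F - {c}. [:- d, 1:])" for c :: complex
  define G where "G = (\<Prod>d\<in>F. [:- d, 1:])"
  define r where "r = (\<Sum>c\<in>F. Polynomial.smult (u c) (P c))"
  have "poly r c0 = (\<Sum>c\<in>F. u c * poly (P c) c0)" by (simp add: r_def poly_sum)
  also have "\<dots> = (\<Sum>c\<in>{c0}. u c * poly (P c) c0)"
    by (rule sum.mono_neutral_right) (use F c0 in \<open>auto simp: P_def poly_prod\<close>)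
  also have "\<dots> = u c0 * (\<Prod>d\<in>F - {c0}. c0 - d)" by (simp add: P_def poly_prod)
  also have "\<dots> \<noteq> 0" using u0 F by simp
  finally have "r \<noteq> 0" by auto
  have gG: "g c * eval_at x G - eval_at x (P c) \<in> J \<tau>" if "c \<in> F" for c
  proof -
    have "G = [:- c, 1:] * P c" unfolding G_def P_def using F that by (rule prod.remove)
    then have "g c * eval_at x G - eval_at x (P c) = (g c * (x - scl c 1) - 1) * eval_at x (P c)"
      by (simp only: eval_at_mult eval_at_linear left_diff_distrib mult.assoc mult_1_left)
    then show ?thesis using J_mult_eval_at[OF \<tau> x g] by simp
  qed
  have 1: "(\<Sum>c\<in>F. scl (u c) (g c * eval_at x G - eval_at x (P c))) \<in> J \<tau>"
    by (rule J_sum) (rule J_scl[OF \<tau> gG])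
  have 2: "(\<Sum>c\<in>F. scl (u c) (g c)) * eval_at x G \<in> J \<tau>" by (rule J_mult_eval_at[OF \<tau> x zero])
  have "(\<Sum>c\<in>F. scl (u c) (g c)) * eval_at x G - (\<Sum>c\<in>F. scl (u c) (g c * eval_at x G - eval_at x (P c)))
      = 1 * eval_at x r"
    by (simp add: r_def eval_at_sum eval_at_smult scale_right_diff_distrib sum_subtractf sum_distrib_right scl_mult_left)
  with J_diff[OF 2 1] have "1 * eval_at x r \<in> J \<tau>" by (simp only:)
  then have "1 \<in> J \<tau>" by (rule maximal_eval_at_cancel[OF \<tau> max x nonscalar \<open>r \<noteq> 0\<close>])
  then show False using one_notin_J[OF \<tau>] by blast
qed

lemma maximal_weight_vector_scalar:
  assumes \<tau>: "\<tau> \<in> torus" and max: "maximal \<tau>" and x: "weight_vector \<tau> \<tau> x"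
  shows "\<exists>c. x - scl c 1 \<in> J \<tau>"
proof (rule ccontr)
  assume "\<nexists>c. x - scl c 1 \<in> J \<tau>"
  then have nonscalar: "x - scl c 1 \<notin> J \<tau>" for c by blast
  have "\<exists>h. h * (x - scl c 1) - 1 \<in> J \<tau>" for c
    using maximal_generate[OF \<tau> max nonscalar] by metis
  then obtain g where g: "\<And>c. g c * (x - scl c 1) - 1 \<in> J \<tau>" by metis
  \<comment> \<open>The complex numbers are uncountable, so infinitely many resolvents are supported
    in one finite set of Weyl group elements.\<close>
  define C where "C j = {c. \<forall>w. co \<tau> (g c) w \<noteq> 0 \<longrightarrow> w \<in> Wl j}" for j
  have "\<exists>j. infinite (C j)"
  proof (rule ccontr)
    assume "\<nexists>j. infinite (C j)"
    then have "countable (\<Union>j. C j)" by (simp add: countable_finite)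
    moreover have "c \<in> (\<Union>j. C j)" for c using co_level[of \<tau> "g c"] by (simp add: C_def)
    then have "(\<Union>j. C j) = UNIV" by blast
    ultimately show False using uncountable_UNIV_complex by simp
  qed
  then obtain j where j: "infinite (C j)" by blast
  \<comment> \<open>Reduced representatives turn independence modulo \<open>J \<tau>\<close> into
    independence inside a finite-dimensional span.\<close>
  define f where "f c = red \<tau> (g c)" for c
  have cong: "g c - f c \<in> J \<tau>" for c unfolding f_def by (rule red_cong[OF \<tau>])
  have indep: "u c0 = 0" if "finite F" "(\<Sum>c\<in>F. scl (u c) (f c)) = 0" "c0 \<in> F" for F u c0
  proof -
    have "(\<Sum>c\<in>F. scl (u c) (g c - f c)) \<in> J \<tau>" by (rule J_sum) (rule J_scl[OF \<tau> cong])
    then have "(\<Sum>c\<in>F. scl (u c) (g c)) \<in> J \<tau>"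
      using that(2) by (simp add: scale_right_diff_distrib sum_subtractf)
    then show ?thesis using resolvents_independent[OF \<tau> max x nonscalar g that(1)] that(3) by blast
  qed
  have inj: "inj_on f (C j)"
  proof (rule inj_onI, rule ccontr)
    fix c d assume cd: "f c = f d" "c \<noteq> d"
    then have "(\<Sum>e\<in>{c, d}. scl (if e = c then 1 else - 1) (f e)) = 0" by simp
    from indep[OF _ this, of c] show False by simp
  qed
  have "independent (f ` C j)"
    unfolding dependent_explicit
  proof (intro notI, elim exE conjE bexE)
    fix T u v assume T: "finite T" "T \<subseteq> f ` C j" "(\<Sum>v\<in>T. scl (u v) v) = 0" "v \<in> T" "u v \<noteq> 0"
    then obtain F where F: "F \<subseteq> C j" "inj_on f F" "T = f ` F" by (meson subset_image_inj)
    then have "finite F" using T(1) finite_image_iff by blast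
    have "(\<Sum>c\<in>F. scl ((u \<circ> f) c) (f c)) = 0" using T(3) unfolding F(3) by (simp add: sum.reindex[OF F(2)])
    moreover obtain c where "c \<in> F" "v = f c" using T(4) F(3) by blast
    ultimately have "(u \<circ> f) c = 0" by (intro indep[OF \<open>finite F\<close>])
    then show False using T(5) \<open>v = f c\<close> by simp
  qed
  moreover have "f ` C j \<subseteq> span (H ` Wl j)"
  proof clarify
    fix c assume "c \<in> C j"
    then show "f c \<in> span (H ` Wl j)"
      unfolding f_def red_def by (intro span_sum span_scale span_base) (auto simp: C_def)
  qed
  ultimately have "finite (f ` C j)"
    using independent_span_bound[of "H ` Wl j" "f ` C j"] by simp
  then show False using j inj finite_image_iff by blast
qed

end

section \<open>Walls of a character\<close>

lemma reflection_closed_translation: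
  fixes S :: "int set"
  assumes S: "\<And>i j. i \<in> S \<Longrightarrow> j \<in> S \<Longrightarrow> 2 * i - j \<in> S"
  shows "i \<in> S \<Longrightarrow> j \<in> S \<Longrightarrow> k \<in> S \<Longrightarrow> i + k - j \<in> S"
proof (induction "nat (\<bar>i - j\<bar> + \<bar>k - j\<bar>)" arbitrary: i k rule: less_induct)
  case less
  have shift: "x + 2 * (l - j) \<in> S" "x - 2 * (l - j) \<in> S" if "x \<in> S" "l \<in> S" for x l
    using S[OF that(2) S[OF less.prems(2) that(1)]] S[OF less.prems(2) S[OF that(2) that(1)]]
    by (simp_all add: algebra_simps)
  \<comment> \<open>The farther point is moved towards \<open>j\<close> by twice the smaller
    displacement, and the result is moved back.\<close>
  have step: "i + k - j \<in> S"
    if "i \<in> S" "k \<in> S" "\<bar>k - j\<bar> < \<bar>i - j\<bar>" "k \<noteq> j"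
      and IH: "\<And>i' k'. nat (\<bar>i' - j\<bar> + \<bar>k' - j\<bar>) < nat (\<bar>i - j\<bar> + \<bar>k - j\<bar>) \<Longrightarrow>
        i' \<in> S \<Longrightarrow> k' \<in> S \<Longrightarrow> i' + k' - j \<in> S" for i k
  proof (cases "(i - j > 0) = (k - j > 0)")
    case True
    define i' where "i' = i - 2 * (k - j)"
    have "i' \<in> S" unfolding i'_def using shift that by blast
    moreover have "\<bar>i' - j\<bar> < \<bar>i - j\<bar>" using that True by (auto simp: i'_def)
    ultimately have "i' + k - j \<in> S" using IH[of i' k] that by simp
    then show ?thesis using shift(1)[of "i' + k - j" k] that by (simp add: i'_def algebra_simps)
  next
    case False
    define i' where "i' = i + 2 * (k - j)"
    have "i' \<in> S" unfolding i'_def using shift that by blast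
    moreover have "\<bar>i' - j\<bar> < \<bar>i - j\<bar>" using that False by (auto simp: i'_def)
    ultimately have "i' + k - j \<in> S" using IH[of i' k] that by simp
    then show ?thesis using shift(2)[of "i' + k - j" k] that by (simp add: i'_def algebra_simps)
  qed
  have IH: "i' + k' - j \<in> S"
    if "nat (\<bar>i' - j\<bar> + \<bar>k' - j\<bar>) < nat (\<bar>i - j\<bar> + \<bar>k - j\<bar>)" "i' \<in> S" "k' \<in> S" for i' k'
    using less.hyps[OF that(1,2) less.prems(2) that(3)] .
  have IH': "i' + k' - j \<in> S"
    if "nat (\<bar>i' - j\<bar> + \<bar>k' - j\<bar>) < nat (\<bar>k - j\<bar> + \<bar>i - j\<bar>)" "i' \<in> S" "k' \<in> S" for i' k'
    by (rule IH) (use that in \<open>simp_all add: add.commute\<close>)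
  consider "i = j" | "k = j" | "i = k" | "i - j = j - k"
    | "\<bar>k - j\<bar> < \<bar>i - j\<bar>" "k \<noteq> j" | "\<bar>i - j\<bar> < \<bar>k - j\<bar>" "i \<noteq> j" by linarith
  then show ?case
  proof cases
    case 3
    then show ?thesis using S[of i j] less.prems by simp
  next
    case 4
    then have "i + k - j = j" by simp
    then show ?thesis using less.prems by simp
  next
    case 5
    show ?thesis by (rule step[OF less.prems(1,3) 5 IH])
  next
    case 6
    have "k + i - j \<in> S" by (rule step[OF less.prems(3,1) 6 IH'])
    then show ?thesis by (simp add: add.commute)
  qed (use less.prems in simp_all)
qed

lemma finite_ex_max:
  fixes f :: "'a \<Rightarrow> 'b::linorder"
  assumes "finite F" "F \<noteq> {}"
  shows "\<exists>x\<in>F. \<forall>y\<in>F. f y \<le> f x"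
  using Max_in[of "f ` F"] Max_ge[of "f ` F"] assms by fastforce

locale rank_two_principal = rank_two_hecke A pairing \<alpha> \<alpha>v \<sigma> \<sigma>' scl ZH a b
  for A :: "'i::finite \<Rightarrow> 'i \<Rightarrow> int"
    and pairing :: "'x::finite_free_ab_group \<Rightarrow> 'y::finite_free_ab_group \<Rightarrow> int"
    and \<alpha> :: "'i \<Rightarrow> 'x"
    and \<alpha>v :: "'i \<Rightarrow> 'y"
    and \<sigma> \<sigma>' :: "'i \<Rightarrow> complex"
    and scl :: "complex \<Rightarrow> 'h::ring_1 \<Rightarrow> 'h"
    and ZH :: "'y \<Rightarrow> ('y \<Rightarrow> 'y) \<Rightarrow> 'h"
    and a b :: 'i +
  fixes \<tau> :: "'y \<Rightarrow> complex"
  assumes \<tau>: "\<tau> \<in> torus"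
begin

abbreviation wt :: "int \<Rightarrow> 'y \<Rightarrow> complex" where
  "wt n \<equiv> torus_act (ch n) \<tau>"

definition P :: "int set" where
  "P = {k. ev (wt k) (den (wall_label k)) = 0}"

definition wall :: "'i \<Rightarrow> int \<Rightarrow> int" where
  "wall i q = (if wall_label q = i then q else q + 1)"

lemma wt_torus [simp]: "wt n \<in> torus"
  by (simp add: torus_act_in_torus \<tau>)

lemma wt_nb: "wt (nb i q) = torus_act (refl i) (wt q)"
  by (simp only: ch_nb torus_act_refl_comp[OF ch_in_W])

lemma wall_label_wall: "wall_label (wall i q) = i"
  using wall_label_neq(1)[of q i] by (simp add: wall_def)

lemma nb_wall: "nb i q = 2 * wall i q - 1 - q"
  by (simp add: nb_def wall_def)

lemma nb_nb [simp]: "nb i (nb i q) = q"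
  using wall_label_eq_iff[of q "q - 1"] wall_label_neq(1)[of q i] by (auto simp: nb_def)

lemma wall_nb [simp]: "wall i (nb i q) = wall i q"
  using nb_nb[of i q] by (simp add: nb_wall)

lemma wall_in_P: "wall i q \<in> P \<longleftrightarrow> ev (wt q) (den i) = 0"
proof (cases "wall_label q = i")
  case False
  then have "nb i q = q + 1" "wall i q = q + 1" by (simp_all add: nb_def wall_def)
  then show ?thesis
    using wt_nb[of i q] ev_act_refl_den[of "wt q" i] wall_label_wall[of i q] by (simp add: P_def)
qed (simp add: P_def wall_def)

text \<open>The vanishing can be tested from either side of the wall.\<close>

lemma P_iff: "k \<in> P \<longleftrightarrow> ev (wt (k - 1)) (den (wall_label k)) = 0"
proof -
  have "wall_label (k - 1) \<noteq> wall_label k" using wall_label_eq_iff by simp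
  then have "wall (wall_label k) (k - 1) = k" by (simp add: wall_def)
  then show ?thesis using wall_in_P[of "wall_label k" "k - 1"] by simp
qed

lemma wt_nb_P: "wall i q \<in> P \<Longrightarrow> wt (nb i q) = wt q"
  unfolding wt_nb wall_in_P by (rule torus_act_refl_eq) simp

lemma wt_comp: "ch l \<circ> ch k = ch n \<Longrightarrow> wt n = torus_act (ch l) (wt k)"
  using torus_act_comp[OF ch_in_W ch_in_W, of l k \<tau>] by (simp only:)

lemma wall_refl_fixes: "p \<in> P \<Longrightarrow> wt (2 * p - 1) = \<tau>"
proof -
  assume p: "p \<in> P"
  have "wt (2 * p - 1) = torus_act (inv_into UNIV (ch p) \<circ> refl (wall_label p) \<circ> ch p) \<tau>"
    by (simp only: conj_wall)
  also have "\<dots> = torus_act (inv_into UNIV (ch p)) (torus_act (refl (wall_label p)) (wt p))"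
    by (simp add: torus_act_comp W_comp W_inv)
  also have "torus_act (refl (wall_label p)) (wt p) = wt p"
    using p by (intro torus_act_refl_eq) (simp_all add: P_def)
  also have "torus_act (inv_into UNIV (ch p)) (wt p) = \<tau>"
    by (simp only: W_inv ch_in_W W_comp_inv torus_act_id flip: torus_act_comp)
  finally show ?thesis .
qed

text \<open>Folding at a wall in \<open>P\<close> does not change the weight.\<close>

lemma wt_reflect: "p \<in> P \<Longrightarrow> wt (2 * p - 1 - n) = wt n"
proof -
  assume p: "p \<in> P"
  have "ch n \<circ> ch (2 * p - 1) = ch (2 * p - 1 - n)" by (rule ch_mult_odd) simp
  from wt_comp[OF this] show ?thesis by (simp add: wall_refl_fixes[OF p])
qed

text \<open>The reflection takes the wall \<open>k\<close> to the wall \<open>2 * p - k\<close> of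
  the same type and exchanges the sides, whence the detour through \<open>P_iff\<close>.\<close>

lemma P_reflect_iff: "p \<in> P \<Longrightarrow> 2 * p - k \<in> P \<longleftrightarrow> k \<in> P"
proof -
  assume p: "p \<in> P"
  have "wall_label (2 * p - k) = wall_label k" by (rule wall_label_cong) simp
  moreover have "wt (2 * p - k) = wt (k - 1)" using wt_reflect[OF p, of "k - 1"] by simp
  ultimately have "2 * p - k \<in> P \<longleftrightarrow> ev (wt (k - 1)) (den (wall_label k)) = 0" by (simp add: P_def)
  then show ?thesis by (simp only: P_iff[of k])
qed

lemma P_translate:
  assumes "i \<in> P" "j \<in> P" "k \<in> P"
  shows "i + k - j \<in> P"
proof (rule reflection_closed_translation[where S = P])
  show "2 * i - j \<in> P" if "i \<in> P" "j \<in> P" for i j using P_reflect_iff[of i j] that by blast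
qed (use assms in simp_all)

lemma wt_add_stab: "wt n = \<tau> \<Longrightarrow> even n \<Longrightarrow> wt (n + k) = wt k"
  using wt_comp[OF ch_mult_even[of n k]] by simp

lemma wt_diff_stab: "wt n = \<tau> \<Longrightarrow> odd n \<Longrightarrow> wt (n - k) = wt k"
  using wt_comp[OF ch_mult_odd[of n k]] by simp

lemma P_stab_even: "wt n = \<tau> \<Longrightarrow> even n \<Longrightarrow> n + k \<in> P \<longleftrightarrow> k \<in> P"
  using wall_label_cong[of "n + k" k] wt_add_stab[of n k] by (simp add: P_def)

lemma P_stab_odd: "wt n = \<tau> \<Longrightarrow> odd n \<Longrightarrow> n + 1 - k \<in> P \<longleftrightarrow> k \<in> P"
proof -
  assume n: "wt n = \<tau>" "odd n"
  have "wall_label (n + 1 - k) = wall_label k" using n(2) by (intro wall_label_cong) simp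
  moreover have "wt (n + 1 - k) = wt (k - 1)" using wt_diff_stab[OF n, of "k - 1"] by (simp add: diff_diff_eq2)
  ultimately have "n + 1 - k \<in> P \<longleftrightarrow> ev (wt (k - 1)) (den (wall_label k)) = 0" by (simp add: P_def)
  then show ?thesis by (simp only: P_iff[of k])
qed

text \<open>In a finite group several indices name one reflection. The element \<open>u\<close>
  carries one wall to the other and its coroot to plus or minus the other coroot, with the same
  parameters; the sign does not affect the vanishing of the denominator.\<close>

lemma P_determined_by_reflection:
  assumes eq: "ch (2 * k - 1) = ch (2 * k' - 1)"
  shows "k \<in> P \<longleftrightarrow> k' \<in> P"
proof -
  define i j u where "i = wall_label k" and "j = wall_label k'" and "u = ch k' \<circ> inv_into UNIV (ch k)"
  have u: "u \<in> W" by (simp add: u_def W_comp W_inv)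
  have "u \<circ> refl i \<circ> inv_into UNIV u = refl j"
    using conj_refl_transfer[of "inv_into UNIV (ch k)" "inv_into UNIV (ch k')" i j] eq
    by (simp add: W_inv u_def i_def j_def conj_wall)
  note conj = this
  have "inv_into UNIV u (\<alpha>v j) = \<alpha>v i \<or> inv_into UNIV u (\<alpha>v j) = - \<alpha>v i"
    using conj_simple_coroot[OF u conj] u by (metis W_inv_f_f W_inv W_minus minus_minus)
  moreover have par: "\<sigma> i = \<sigma> j" "\<sigma>' i = \<sigma>' j" using conj_parameters[OF u conj] .
  moreover have "ev (torus_act u (wt k)) (den j) = ev (wt k) (den_at (\<sigma> j) (\<sigma>' j) (inv_into UNIV u (\<alpha>v j)))"
    using u by (simp only: den_def ev_torus_act[OF u] act_den_at W_inv)
  ultimately have "ev (torus_act u (wt k)) (den j) = 0 \<longleftrightarrow> ev (wt k) (den i) = 0"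
    using ev_den_at_minus[OF wt_torus] unfolding den_def by metis
  moreover have "torus_act u (wt k) = wt k'"
    by (simp add: u_def W_inv W_comp comp_assoc W_comp_inv flip: torus_act_comp)
  ultimately show ?thesis by (simp add: P_def i_def j_def)
qed

text \<open>The period is \<open>per\<close>, half that of the chambers: opposite walls define the
  same reflection.\<close>

lemma P_periodic: "k + int per \<in> P \<longleftrightarrow> k \<in> P"
  by (rule P_determined_by_reflection) (simp add: ch_eq_iff)

subsection \<open>Counting the walls crossed\<close>

text \<open>The walls between the chambers 0 and \<open>n\<close>. The intervals are half open
  because the wall \<open>k\<close> lies between the chambers \<open>k - 1\<close> and
  \<open>k\<close>.\<close>

definition btw :: "int \<Rightarrow> int set" where
  "btw n = {k. (0 < k \<and> k \<le> n) \<or> (n < k \<and> k \<le> 0)}"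

definition cnt :: "int \<Rightarrow> nat" where
  "cnt n = card (P \<inter> btw n)"

abbreviation outward :: "'i \<Rightarrow> int \<Rightarrow> bool" where
  "outward i q \<equiv> \<bar>nb i q\<bar> > \<bar>q\<bar>"

lemma btw_0 [simp]: "btw 0 = {}"
  by (auto simp: btw_def)

lemma btw_pos: "n \<ge> 0 \<Longrightarrow> btw n = {0<..n}" and btw_neg: "n \<le> 0 \<Longrightarrow> btw n = {n<..0}"
  by (auto simp: btw_def)

lemma finite_btw [simp]: "finite (btw n)"
  by (cases "n \<ge> 0") (simp_all add: btw_pos btw_neg)

lemma outward_cases: "outward i q \<or> outward i (nb i q)"
  using abs_nb[of i q] by auto

lemma btw_outward: "outward i q \<Longrightarrow> btw (nb i q) = insert (wall i q) (btw q) \<and> wall i q \<notin> btw q"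
  by (auto simp: btw_def nb_def wall_def split: if_splits)

lemma cnt_outward: "outward i q \<Longrightarrow> cnt (nb i q) = cnt q + (if wall i q \<in> P then 1 else 0)"
  using btw_outward[of q i] by (simp add: cnt_def)

lemma cnt_nb_notin_P: "wall i q \<notin> P \<Longrightarrow> cnt (nb i q) = cnt q"
  using outward_cases[of q i] cnt_outward[of q i] cnt_outward[of "nb i q" i] by auto

lemma ex_outward:
  assumes "n \<noteq> 0"
  obtains i q where "n = nb i q" "outward i q" "\<bar>n\<bar> = \<bar>q\<bar> + 1"
proof (cases "n > 0")
  case True
  have "wall_label (n - 1) \<noteq> wall_label n" using wall_label_eq_iff by simp
  then show ?thesis using that[of "wall_label n" "n - 1"] True by (simp add: nb_def)
next
  case False
  then show ?thesis using that[of "wall_label (n + 1)" "n + 1"] assms by (simp add: nb_def)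
qed

lemma path_induct [case_names zero step]:
  assumes "R 0" "\<And>i q. outward i q \<Longrightarrow> \<bar>nb i q\<bar> = \<bar>q\<bar> + 1 \<Longrightarrow> R q \<Longrightarrow> R (nb i q)"
  shows "R n"
proof (induction "nat \<bar>n\<bar>" arbitrary: n rule: less_induct)
  case less
  show ?case
  proof (cases "n = 0")
    case False
    then obtain i q where "n = nb i q" "outward i q" "\<bar>n\<bar> = \<bar>q\<bar> + 1" by (rule ex_outward)
    then show ?thesis using assms(2)[of q i] less by auto
  qed (use assms in simp)
qed

primrec gv_pos :: "nat \<Rightarrow> 'h" where
  "gv_pos 0 = 1"
| "gv_pos (Suc n) = (if int (Suc n) \<in> P then Kop (wall_label (int (Suc n))) else Fop (wall_label (int (Suc n)))) * gv_pos n"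

primrec gv_neg :: "nat \<Rightarrow> 'h" where
  "gv_neg 0 = 1"
| "gv_neg (Suc n) = (if - int n \<in> P then Kop (wall_label (- int n)) else Fop (wall_label (- int n))) * gv_neg n"

text \<open>
  Along the gallery from the chamber 0 to the chamber \<open>n\<close> every wall contributes an
  intertwiner, or its regularisation \<open>Kop\<close> if the denominator vanishes there.
\<close>

definition gv :: "int \<Rightarrow> 'h" where
  "gv n = (if n \<ge> 0 then gv_pos (nat n) else gv_neg (nat (- n)))"

lemma gv_0 [simp]: "gv 0 = 1"
  by (simp add: gv_def)

lemma gv_outward: "outward i q \<Longrightarrow> gv (nb i q) = (if wall i q \<in> P then Kop i else Fop i) * gv q"
proof (cases "wall_label q = i")
  case True
  assume o: "outward i q"
  have nb: "nb i q = q - 1" "wall i q = q" using True by (simp_all add: nb_def wall_def)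
  then have "q \<le> 0" using o by simp
  then have "nat (- (q - 1)) = Suc (nat (- q))" "- int (nat (- q)) = q" by arith+
  moreover have "gv q = gv_neg (nat (- q))" using \<open>q \<le> 0\<close> by (cases "q = 0") (simp_all add: gv_def)
  ultimately show ?thesis using \<open>q \<le> 0\<close> True by (simp add: nb gv_def)
next
  case False
  assume o: "outward i q"
  have nb: "nb i q = q + 1" "wall i q = q + 1" using False by (simp_all add: nb_def wall_def)
  then have "q \<ge> 0" using o by simp
  then have "nat (q + 1) = Suc (nat q)" "int (Suc (nat q)) = q + 1" by simp_all
  then show ?thesis using \<open>q \<ge> 0\<close> wall_label_neq(1)[OF False] by (simp add: nb gv_def del: of_nat_Suc)
qed

text \<open>Within the bound the gallery is reduced, so lengths grow at each step, and
  \<open>Fop\<close> is used only where the denominator does not vanish.\<close>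

lemma lead_gv: "per = 0 \<or> \<bar>n\<bar> \<le> int per \<Longrightarrow> lead \<tau> (ch n) (gv n)"
proof (induction n rule: path_induct)
  case zero
  have "lead \<tau> id 1" by (rule lead_1[OF \<tau>])
  then show ?case by (simp flip: id_def)
next
  case (step i q)
  then have q: "lead \<tau> (ch q) (gv q)" by auto
  have "len (ch (nb i q)) = nat \<bar>nb i q\<bar>" "len (ch q) = nat \<bar>q\<bar>"
    using step len_ch[of "nb i q"] len_ch[of q] by auto
  then have len: "len (refl i \<circ> ch q) = len (ch q) + 1"
    using step(2) unfolding ch_nb[symmetric] by (simp add: nat_add_distrib)
  show ?case unfolding gv_outward[OF step(1)] ch_nb
    using lead_Kop[OF \<tau> q len] lead_Fop[OF \<tau> q len] by (simp add: wall_in_P del: comp_apply)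
qed

lemma weight_vector_gv: "P \<inter> btw n = {} \<Longrightarrow> weight_vector \<tau> (wt n) (gv n)"
proof (induction n rule: path_induct)
  case zero
  have "weight_vector \<tau> (wt 0) (gv 0)" using weight_vector_1[OF \<tau>] by simp
  then show ?case .
next
  case (step i q)
  then have "P \<inter> btw q = {}" "wall i q \<notin> P" using btw_outward[OF step(1)] by auto
  then show ?case using step weight_vector_Fop[OF \<tau>, of "wt q" "gv q" i] by (simp add: gv_outward wt_nb)
qed


subsection \<open>The group generated by the reflections in the walls\<close>

lemma W_paren_generate: "W_paren \<tau> = generate (BijGroup UNIV) {ch (2 * k - 1) |k. k \<in> P}"
proof -
  have "{inv_into UNIV w \<circ> refl i \<circ> w |w i. w \<in> W \<and> ev (torus_act w \<tau>) (den i) = 0} = {ch (2 * k - 1) |k. k \<in> P}"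
  proof (intro equalityI subsetI)
    fix r assume "r \<in> {inv_into UNIV w \<circ> refl i \<circ> w |w i. w \<in> W \<and> ev (torus_act w \<tau>) (den i) = 0}"
    then obtain w i where w: "w \<in> W" "ev (torus_act w \<tau>) (den i) = 0" "r = inv_into UNIV w \<circ> refl i \<circ> w" by blast
    obtain q where q: "w = ch q" using w(1) by (rule W_cases)
    have "r = inv_into UNIV (ch (wall i q)) \<circ> refl i \<circ> ch (wall i q)"
    proof (cases "wall i q = q")
      case False
      then have "ch (wall i q) = refl i \<circ> ch q" using ch_nb[of i q] by (auto simp: wall_def nb_def split: if_splits)
      then show ?thesis by (simp add: w(3) q inv_refl_comp comp_assoc)
    qed (simp add: w(3) q)
    then have "r = ch (2 * wall i q - 1)" using conj_wall[of "wall i q"] by (simp add: wall_label_wall)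
    moreover have "wall i q \<in> P" using w(2) q by (simp add: wall_in_P)
    ultimately show "r \<in> {ch (2 * k - 1) |k. k \<in> P}" by blast
  next
    fix r assume "r \<in> {ch (2 * k - 1) |k. k \<in> P}"
    then obtain k where "r = ch (2 * k - 1)" "k \<in> P" by blast
    then show "r \<in> {inv_into UNIV w \<circ> refl i \<circ> w |w i. w \<in> W \<and> ev (torus_act w \<tau>) (den i) = 0}"
      using conj_wall[of k] by (intro CollectI exI[of _ "ch k"] exI[of _ "wall_label k"]) (simp add: P_def)
  qed
  then show ?thesis by (simp add: W_paren_eq[OF \<tau>])
qed

lemma bij_ch: "bij (ch n)"
  by (rule W_subset_bij) simp

lemma W_paren_refl: "k \<in> P \<Longrightarrow> ch (2 * k - 1) \<in> W_paren \<tau>"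
  unfolding W_paren_generate by (rule generate.incl) blast

lemma W_paren_id: "id \<in> W_paren \<tau>"
  unfolding W_paren_generate using generate.one[of "BijGroup UNIV"] by (simp only: one_BijGroup)

lemma W_paren_comp: "ch k \<in> W_paren \<tau> \<Longrightarrow> ch l \<in> W_paren \<tau> \<Longrightarrow> ch k \<circ> ch l \<in> W_paren \<tau>"
  unfolding W_paren_generate mult_BijGroup[OF bij_ch bij_ch, symmetric] by (rule generate.eng)

text \<open>A set of indices containing those of the generators and closed under products, which
  shows that the reflections in \<open>W_paren \<tau>\<close> are those in the walls of
  \<open>P\<close>. An even \<open>n\<close> arises from two reflections whose walls are
  \<open>n div 2\<close> apart; by \<open>P_translate\<close> this distance itself, not only its
  double, preserves \<open>P\<close>.\<close>

definition E :: "int set" where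
  "E = {n. if odd n then (n + 1) div 2 \<in> P else (\<forall>k\<in>P. k + n div 2 \<in> P \<and> k - n div 2 \<in> P)}"

lemma E_mult: "n \<in> E \<Longrightarrow> m \<in> E \<Longrightarrow> (if even m then m + n else m - n) \<in> E"
proof -
  assume n: "n \<in> E" and m: "m \<in> E"
  have even_div: "(2 * x) div 2 = x" for x :: int by simp
  show ?thesis
  proof (cases "even m"; cases "even n")
    assume "even m" "even n"
    then obtain x z where "m = 2 * x" "n = 2 * z" by (auto elim!: evenE)
    then have P: "\<And>k. k \<in> P \<Longrightarrow> k + x \<in> P \<and> k - x \<in> P" "\<And>k. k \<in> P \<Longrightarrow> k + z \<in> P \<and> k - z \<in> P"
      using n m by (auto simp: E_def)
    have "k + (x + z) \<in> P \<and> k - (x + z) \<in> P" if "k \<in> P" for k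
      using P(1)[OF that] P(2)[of "k + x"] P(2)[of "k - x"] by (simp add: add.assoc diff_diff_eq)
    moreover have "m + n = 2 * (x + z)" using \<open>m = 2 * x\<close> \<open>n = 2 * z\<close> by simp
    ultimately show ?thesis using \<open>even m\<close> by (simp add: E_def)
  next
    assume "even m" "odd n"
    then obtain x z where xz: "m = 2 * x" "n = 2 * z + 1" by (auto elim!: evenE oddE)
    then have "(m + n + 1) div 2 = (n + 1) div 2 + m div 2" by simp
    moreover have "(n + 1) div 2 \<in> P" "\<forall>k\<in>P. k + m div 2 \<in> P"
      using n m \<open>even m\<close> \<open>odd n\<close> unfolding E_def by simp_all
    ultimately have "(m + n + 1) div 2 \<in> P" by simp
    then show ?thesis using \<open>even m\<close> \<open>odd n\<close> unfolding E_def by simp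
  next
    assume "odd m" "even n"
    then obtain x z where xz: "m = 2 * x + 1" "n = 2 * z" by (auto elim!: evenE oddE)
    then have "(m - n + 1) div 2 = (m + 1) div 2 - n div 2" by simp
    moreover have "(m + 1) div 2 \<in> P" "\<forall>k\<in>P. k - n div 2 \<in> P"
      using n m \<open>odd m\<close> \<open>even n\<close> unfolding E_def by simp_all
    ultimately have "(m - n + 1) div 2 \<in> P" by simp
    then show ?thesis using \<open>odd m\<close> \<open>even n\<close> unfolding E_def by simp
  next
    assume "odd m" "odd n"
    then obtain x z where xz: "m = 2 * x + 1" "n = 2 * z + 1" by (auto elim!: oddE)
    then have P: "x + 1 \<in> P" "z + 1 \<in> P" using n m by (simp_all add: E_def add.commute)
    have "k + (x - z) \<in> P" "k - (x - z) \<in> P" if "k \<in> P" for k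
      using P_translate[OF that P(2,1)] P_translate[OF that P] by (simp_all add: algebra_simps)
    then show ?thesis using xz by (simp add: E_def)
  qed
qed

lemma W_paren_E: "w \<in> W_paren \<tau> \<Longrightarrow> \<exists>n\<in>E. w = ch n"
  unfolding W_paren_generate
proof (induction rule: generate.induct)
  case one
  have "(0 :: int) \<in> E" by (simp add: E_def)
  then show ?case by (intro bexI[of _ 0]) (simp_all add: one_BijGroup)
next
  case (incl h)
  then obtain k where "h = ch (2 * k - 1)" "k \<in> P" by blast
  then show ?case by (intro bexI[of _ "2 * k - 1"]) (simp_all add: E_def)
next
  case (inv h)
  then obtain k where "h = ch (2 * k - 1)" "k \<in> P" by blast
  then show ?case
    by (intro bexI[of _ "2 * k - 1"]) (simp_all add: E_def inv_BijGroup_eq bij_ch inv_ch)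
next
  case (eng h1 h2)
  then obtain n m where nm: "n \<in> E" "m \<in> E" "h1 = ch n" "h2 = ch m" by blast
  have "h1 \<otimes>\<^bsub>BijGroup UNIV\<^esub> h2 = ch n \<circ> ch m" unfolding nm by (rule mult_BijGroup[OF bij_ch bij_ch])
  also have "\<dots> = ch (if even m then m + n else m - n)" by (simp add: ch_mult_even ch_mult_odd)
  finally show ?case using E_mult[OF nm(1,2)] by blast
qed

lemma W_stab_eq: "W_stab \<tau> = {w \<in> W. torus_act w \<tau> = \<tau>}"
  by (simp add: W_stab_def)

lemma W_paren_subset_stab: "W_paren \<tau> \<subseteq> W_stab \<tau>"
proof
  fix w assume "w \<in> W_paren \<tau>"
  then show "w \<in> W_stab \<tau>" unfolding W_paren_generate
  proof (induction rule: generate.induct)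
    case one
    show ?case by (simp add: W_stab_eq one_BijGroup del: id_apply)
  next
    case (incl h)
    then show ?case using wall_refl_fixes by (auto simp: W_stab_eq)
  next
    case (inv h)
    then obtain k where k: "h = ch (2 * k - 1)" "k \<in> P" by blast
    then have "inv\<^bsub>BijGroup UNIV\<^esub> h = h" by (simp add: inv_BijGroup_eq bij_ch inv_ch)
    then show ?case using wall_refl_fixes k by (auto simp: W_stab_eq)
  next
    case (eng h1 h2)
    then have h: "h1 \<in> W" "h2 \<in> W" "torus_act h1 \<tau> = \<tau>" "torus_act h2 \<tau> = \<tau>" by (auto simp: W_stab_eq)
    then have "h1 \<otimes>\<^bsub>BijGroup UNIV\<^esub> h2 = h1 \<circ> h2" by (intro mult_BijGroup W_subset_bij)
    moreover have "h1 \<circ> h2 \<in> W" "torus_act (h1 \<circ> h2) \<tau> = \<tau>"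
      using h W_comp torus_act_comp by auto
    ultimately show ?case by (simp add: W_stab_eq del: comp_apply)
  qed
qed

theorem maximal_imp_W_stab:
  assumes max: "maximal \<tau>"
  shows "W_stab \<tau> = W_paren \<tau>"
proof (rule ccontr)
  assume "W_stab \<tau> \<noteq> W_paren \<tau>"
  then obtain w where "w \<in> W_stab \<tau>" "w \<notin> W_paren \<tau>" using W_paren_subset_stab by blast
  moreover obtain n where "w = ch n" using \<open>w \<in> W_stab \<tau>\<close> W_cases[of w] by (auto simp: W_stab_eq)
  ultimately have ex: "\<exists>n. wt n = \<tau> \<and> ch n \<notin> W_paren \<tau>" by (auto simp: W_stab_eq)
  \<comment> \<open>With \<open>n\<close> nearest to 0 no wall of \<open>P\<close> is crossed:
    folding at such a wall would give a nearer index of the same kind.\<close>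
  obtain n where n: "wt n = \<tau>" "ch n \<notin> W_paren \<tau>"
    and min: "\<forall>n'. wt n' = \<tau> \<and> ch n' \<notin> W_paren \<tau> \<longrightarrow> nat \<bar>n\<bar> \<le> nat \<bar>n'\<bar>"
    using ex ex_has_least_nat[of "\<lambda>n. wt n = \<tau> \<and> ch n \<notin> W_paren \<tau>" _ "\<lambda>n. nat \<bar>n\<bar>"] by blast
  have least: "\<bar>n\<bar> \<le> \<bar>n'\<bar>" if "wt n' = \<tau>" "ch n' \<notin> W_paren \<tau>" for n'
    using min that by (simp add: nat_le_eq_zle)
  have "P \<inter> btw n = {}"
  proof (rule ccontr)
    assume "P \<inter> btw n \<noteq> {}"
    then obtain p where p: "p \<in> P" "p \<in> btw n" by blast
    have ch: "ch n \<circ> ch (2 * p - 1) = ch (2 * p - 1 - n)" by (rule ch_mult_odd) simp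
    have "\<bar>2 * p - 1 - n\<bar> < \<bar>n\<bar>" using p(2) by (auto simp: btw_def)
    moreover have "wt (2 * p - 1 - n) = \<tau>" using wt_reflect[OF p(1)] n(1) by simp
    ultimately have "ch (2 * p - 1 - n) \<in> W_paren \<tau>" using least[of "2 * p - 1 - n"] by linarith
    then have "ch (2 * p - 1 - n) \<circ> ch (2 * p - 1) \<in> W_paren \<tau>"
      using W_paren_refl[OF p(1)] by (rule W_paren_comp)
    then have "ch (2 * p - 1 - (2 * p - 1 - n)) \<in> W_paren \<tau>" by (subst (asm) ch_mult_odd) simp_all
    then show False using n(2) by simp
  qed
  then have wv: "weight_vector \<tau> \<tau> (gv n)" using weight_vector_gv[of n] n(1) by simp
  obtain c where c: "gv n - scl c 1 \<in> J \<tau>" using maximal_weight_vector_scalar[OF \<tau> max wv] by blast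
  \<comment> \<open>The same minimality bounds \<open>n\<close> by the index in \<open>idx\<close>,
    so that \<open>lead_gv\<close> applies.\<close>
  obtain n' where idx: "n' \<in> idx" "ch n' = ch n" using ex_idx .
  have "\<bar>n\<bar> \<le> \<bar>n'\<bar>" by (rule least) (use n in \<open>simp_all only: idx(2) not_False_eq_True\<close>)
  then have n': "per = 0 \<or> \<bar>n\<bar> \<le> int per" using idx(1) by (auto simp: idx_def)
  have "ch n \<noteq> id"
  proof
    assume "ch n = id"
    then show False using n(2) W_paren_id by (simp only: not_True_eq_False)
  qed
  then have "co \<tau> (scl c 1) (ch n) = 0" using co_H[OF \<tau> id_in_W, of "ch n"] by (simp add: co_scl \<tau>)
  then have "co \<tau> (gv n) (ch n) = 0" using c by (simp add: J_def co_diff)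
  then show False using lead_gv[OF n'] by (simp add: lead_def)
qed

subsection \<open>The gallery vectors are triangular\<close>

text \<open>The index \<open>n\<close> is not restricted to \<open>idx\<close>;
  \<open>cnt_less_idx\<close> shows below that beneath the level of a chamber in \<open>idx\<close>
  this makes no difference.\<close>

definition Sp :: "nat \<Rightarrow> ('y \<Rightarrow> complex) \<Rightarrow> 'h set" where
  "Sp j \<omega> = {x. \<exists>z\<in>span (gv ` {n. cnt n < j \<and> wt n = \<omega>}). x - z \<in> J \<tau>}"

lemma Sp_J: "x \<in> J \<tau> \<Longrightarrow> x \<in> Sp j \<omega>"
  unfolding Sp_def by (rule CollectI, rule bexI[of _ 0]) (simp_all add: span_zero)

lemma Sp_add: "x \<in> Sp j \<omega> \<Longrightarrow> y \<in> Sp j \<omega> \<Longrightarrow> x + y \<in> Sp j \<omega>"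
proof -
  assume "x \<in> Sp j \<omega>" "y \<in> Sp j \<omega>"
  then obtain z z' where z: "z \<in> span (gv ` {n. cnt n < j \<and> wt n = \<omega>})" "x - z \<in> J \<tau>"
    "z' \<in> span (gv ` {n. cnt n < j \<and> wt n = \<omega>})" "y - z' \<in> J \<tau>" by (auto simp: Sp_def)
  then have "x + y - (z + z') \<in> J \<tau>" using J_add[OF z(2,4)] by (simp add: algebra_simps)
  then show ?thesis using span_add[OF z(1,3)] unfolding Sp_def by blast
qed

lemma Sp_scl: "x \<in> Sp j \<omega> \<Longrightarrow> scl c x \<in> Sp j \<omega>"
proof -
  assume "x \<in> Sp j \<omega>"
  then obtain z where z: "z \<in> span (gv ` {n. cnt n < j \<and> wt n = \<omega>})" "x - z \<in> J \<tau>" by (auto simp: Sp_def)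
  then have "scl c x - scl c z \<in> J \<tau>" using J_scl[OF \<tau> z(2), of c] by (simp add: scale_right_diff_distrib)
  then show ?thesis using span_scale[OF z(1)] unfolding Sp_def by blast
qed

lemma Sp_sum: "(\<And>s. s \<in> T \<Longrightarrow> f s \<in> Sp j \<omega>) \<Longrightarrow> sum f T \<in> Sp j \<omega>"
  by (induction T rule: infinite_finite_induct) (auto intro: Sp_add Sp_J)

lemma Sp_gv: "cnt n < j \<Longrightarrow> wt n = \<omega> \<Longrightarrow> gv n \<in> Sp j \<omega>"
  unfolding Sp_def by (rule CollectI, rule bexI[of _ "gv n"]) (auto intro: span_base)

lemma Sp_mono: "x \<in> Sp j \<omega> \<Longrightarrow> j \<le> k \<Longrightarrow> x \<in> Sp k \<omega>"
proof -
  assume x: "x \<in> Sp j \<omega>" and "j \<le> k"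
  then have "span (gv ` {n. cnt n < j \<and> wt n = \<omega>}) \<subseteq> span (gv ` {n. cnt n < k \<and> wt n = \<omega>})"
    by (intro span_mono image_mono) auto
  then show ?thesis using x unfolding Sp_def by blast
qed

lemma Sp_induct [consumes 1, case_names J gv add]:
  assumes x: "x \<in> Sp j \<omega>" and "\<And>x. x \<in> J \<tau> \<Longrightarrow> R x"
    "\<And>c n. cnt n < j \<Longrightarrow> wt n = \<omega> \<Longrightarrow> R (scl c (gv n))" "\<And>x y. R x \<Longrightarrow> R y \<Longrightarrow> R (x + y)"
  shows "R x"
proof -
  obtain z where z: "z \<in> span (gv ` {n. cnt n < j \<and> wt n = \<omega>})" "x - z \<in> J \<tau>"
    using x by (auto simp: Sp_def)
  have "R z" using z(1) by (induction rule: span_induct_alt) (auto intro: assms)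
  then have "R ((x - z) + z)" by (rule assms(4)[OF assms(2)[OF z(2)]])
  then show ?thesis by simp
qed

lemma Sp_mult:
  assumes "x \<in> Sp j \<omega>" "\<And>n. cnt n < j \<Longrightarrow> wt n = \<omega> \<Longrightarrow> h * gv n \<in> Sp k \<omega>'"
  shows "h * x \<in> Sp k \<omega>'"
  using assms(1)
  by (induction rule: Sp_induct) (auto simp: distrib_left scl_mult_right intro: Sp_J Sp_add Sp_scl J_mult[OF \<tau>] assms(2))

lemma gv_inward: "\<not> outward i n \<Longrightarrow> gv n = (if wall i n \<in> P then Kop i else Fop i) * gv (nb i n)"
  using gv_outward[of "nb i n" i] outward_cases[of n i] by simp

lemma cnt_inward: "\<not> outward i n \<Longrightarrow> cnt n = cnt (nb i n) + (if wall i n \<in> P then 1 else 0)"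
  using cnt_outward[of "nb i n" i] outward_cases[of n i] by simp

definition tri :: "int \<Rightarrow> bool" where
  "tri n \<longleftrightarrow> (\<forall>p. of_algebra p * gv n - scl (ev (wt n) p) (gv n) \<in> Sp (cnt n) (wt n))"

lemma Kop_gv:
  assumes "wall i n \<in> P"
  shows "Kop i * gv n = (if outward i n then gv (nb i n) else scl (- (1 + (\<sigma> i)\<^sup>2)) (gv n))"
proof (cases "outward i n")
  case False
  have "Kop i * gv n = (Kop i * Kop i) * gv (nb i n)"
    using gv_inward[OF False] assms by (simp add: mult.assoc)
  also have "\<dots> = scl (- (1 + (\<sigma> i)\<^sup>2)) (Kop i * gv (nb i n))"
    unfolding Kop_square scale_minus_left[symmetric] by (simp only: scl_mult_left)
  finally show ?thesis using False assms gv_inward[OF False] by simp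
qed (use assms gv_outward in simp)

lemma Kop_Sp:
  assumes "x \<in> Sp j \<omega>" "\<And>n. wt n = \<omega> \<Longrightarrow> wall i n \<in> P"
  shows "Kop i * x \<in> Sp (Suc j) \<omega>"
  using assms(1)
proof (rule Sp_mult)
  fix n assume n: "cnt n < j" "wt n = \<omega>"
  then have P: "wall i n \<in> P" using assms(2) by blast
  show "Kop i * gv n \<in> Sp (Suc j) \<omega>"
  proof (cases "outward i n")
    case True
    then have "gv (nb i n) \<in> Sp (Suc j) \<omega>"
      using n P cnt_outward[OF True] wt_nb_P[OF P] by (intro Sp_gv) auto
    then show ?thesis using True by (simp add: Kop_gv[OF P])
  next
    case False
    then show ?thesis unfolding Kop_gv[OF P] using n by (simp del: scale_minus_left) (intro Sp_scl Sp_gv; simp)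
  qed
qed

text \<open>Walking back across a wall outside \<open>P\<close> produces the square of
  \<open>Fop i\<close>, an element of the group algebra, which acts by its value up to terms of
  smaller count.\<close>

lemma Fop_gv:
  assumes P: "wall i n \<notin> P" and tri: "tri (nb i n)"
  shows "Fop i * gv n - scl (if outward i n then 1 else ev (wt (nb i n)) (num i * sact i (num i))) (gv (nb i n))
    \<in> Sp (cnt n) (wt (nb i n))"
proof (cases "outward i n")
  case True
  then show ?thesis using P by (simp add: gv_outward Sp_J)
next
  case False
  have "Fop i * gv n = of_algebra (num i * sact i (num i)) * gv (nb i n)"
    using gv_inward[OF False] P by (simp add: Fop_square flip: mult.assoc)
  then show ?thesis using False tri cnt_nb_notin_P[OF P] by (simp add: tri_def)
qed

lemma Fop_Sp:
  assumes x: "x \<in> Sp j \<omega>" and P: "\<And>n. wt n = \<omega> \<Longrightarrow> wall i n \<notin> P"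
    and tri: "\<And>n. cnt n < j \<Longrightarrow> tri n"
  shows "Fop i * x \<in> Sp j (torus_act (refl i) \<omega>)"
  using x
proof (rule Sp_mult)
  fix n assume n: "cnt n < j" "wt n = \<omega>"
  have c: "cnt (nb i n) = cnt n" "wt (nb i n) = torus_act (refl i) \<omega>"
    using cnt_nb_notin_P[OF P[OF n(2)]] wt_nb n by auto
  let ?c = "if outward i n then 1 else ev (wt (nb i n)) (num i * sact i (num i))"
  have "Fop i * gv n - scl ?c (gv (nb i n)) \<in> Sp j (torus_act (refl i) \<omega>)"
    using Fop_gv[OF P[OF n(2)] tri] n c by (auto intro: Sp_mono)
  moreover have "scl ?c (gv (nb i n)) \<in> Sp j (torus_act (refl i) \<omega>)"
    using n c by (intro Sp_scl Sp_gv) auto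
  ultimately have "(Fop i * gv n - scl ?c (gv (nb i n))) + scl ?c (gv (nb i n)) \<in> Sp j (torus_act (refl i) \<omega>)"
    by (rule Sp_add)
  then show "Fop i * gv n \<in> Sp j (torus_act (refl i) \<omega>)" by simp
qed

lemma wall_in_P_cong: "wt n = wt n' \<Longrightarrow> wall i n \<in> P \<longleftrightarrow> wall i n' \<in> P"
  by (simp add: wall_in_P)

text \<open>A double induction: along the gallery, and on the count, because at a wall outside
  \<open>P\<close> the error terms need triangularity at smaller counts.\<close>

lemma tri_less: "cnt n < c \<Longrightarrow> tri n"
proof (induction c arbitrary: n)
  case (Suc c)
  have "cnt n < Suc c \<longrightarrow> tri n" for n
  proof (induction n rule: path_induct)
    case zero
    have "of_algebra p * gv 0 - scl (ev \<tau> p) (gv 0) \<in> J \<tau>" for p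
      using J_ev[OF \<tau>, of 1 p] by simp
    then have "tri 0" by (auto simp: tri_def intro: Sp_J)
    then show ?case by blast
  next
    case (step i q)
    show ?case
    proof
      assume n: "cnt (nb i q) < Suc c"
      then have q: "tri q" using step cnt_outward[OF step(1)] by auto
      show "tri (nb i q)"
      proof (cases "wall i q \<in> P")
        case True
        have wt: "wt (nb i q) = wt q" by (rule wt_nb_P[OF True])
        have fixed: "ev (wt q) (sact i p) = ev (wt q) p" for p
          using True by (intro ev_den_refl_fixed) (simp_all add: wall_in_P)
        have cnt: "cnt (nb i q) = Suc (cnt q)" using cnt_outward[OF step(1)] True by simp
        have K: "Kop i * x \<in> Sp (Suc (cnt q)) (wt q)" if "x \<in> Sp (cnt q) (wt q)" for x
          using that True wall_in_P_cong by (intro Kop_Sp) blast+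
        show ?thesis unfolding tri_def
        proof
          fix p
          have "of_algebra p * gv (nb i q) - scl (ev (wt (nb i q)) p) (gv (nb i q)) =
              Kop i * (of_algebra (sact i p) * gv q - scl (ev (wt q) (sact i p)) (gv q)) +
              ((of_algebra (eta i p) * gv q - scl (ev (wt q) (eta i p)) (gv q)) + scl (ev (wt q) (eta i p)) (gv q))"
            using step(1) True
            by (simp add: gv_outward wt fixed right_diff_distrib scl_mult_right of_mult_Kop distrib_right flip: mult.assoc)
          also have "\<dots> \<in> Sp (Suc (cnt q)) (wt q)"
            using q by (intro Sp_add K Sp_scl Sp_gv Sp_mono[of _ "cnt q" _ "Suc (cnt q)"]) (simp_all add: tri_def)
          finally show "of_algebra p * gv (nb i q) - scl (ev (wt (nb i q)) p) (gv (nb i q)) \<in>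
              Sp (cnt (nb i q)) (wt (nb i q))" by (simp only: cnt wt)
        qed
      next
        case False
        have cnt: "cnt (nb i q) = cnt q" by (rule cnt_nb_notin_P[OF False])
        have F: "Fop i * x \<in> Sp (cnt q) (wt (nb i q))" if "x \<in> Sp (cnt q) (wt q)" for x
          unfolding wt_nb using that
        proof (rule Fop_Sp)
          show "wall i n \<notin> P" if "wt n = wt q" for n using False wall_in_P_cong[OF that] by blast
          show "tri n" if "cnt n < cnt q" for n using Suc.IH[of n] that n cnt by simp
        qed
        show ?thesis unfolding tri_def
        proof
          fix p
          have "of_algebra p * gv (nb i q) - scl (ev (wt (nb i q)) p) (gv (nb i q)) =
              Fop i * (of_algebra (sact i p) * gv q - scl (ev (wt q) (sact i p)) (gv q))"
            using step(1) False
            by (simp add: gv_outward wt_nb ev_torus_act_refl right_diff_distrib scl_mult_right of_mult_Fop flip: mult.assoc)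
          also have "\<dots> \<in> Sp (cnt q) (wt (nb i q))"
            using q by (intro F) (simp add: tri_def)
          finally show "of_algebra p * gv (nb i q) - scl (ev (wt (nb i q)) p) (gv (nb i q)) \<in>
              Sp (cnt (nb i q)) (wt (nb i q))" by (simp only: cnt)
        qed
      qed
    qed
  qed
  then show ?case using Suc.prems by blast
qed simp

lemma tri: "tri n"
  using tri_less[of n "Suc (cnt n)"] by simp


subsection \<open>Folding galleries\<close>

text \<open>If the folded gallery stays on the same side of 0, it crosses a subset of the walls
  without \<open>k\<close>; otherwise its walls are mirrored in \<open>k\<close> first.\<close>

lemma cnt_reflect_less:
  assumes k: "k \<in> P" "k \<in> btw q"
  shows "cnt (2 * k - 1 - q) < cnt q"
proof -
  let ?r = "2 * k - 1 - q"
  have "card (P \<inter> btw ?r) \<le> card (P \<inter> btw q - {k})"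
  proof (cases "(q > 0) = (?r \<ge> 0)")
    case True
    then have "P \<inter> btw ?r \<subseteq> P \<inter> btw q - {k}" using k(2) by (auto simp: btw_def)
    then show ?thesis by (intro card_mono) auto
  next
    \<comment> \<open>The mirror image of the walls between 0 and the folded end lies strictly
      between \<open>k\<close> and the old end.\<close>
    case False
    have "(\<lambda>x. 2 * k - x) ` (P \<inter> btw ?r) \<subseteq> P \<inter> btw q - {k}"
      using False k(2) P_reflect_iff[OF k(1)] by (auto simp: btw_def)
    then show ?thesis
      by (intro card_inj_on_le[of "\<lambda>x. 2 * k - x"]) (auto simp: inj_on_def)
  qed
  also have "\<dots> < card (P \<inter> btw q)"
    using k by (intro psubset_card_mono) auto
  finally show ?thesis by (simp add: cnt_def)
qed

text \<open>Folding at a crossed wall of \<open>P\<close> always loses at least one crossing; here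
  exactly one is lost, as in a covering relation of the Bruhat order.\<close>

definition good :: "int \<Rightarrow> int set" where
  "good n = {k \<in> P \<inter> btw n. Suc (cnt (2 * k - 1 - n)) = cnt n}"

text \<open>The root of the left reflection that carries \<open>ch n\<close> to
  \<open>ch (2 * k - 1 - n)\<close>, evaluated at \<mu>; see \<open>wall_conj_ch\<close>.\<close>

definition wall_root :: "int \<Rightarrow> int \<Rightarrow> 'y \<Rightarrow> int" where
  "wall_root k n \<mu> = pairing (\<alpha> (wall_label k)) (ch k (inv_into UNIV (ch n) \<mu>))"

lemma finite_good [simp]: "finite (good n)"
  by (simp add: good_def)

lemma good_in_P: "k \<in> good n \<Longrightarrow> k \<in> P"
  by (simp add: good_def)

lemma nb_reflect: "nb i (2 * k - 1 - q) = 2 * k - 1 - nb i q"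
proof -
  have "wall_label (2 * k - 1 - q) = i \<longleftrightarrow> wall_label q \<noteq> i"
    using wall_label_eq_iff[of "2 * k - 1 - q" q] wall_label_eq_iff[of "2 * k - 1 - q" "q + 1"]
      wall_label_neq(1)[of q i] by auto
  then show ?thesis by (auto simp: nb_def)
qed

lemma wall_reflect: "wall i (2 * k - 1 - q) = 2 * k - wall i q"
  proof -
  have "nb i (2 * k - 1 - q) = 2 * k - 1 - nb i q" by (rule nb_reflect)
  then show ?thesis by (simp add: nb_wall)
qed

lemma wall_root_nb: "wall_root k (nb i q) \<mu> = wall_root k q (refl i \<mu>)"
  by (simp add: wall_root_def ch_nb inv_refl_comp)

lemma good_outward_notin_P:
  assumes "outward i q" "wall i q \<notin> P"
  shows "good (nb i q) = good q"
proof -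
  have "cnt (2 * k - 1 - nb i q) = cnt (2 * k - 1 - q)" if "k \<in> P" for k
    unfolding nb_reflect[symmetric]
    by (rule cnt_nb_notin_P) (use assms(2) P_reflect_iff[OF that] in \<open>simp add: wall_reflect\<close>)
  then show ?thesis
    using btw_outward[OF assms(1)] cnt_nb_notin_P[OF assms(2)] assms(2) by (auto simp: good_def)
qed

text \<open>The new wall is good, as folding there returns to \<open>q\<close>. An old good wall
  remains good only if the folded gallery also gains a crossing in this step.\<close>

lemma good_outward_in_P:
  assumes o: "outward i q" and P: "wall i q \<in> P"
  shows "good (nb i q) = insert (wall i q) {k \<in> good q. outward i (2 * k - 1 - q)}"
    and "wall i q \<notin> good q"
proof -
  have btw: "btw (nb i q) = insert (wall i q) (btw q)" "wall i q \<notin> btw q" using btw_outward[OF o] by auto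
  then show "wall i q \<notin> good q" by (simp add: good_def)
  have cnt: "cnt (nb i q) = Suc (cnt q)" using cnt_outward[OF o] P by simp
  have *: "k \<in> good (nb i q) \<longleftrightarrow> k \<in> good q \<and> outward i (2 * k - 1 - q)" if k: "k \<in> P" "k \<in> btw q" for k
  proof -
    let ?r = "2 * k - 1 - q"
    have wP: "wall i ?r \<in> P" using P_reflect_iff[OF k(1)] P by (simp add: wall_reflect)
    have "cnt ?r < cnt q" by (rule cnt_reflect_less[OF k])
    then have "Suc (cnt (nb i ?r)) = Suc (cnt q) \<longleftrightarrow> Suc (cnt ?r) = cnt q \<and> outward i ?r"
      using cnt_outward[where i = i and q = ?r] cnt_inward[where i = i and n = ?r] wP by (cases "outward i ?r") auto
    then show ?thesis using k btw by (simp add: good_def cnt nb_reflect)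
  qed
  have "2 * wall i q - 1 - nb i q = q" by (simp add: nb_wall)
  then have "wall i q \<in> good (nb i q)" using P btw by (simp add: good_def cnt)
  then show "good (nb i q) = insert (wall i q) {k \<in> good q. outward i (2 * k - 1 - q)}"
    using * btw by (auto simp: good_def)
qed

text \<open>\<open>eta\<close> is the numerator times a divided difference, whose value at the zero
  of the denominator is known from \<open>den_dvd_refl_diff\<close>.\<close>

lemma ev_eta:
  assumes "\<omega> \<in> torus" "ev \<omega> (den i) = 0"
  shows "ev \<omega> (eta i (monomial 1 \<mu>)) =
    - (ev \<omega> (num i) / of_int (den_exp (\<sigma> i) (\<sigma>' i))) * \<omega> \<mu> * of_int (pairing (\<alpha> i) \<mu>)"
proof -
  let ?e = "den_exp (\<sigma> i) (\<sigma>' i)"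
  have e0: "?e \<noteq> 0" by (simp add: den_exp_def)
  obtain q where q: "den i * q = monomial 1 (refl i \<mu>) - monomial 1 \<mu>"
    "ev \<omega> q = - of_int (pairing (\<alpha> i) \<mu> div ?e) * \<omega> \<mu>"
    using den_dvd_refl_diff[of i \<mu>] assms by metis
  have "den i * eta i (monomial 1 \<mu>) = den i * (num i * q)"
    unfolding den_mult_eta by (simp add: mult.left_commute[of "den i"] q(1))
  then have "eta i (monomial 1 \<mu>) = num i * q" by (rule divide_unique[OF den_nonzero])
  moreover have "(of_int (pairing (\<alpha> i) \<mu> div ?e) :: complex) = of_int (pairing (\<alpha> i) \<mu>) / of_int ?e"
    using den_exp_dvd_pairing[of i \<mu>] e0 by (auto elim!: dvdE)
  ultimately show ?thesis by (simp add: ev_mult assms q(2))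
qed

subsection \<open>Coordinates modulo the defining left ideal\<close>

lemma lead_gv_idx: "n \<in> idx \<Longrightarrow> lead \<tau> (ch n) (gv n)"
  by (rule lead_gv) (auto simp: idx_def)

text \<open>At an index farthest from 0 with nonzero coefficient, the leading coordinate receives no
  other contribution.\<close>

lemma gv_independent:
  assumes T: "finite T" "T \<subseteq> idx" and s: "(\<Sum>n\<in>T. scl (c n) (gv n)) \<in> J \<tau>" and n: "n \<in> T"
  shows "c n = 0"
proof (rule ccontr)
  assume "c n \<noteq> 0"
  then have "finite {n \<in> T. c n \<noteq> 0}" "{n \<in> T. c n \<noteq> 0} \<noteq> {}" using T n by auto
  then obtain N where "N \<in> {n \<in> T. c n \<noteq> 0}"
    and max: "\<And>m. m \<in> {n \<in> T. c n \<noteq> 0} \<Longrightarrow> nat \<bar>m\<bar> \<le> nat \<bar>N\<bar>"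
    using finite_ex_max[of "{n \<in> T. c n \<noteq> 0}" "\<lambda>m. nat \<bar>m\<bar>"] by blast
  then have N: "N \<in> T" "c N \<noteq> 0" by auto
  have "c m * co \<tau> (gv m) (ch N) = (if m = N then c N * co \<tau> (gv N) (ch N) else 0)" if "m \<in> T" for m
  proof (cases "m = N \<or> c m = 0")
    case False
    have idx: "m \<in> idx" "N \<in> idx" using that N T by auto
    have "lead \<tau> (ch m) (gv m)" by (rule lead_gv_idx[OF idx(1)])
    moreover have "ch N \<noteq> ch m" using inj_on_ch_idx idx False by (auto simp: inj_on_def)
    moreover have "nat \<bar>m\<bar> \<le> nat \<bar>N\<bar>" using max[of m] that False by blast
    then have "\<not> len (ch N) < len (ch m)" using idx by (simp only: len_ch_idx not_less)
    ultimately have "co \<tau> (gv m) (ch N) = 0" unfolding lead_def by blast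
    then show ?thesis using False by simp
  qed auto
  then have "co \<tau> (\<Sum>n\<in>T. scl (c n) (gv n)) (ch N) = (\<Sum>m\<in>T. if m = N then c N * co \<tau> (gv N) (ch N) else 0)"
    unfolding co_sum co_scl[OF \<tau>] by (rule sum.cong[OF refl])
  then have "c N * co \<tau> (gv N) (ch N) = 0" using s T(1) N(1) by (simp add: J_def)
  moreover have "lead \<tau> (ch N) (gv N)" by (rule lead_gv_idx) (use N(1) T(2) in blast)
  ultimately show False using N(2) by (simp add: lead_def)
qed

lemma inj_on_gv: "inj_on gv idx"
proof
  fix m n assume mn: "m \<in> idx" "n \<in> idx" "gv m = gv n"
  show "m = n"
  proof (rule ccontr)
    assume "m \<noteq> n"
    then have "(\<Sum>l\<in>{m, n}. scl (if l = m then 1 else - 1) (gv l)) \<in> J \<tau>" using mn(3) by simp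
    then show False using gv_independent[of "{m, n}" "\<lambda>l. if l = m then 1 else - 1" m] mn by simp
  qed
qed

lemma span_gv_J:
  assumes "z \<in> span (gv ` idx)" "z \<in> J \<tau>"
  shows "z = 0"
proof -
  obtain T r where T: "finite T" "T \<subseteq> gv ` idx" "z = (\<Sum>x\<in>T. scl (r x) x)"
    using assms(1) unfolding span_explicit by blast
  obtain T' where T': "T' \<subseteq> idx" "T = gv ` T'" using T(2) by (auto simp: subset_image_iff)
  have inj: "inj_on gv T'" using inj_on_gv T' inj_on_subset by blast
  then have fin: "finite T'" using T(1) T' by (simp add: finite_image_iff)
  have z: "z = (\<Sum>n\<in>T'. scl (r (gv n)) (gv n))"
    unfolding T(3) T'(2) by (simp add: sum.reindex[OF inj])
  then have "(\<Sum>n\<in>T'. scl (r (gv n)) (gv n)) \<in> J \<tau>" using assms(2) by simp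
  then have "r (gv n) = 0" if "n \<in> T'" for n by (rule gv_independent[OF fin T'(1) _ that])
  then show ?thesis using z by simp
qed

lemma independent_gv: "independent (gv ` idx)"
  unfolding dependent_explicit
proof safe
  fix T r v assume T: "finite T" "T \<subseteq> gv ` idx" "(\<Sum>v\<in>T. scl (r v) v) = 0" "v \<in> T" "r v \<noteq> 0"
  obtain T' where T': "T' \<subseteq> idx" "T = gv ` T'" using T(2) by (auto simp: subset_image_iff)
  have inj: "inj_on gv T'" using inj_on_gv T' inj_on_subset by blast
  then have fin: "finite T'" using T(1) T' by (simp add: finite_image_iff)
  have "(\<Sum>n\<in>T'. scl (r (gv n)) (gv n)) \<in> J \<tau>"
    using T(3) unfolding T'(2) by (simp add: sum.reindex[OF inj])
  then have "r (gv n) = 0" if "n \<in> T'" for n by (rule gv_independent[OF fin T'(1) _ that])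
  then show False using T(4,5) T'(2) by blast
qed

text \<open>Each \<open>H w\<close> is obtained by induction on the length: the gallery vector of
  \<open>w\<close> leads with it, and the other terms are shorter.\<close>

lemma ex_span_gv: "\<exists>z\<in>span (gv ` idx). x - z \<in> J \<tau>"
proof -
  define M where "M = {x. \<exists>z\<in>span (gv ` idx). x - z \<in> J \<tau>}"
  have M_J: "x \<in> M" if "x \<in> J \<tau>" for x
    unfolding M_def using that by (auto intro!: bexI[of _ 0] simp: span_zero)
  have M_add: "x + y \<in> M" if xy: "x \<in> M" "y \<in> M" for x y
  proof -
    obtain z z' where z: "z \<in> span (gv ` idx)" "x - z \<in> J \<tau>" "z' \<in> span (gv ` idx)" "y - z' \<in> J \<tau>"
      using xy by (auto simp: M_def)
    have "x + y - (z + z') \<in> J \<tau>" using J_add[OF z(2,4)] by (simp add: algebra_simps)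
    then show ?thesis using span_add[OF z(1,3)] unfolding M_def by blast
  qed
  have M_scl: "scl c x \<in> M" if x: "x \<in> M" for c x
  proof -
    obtain z where z: "z \<in> span (gv ` idx)" "x - z \<in> J \<tau>" using x by (auto simp: M_def)
    have "scl c x - scl c z \<in> J \<tau>" using J_scl[OF \<tau> z(2), of c] by (simp add: scale_right_diff_distrib)
    then show ?thesis using span_scale[OF z(1)] unfolding M_def by blast
  qed
  have M_sum: "(\<And>s. s \<in> T \<Longrightarrow> f s \<in> M) \<Longrightarrow> sum f T \<in> M" for f :: "('y \<Rightarrow> 'y) \<Rightarrow> 'h" and T
    by (induction T rule: infinite_finite_induct) (auto intro: M_J M_add)
  have H: "H w \<in> M" if "w \<in> W" for w
    using that
  proof (induction "len w" arbitrary: w rule: less_induct)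
    case less
    obtain n where n: "n \<in> idx" "w = ch n" using less.prems by (rule W_idx_cases)
    let ?S = "{u. co \<tau> (gv n) u \<noteq> 0}"
    have lead: "lead \<tau> w (gv n)" unfolding n(2) by (rule lead_gv_idx[OF n(1)])
    then have w: "w \<in> ?S" by (simp add: lead_def)
    have "(\<Sum>u\<in>?S - {w}. scl (co \<tau> (gv n) u) (H u)) \<in> M"
      using lead less.hyps co_in_W by (intro M_sum M_scl) (auto simp: lead_def)
    then have sub: "- (\<Sum>u\<in>?S - {w}. scl (co \<tau> (gv n) u) (H u)) \<in> M"
      using M_scl[of _ "- 1"] by simp
    have "gv n \<in> M" unfolding M_def using n(1) by (auto intro!: bexI[of _ "gv n"] span_base)
    moreover have "- (gv n - red \<tau> (gv n)) \<in> M" by (intro M_J J_uminus red_cong[OF \<tau>])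
    ultimately have "gv n + - (gv n - red \<tau> (gv n)) \<in> M" by (rule M_add)
    then have "red \<tau> (gv n) \<in> M" by simp
    then have "red \<tau> (gv n) + - (\<Sum>u\<in>?S - {w}. scl (co \<tau> (gv n) u) (H u)) \<in> M"
      using sub by (rule M_add)
    moreover have "red \<tau> (gv n) = scl (co \<tau> (gv n) w) (H w) + (\<Sum>u\<in>?S - {w}. scl (co \<tau> (gv n) u) (H u))"
      unfolding red_def by (rule sum.remove[OF finite_co_support w])
    ultimately have "scl (co \<tau> (gv n) w) (H w) \<in> M" by simp
    then have "scl (1 / co \<tau> (gv n) w) (scl (co \<tau> (gv n) w) (H w)) \<in> M" by (rule M_scl)
    then show ?case using w by simp
  qed
  have "red \<tau> x \<in> M" unfolding red_def by (intro M_sum M_scl H) (auto intro: co_in_W)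
  with M_J[OF red_cong[OF \<tau>]] have "(x - red \<tau> x) + red \<tau> x \<in> M" by (rule M_add)
  then show ?thesis by (simp add: M_def)
qed

definition nf :: "'h \<Rightarrow> 'h" where
  "nf x = (SOME z. z \<in> span (gv ` idx) \<and> x - z \<in> J \<tau>)"

lemma nf: "nf x \<in> span (gv ` idx)" "x - nf x \<in> J \<tau>"
  using someI_ex[of "\<lambda>z. z \<in> span (gv ` idx) \<and> x - z \<in> J \<tau>"] ex_span_gv[of x]
  by (auto simp: nf_def)

lemma nf_eqI:
  assumes "z \<in> span (gv ` idx)" "x - z \<in> J \<tau>"
  shows "nf x = z"
proof -
  have "(x - z) - (x - nf x) \<in> J \<tau>" using assms(2) nf(2) by (rule J_diff)
  then have "nf x - z \<in> J \<tau>" by simp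
  then have "nf x - z = 0" using assms(1) nf(1) by (intro span_gv_J span_diff)
  then show ?thesis by simp
qed

definition \<phi> :: "int \<Rightarrow> 'h \<Rightarrow> complex" where
  "\<phi> n x = representation (gv ` idx) (nf x) (gv n)"

lemma \<phi>_J: "x \<in> J \<tau> \<Longrightarrow> \<phi> n x = 0"
  using nf_eqI[of 0 x] by (simp add: \<phi>_def span_zero representation_zero)

lemma \<phi>_add: "\<phi> n (x + y) = \<phi> n x + \<phi> n y"
proof -
  have "nf (x + y) = nf x + nf y"
    using J_add[OF nf(2)[of x] nf(2)[of y]] by (intro nf_eqI span_add nf) (simp add: algebra_simps)
  then show ?thesis by (simp add: \<phi>_def representation_add[OF independent_gv nf(1) nf(1)])
qed

lemma \<phi>_scl: "\<phi> n (scl c x) = c * \<phi> n x"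
proof -
  have "nf (scl c x) = scl c (nf x)"
    using J_scl[OF \<tau> nf(2)[of x], of c] by (intro nf_eqI span_scale nf) (simp add: scale_right_diff_distrib)
  then show ?thesis by (simp add: \<phi>_def representation_scale[OF independent_gv nf(1)])
qed

lemma \<phi>_diff: "\<phi> n (x - y) = \<phi> n x - \<phi> n y"
  using \<phi>_add[of n x "scl (- 1) y"] unfolding \<phi>_scl by simp

lemma \<phi>_sum: "\<phi> n (sum f T) = (\<Sum>s\<in>T. \<phi> n (f s))"
  by (induction T rule: infinite_finite_induct) (simp_all add: \<phi>_add \<phi>_J)

lemma \<phi>_gv: "m \<in> idx \<Longrightarrow> n \<in> idx \<Longrightarrow> \<phi> m (gv n) = (if n = m then 1 else 0)"
proof -
  assume mn: "m \<in> idx" "n \<in> idx"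
  then have "nf (gv n) = gv n" by (intro nf_eqI span_base) auto
  then show ?thesis
    using mn inj_on_gv by (auto simp: \<phi>_def representation_basis[OF independent_gv] inj_on_def)
qed

definition supp :: "'h \<Rightarrow> int set" where
  "supp x = {n \<in> idx. \<phi> n x \<noteq> 0}"

lemma finite_supp: "finite (supp x)"
proof -
  have "finite (gv ` supp x)"
    by (rule finite_subset[OF _ finite_representation[of "gv ` idx" "nf x"]]) (auto simp: supp_def \<phi>_def)
  then show ?thesis using inj_on_gv by (auto simp: finite_image_iff inj_on_def supp_def)
qed

lemma \<phi>_expand: "x - (\<Sum>n\<in>supp x. scl (\<phi> n x) (gv n)) \<in> J \<tau>"
proof -
  have inj: "inj_on gv (supp x)" using inj_on_gv by (auto simp: inj_on_def supp_def)
  have "{b. representation (gv ` idx) (nf x) b \<noteq> 0} = gv ` supp x"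
    by (auto simp: supp_def \<phi>_def dest: representation_ne_zero)
  then have "(\<Sum>n\<in>supp x. scl (\<phi> n x) (gv n)) = nf x"
    using sum_nonzero_representation_eq[OF independent_gv nf(1)[of x]]
    by (simp add: sum.reindex[OF inj] \<phi>_def)
  then show ?thesis using nf(2) by simp
qed

lemma \<phi>_mult: "\<phi> m (h * x) = (\<Sum>n\<in>supp x. \<phi> n x * \<phi> m (h * gv n))"
proof -
  have "h * (x - (\<Sum>n\<in>supp x. scl (\<phi> n x) (gv n))) \<in> J \<tau>" by (rule J_mult[OF \<tau> \<phi>_expand])
  then have "\<phi> m (h * (x - (\<Sum>n\<in>supp x. scl (\<phi> n x) (gv n)))) = 0" by (rule \<phi>_J)
  then show ?thesis
    by (simp add: right_diff_distrib sum_distrib_left scl_mult_right \<phi>_diff \<phi>_sum \<phi>_scl)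
qed

text \<open>In a finite group an index outside \<open>idx\<close> passes at least one full period of
  walls, thus by \<open>P_periodic\<close> at least as many walls of \<open>P\<close> as any chamber
  in \<open>idx\<close>.\<close>

lemma cnt_less_idx:
  assumes n: "n \<in> idx" and less: "cnt n' < cnt n"
  shows "n' \<in> idx"
proof (rule ccontr)
  assume n': "n' \<notin> idx"
  let ?p = "int per"
  have p: "per > 0" "n' \<le> - ?p \<or> ?p < n'" using n' by (auto simp: idx_def)
  have "(\<lambda>x. x - ?p) ` (P \<inter> {0<..?p}) = P \<inter> {- ?p<..0}" (is "?f ` ?A = ?B")
  proof safe
    fix x assume "x \<in> P" then show "x - ?p \<in> P" using P_periodic[of "x - ?p"] by simp
  next
    fix x assume "x \<in> P" "x \<in> {- ?p<..0}"
    then show "x \<in> ?f ` ?A" using P_periodic[of x] by (intro image_eqI[of _ _ "x + ?p"]) auto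
  qed auto
  then have card: "card ?A = card ?B" using card_image[of ?f ?A] by (auto simp: inj_on_def)
  have "P \<inter> btw n \<subseteq> ?A \<or> P \<inter> btw n \<subseteq> ?B" using n p by (auto simp: idx_def btw_def)
  then have "cnt n \<le> card ?A"
    unfolding cnt_def using card by (metis card_mono finite_Int finite_greaterThanAtMost_int)
  moreover have "?A \<subseteq> P \<inter> btw n' \<or> ?B \<subseteq> P \<inter> btw n'" using p by (auto simp: btw_def)
  then have "card ?A \<le> cnt n'"
    unfolding cnt_def using card by (metis card_mono finite_Int finite_btw)
  ultimately show False using less by simp
qed

lemma \<phi>_Sp:
  assumes x: "x \<in> Sp j \<omega>" and N: "N \<in> idx" "wt N \<noteq> \<omega> \<or> j \<le> cnt N" and m: "m \<in> idx" "j \<le> cnt m"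
  shows "\<phi> N x = 0"
  using x
proof (induction rule: Sp_induct)
  case (gv c n)
  then have "n \<in> idx" "n \<noteq> N" using cnt_less_idx[OF m(1), of n] m(2) N by auto
  then show ?case using N(1) by (simp add: \<phi>_scl \<phi>_gv)
qed (simp_all add: \<phi>_J \<phi>_add)

lemma \<phi>_weight_vector:
  assumes "weight_vector \<tau> \<omega> x"
  shows "\<phi> n (of_algebra p * x) = ev \<omega> p * \<phi> n x"
  using \<phi>_J[OF weight_vectorD[OF assms, of p], of n] by (simp add: \<phi>_diff \<phi>_scl)

text \<open>Among the indices of a given weight in the support, one with the greatest count receives
  no error term; there a monomial acts by this weight and also by \<tau>.\<close>

lemma weight_vector_supp:
  assumes x: "weight_vector \<tau> \<tau> x" and n: "n \<in> supp x"
  shows "wt n = \<tau>"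
proof (rule ccontr)
  assume neq: "wt n \<noteq> \<tau>"
  let ?F = "{m \<in> supp x. wt m = wt n}"
  have "finite ?F" "?F \<noteq> {}" using n finite_supp[of x] by auto
  then obtain N where N: "N \<in> ?F" and max: "\<And>m. m \<in> ?F \<Longrightarrow> cnt m \<le> cnt N"
    using finite_ex_max[of ?F cnt] by blast
  obtain \<mu> where \<mu>: "wt n \<mu> \<noteq> \<tau> \<mu>" using neq by blast
  let ?p = "monomial 1 \<mu>"
  have idx: "N \<in> idx" using N by (simp add: supp_def)
  have *: "\<phi> N (of_algebra ?p * gv m) = (if m = N then wt n \<mu> else 0)" if m: "m \<in> supp x" for m
  proof -
    have "of_algebra ?p * gv m - scl (ev (wt m) ?p) (gv m) \<in> Sp (cnt m) (wt m)"
      by (rule spec[OF tri[unfolded tri_def]])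
    moreover have "wt N \<noteq> wt m \<or> cnt m \<le> cnt N" using max[of m] m N by auto
    ultimately have "\<phi> N (of_algebra ?p * gv m - scl (ev (wt m) ?p) (gv m)) = 0"
      using m idx by (intro \<phi>_Sp[of _ "cnt m" "wt m" N m]) (auto simp: supp_def)
    then show ?thesis using m idx N by (auto simp: \<phi>_diff \<phi>_scl \<phi>_gv supp_def)
  qed
  have "\<phi> N (of_algebra ?p * x) = (\<Sum>m\<in>supp x. \<phi> m x * \<phi> N (of_algebra ?p * gv m))"
    by (rule \<phi>_mult)
  also have "\<dots> = (\<Sum>m\<in>supp x. if m = N then \<phi> N x * wt n \<mu> else 0)"
    using * by (intro sum.cong[OF refl]) simp
  also have "\<dots> = \<phi> N x * wt n \<mu>" using N finite_supp[of x] by simp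
  finally show False using \<phi>_weight_vector[OF x, of N ?p] \<mu> N by (simp add: supp_def)
qed

text \<open>Folding at the last crossed wall of \<open>P\<close> loses only that wall: there is none
  between it and \<open>n\<close>, hence none in the mirror image of this stretch.\<close>

lemma nearest_wall_good:
  assumes "P \<inter> btw n \<noteq> {}"
  obtains k where "k \<in> good n"
proof -
  have fin: "finite (P \<inter> btw n)" by simp
  obtain k where k: "k \<in> P" "k \<in> btw n" and near: "\<And>l. l \<in> P \<Longrightarrow> l \<in> btw n \<Longrightarrow> if n > 0 then l \<le> k else k \<le> l"
  proof (cases "n > 0")
    case True
    then show ?thesis using that[of "Max (P \<inter> btw n)"] Max_in[OF fin assms] Max_ge[OF fin] by simp
  next
    case False
    then show ?thesis using that[of "Min (P \<inter> btw n)"] Min_in[OF fin assms] Min_le[OF fin] by simp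
  qed
  let ?r = "2 * k - 1 - n"
  have refl_near: "2 * k - l \<notin> btw n \<or> (if n > 0 then k \<le> l else l \<le> k)" if "l \<in> P" for l
    using near[of "2 * k - l"] P_reflect_iff[OF k(1), of l] that by (auto split: if_splits)
  have "P \<inter> btw ?r = P \<inter> btw n - {k}"
  proof (intro equalityI subsetI)
    fix l assume l: "l \<in> P \<inter> btw ?r"
    then show "l \<in> P \<inter> btw n - {k}"
      using refl_near[of l] k(2) by (cases "n > 0"; cases "?r > 0") (auto simp: btw_def)
  next
    fix l assume l: "l \<in> P \<inter> btw n - {k}"
    then show "l \<in> P \<inter> btw ?r"
      using near[of l] refl_near[of l] k(2) by (cases "n > 0"; cases "?r > 0") (auto simp: btw_def)
  qed
  then have "cnt n = Suc (cnt ?r)"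
    unfolding cnt_def using k card_Suc_Diff1[OF fin, of k] by simp
  then show ?thesis using k that by (simp add: good_def)
qed

text \<open>Folding is multiplication by a reflection from the right; this is the same operation as
  a reflection on the left, with the root \<open>wall_root k n\<close>.\<close>

lemma wall_conj_ch:
  fixes k n :: int
  defines "v \<equiv> ch k \<circ> inv_into UNIV (ch n)"
  shows "v \<in> W" "(inv_into UNIV v \<circ> refl (wall_label k) \<circ> v) \<circ> ch n = ch (2 * k - 1 - n)"
proof -
  have inv_v: "inv_into UNIV v = ch n \<circ> inv_into UNIV (ch k)"
    unfolding v_def by (simp add: o_inv_distrib W_subset_bij W_inv W_inv_inv)
  show "v \<in> W" unfolding v_def by (simp add: W_comp W_inv del: comp_apply)
  have "(inv_into UNIV v \<circ> refl (wall_label k) \<circ> v) \<circ> ch n =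
      ch n \<circ> (inv_into UNIV (ch k) \<circ> refl (wall_label k) \<circ> ch k)"
    unfolding inv_v unfolding v_def by (simp add: fun_eq_iff W_inv_f_f)
  also have "\<dots> = ch (2 * k - 1 - n)"
    unfolding conj_wall by (rule ch_mult_odd) simp
  finally show "(inv_into UNIV v \<circ> refl (wall_label k) \<circ> v) \<circ> ch n = ch (2 * k - 1 - n)" .
qed

end

section \<open>The irreducibility criterion\<close>

locale rank_two_nonvanishing = rank_two_principal A pairing \<alpha> \<alpha>v \<sigma> \<sigma>' scl ZH a b \<tau>
  for A :: "'i::finite \<Rightarrow> 'i \<Rightarrow> int"
    and pairing :: "'x::finite_free_ab_group \<Rightarrow> 'y::finite_free_ab_group \<Rightarrow> int"
    and \<alpha> :: "'i \<Rightarrow> 'x"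
    and \<alpha>v :: "'i \<Rightarrow> 'y"
    and \<sigma> \<sigma>' :: "'i \<Rightarrow> complex"
    and scl :: "complex \<Rightarrow> 'h::ring_1 \<Rightarrow> 'h"
    and ZH :: "'y \<Rightarrow> ('y \<Rightarrow> 'y) \<Rightarrow> 'h"
    and a b :: 'i
    and \<tau> :: "'y \<Rightarrow> complex" +
  assumes in_U: "\<tau> \<in> U_set"
begin

lemma num_nonzero: "w \<in> W \<Longrightarrow> ev (torus_act w \<tau>) (num i) \<noteq> 0"
  using in_U U_set_iff[OF \<tau>] by blast

lemma num_num_nonzero: "w \<in> W \<Longrightarrow> ev (torus_act w \<tau>) (num i * sact i (num i)) \<noteq> 0"
  using num_nonzero[of w i] num_nonzero[of "refl i \<circ> w" i]
  by (simp add: ev_mult torus_act_in_torus \<tau> torus_act_refl_comp ev_torus_act_refl[of i "torus_act w \<tau>"] W_comp)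

lemma Fop_gv_nonzero:
  assumes "wall i n \<notin> P"
  obtains c where "c \<noteq> 0" "Fop i * gv n - scl c (gv (nb i n)) \<in> Sp (cnt n) (wt (nb i n))"
proof (cases "outward i n")
  case True
  then show ?thesis using that[of 1] Fop_gv[OF assms tri] by simp
next
  case False
  have "ev (wt (nb i n)) (num i * sact i (num i)) \<noteq> 0"
    by (rule num_num_nonzero) simp
  then show ?thesis using that Fop_gv[OF assms tri] False by simp
qed

text \<open>
  Multiplication by \<open>Z\<^bsup>\<mu>\<^esup>\<close> subtracts, to first order, multiples of the gallery vectors obtained by
  folding the gallery at one of the walls in \<open>P\<close>; the multiple is the root of the wall up to
  a nonzero factor independent of \<open>\<mu>\<close>.
\<close>

lemma chevalley:
  "\<exists>C. (\<forall>k\<in>good n. C k \<noteq> 0) \<and>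
    (\<forall>\<mu>. of_algebra (monomial 1 \<mu>) * gv n - scl (wt n \<mu>) (gv n) -
        (\<Sum>k\<in>good n. scl (C k * wt n \<mu> * of_int (wall_root k n \<mu>)) (gv (2 * k - 1 - n)))
      \<in> Sp (cnt n - 1) (wt n))"
proof (induction n rule: path_induct)
  case zero
  have "good 0 = {}" by (simp add: good_def)
  moreover have "of_algebra (monomial 1 \<mu>) * gv 0 - scl (\<tau> \<mu>) (gv 0) \<in> J \<tau>" for \<mu>
    using J_ev[OF \<tau>, of 1 "monomial 1 \<mu>"] by simp
  ultimately have *: "of_algebra (monomial 1 \<mu>) * gv 0 - scl (wt 0 \<mu>) (gv 0) -
        (\<Sum>k\<in>good 0. scl (1 * wt 0 \<mu> * of_int (wall_root k 0 \<mu>)) (gv (2 * k - 1 - 0)))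
      \<in> Sp (cnt 0 - 1) (wt 0)" for \<mu>
    by (simp add: Sp_J)
  show ?case by (intro exI[of _ "\<lambda>_. 1"] conjI ballI allI *) simp
next
  case (step i q)
  define n where "n = nb i q"
  obtain C where C: "\<And>k. k \<in> good q \<Longrightarrow> C k \<noteq> 0"
    "\<And>\<mu>. of_algebra (monomial 1 \<mu>) * gv q - scl (wt q \<mu>) (gv q) -
        (\<Sum>k\<in>good q. scl (C k * wt q \<mu> * of_int (wall_root k q \<mu>)) (gv (2 * k - 1 - q)))
      \<in> Sp (cnt q - 1) (wt q)"
    using step.IH by blast
  define X where "X \<mu> = of_algebra (monomial 1 \<mu>) * gv q - scl (wt q \<mu>) (gv q) -
        (\<Sum>k\<in>good q. scl (C k * wt q \<mu> * of_int (wall_root k q \<mu>)) (gv (2 * k - 1 - q)))" for \<mu>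
  have X: "X \<mu> \<in> Sp (cnt q - 1) (wt q)" for \<mu> unfolding X_def by (rule C(2))
  have wtn: "wt n \<mu> = wt q (refl i \<mu>)" for \<mu> by (simp add: n_def wt_nb torus_act_refl)
  have root: "wall_root k n \<mu> = wall_root k q (refl i \<mu>)" for k \<mu> by (simp add: n_def wall_root_nb)
  define t where "t k \<mu> = C k * wt n \<mu> * of_int (wall_root k n \<mu>)" for k \<mu>
  have Xs: "X (refl i \<mu>) = of_algebra (monomial 1 (refl i \<mu>)) * gv q - scl (wt n \<mu>) (gv q) -
      (\<Sum>k\<in>good q. scl (t k \<mu>) (gv (2 * k - 1 - q)))" for \<mu>
    by (simp add: X_def wtn root t_def)
  have wt_good: "wt (2 * k - 1 - n) = wt n" if "k \<in> good q" for k
    by (rule wt_reflect[OF good_in_P[OF that]])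
  show ?case unfolding n_def[symmetric]
  proof (cases "wall i q \<in> P")
    case False
    have cnt: "cnt n = cnt q" unfolding n_def by (rule cnt_nb_notin_P[OF False])
    have good: "good n = good q" unfolding n_def by (rule good_outward_notin_P[OF step(1) False])
    have gvn: "gv n = Fop i * gv q" using step(1) False by (simp add: n_def gv_outward)
    \<comment> \<open>Outside \<open>P\<close> the folds of the new gallery are those of the old one
      moved by \<open>Fop i\<close>; the nonvanishing numerators keep their coefficients
      nonzero.\<close>
    have "\<exists>c. c \<noteq> 0 \<and> Fop i * gv (2 * k - 1 - q) - scl c (gv (2 * k - 1 - n)) \<in> Sp (cnt n - 1) (wt n)"
      if k: "k \<in> good q" for k
    proof -
      have "wall i (2 * k - 1 - q) \<notin> P" using False P_reflect_iff[OF good_in_P[OF k]] by (simp add: wall_reflect)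
      then obtain c where "c \<noteq> 0" "Fop i * gv (2 * k - 1 - q) - scl c (gv (nb i (2 * k - 1 - q)))
          \<in> Sp (cnt (2 * k - 1 - q)) (wt (nb i (2 * k - 1 - q)))" by (rule Fop_gv_nonzero)
      moreover have "cnt (2 * k - 1 - q) = cnt n - 1" using k cnt by (auto simp: good_def)
      ultimately show ?thesis using wt_good[OF k] by (auto simp: nb_reflect n_def)
    qed
    then obtain c where c: "\<And>k. k \<in> good q \<Longrightarrow> c k \<noteq> 0"
      "\<And>k. k \<in> good q \<Longrightarrow> Fop i * gv (2 * k - 1 - q) - scl (c k) (gv (2 * k - 1 - n)) \<in> Sp (cnt n - 1) (wt n)"
      by metis
    have "of_algebra (monomial 1 \<mu>) * gv n - scl (wt n \<mu>) (gv n) -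
        (\<Sum>k\<in>good n. scl ((C k * c k) * wt n \<mu> * of_int (wall_root k n \<mu>)) (gv (2 * k - 1 - n)))
      \<in> Sp (cnt n - 1) (wt n)" for \<mu>
    proof -
      have "Fop i * X (refl i \<mu>) \<in> Sp (cnt n - 1) (wt n)"
        unfolding n_def wt_nb unfolding n_def[symmetric] cnt
      proof (rule Fop_Sp[OF X])
        show "wall i m \<notin> P" if "wt m = wt q" for m using False wall_in_P_cong[OF that] by blast
      qed (rule tri)
      moreover have "(\<Sum>k\<in>good q. scl (t k \<mu>) (Fop i * gv (2 * k - 1 - q) - scl (c k) (gv (2 * k - 1 - n))))
          \<in> Sp (cnt n - 1) (wt n)"
        by (rule Sp_sum) (rule Sp_scl[OF c(2)])
      ultimately have "Fop i * X (refl i \<mu>) +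
          (\<Sum>k\<in>good q. scl (t k \<mu>) (Fop i * gv (2 * k - 1 - q) - scl (c k) (gv (2 * k - 1 - n))))
          \<in> Sp (cnt n - 1) (wt n)" by (rule Sp_add)
      also have "Fop i * X (refl i \<mu>) +
          (\<Sum>k\<in>good q. scl (t k \<mu>) (Fop i * gv (2 * k - 1 - q) - scl (c k) (gv (2 * k - 1 - n)))) =
        of_algebra (monomial 1 \<mu>) * gv n - scl (wt n \<mu>) (gv n) -
        (\<Sum>k\<in>good n. scl ((C k * c k) * wt n \<mu> * of_int (wall_root k n \<mu>)) (gv (2 * k - 1 - n)))"
        unfolding Xs good gvn
        by (simp add: right_diff_distrib scl_mult_right sum_distrib_left scale_right_diff_distrib
            sum_subtractf t_def mult.assoc[where 'a = complex] mult.commute mult.left_commute Fop_mult_of flip: mult.assoc[where 'a = 'h])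
      finally show ?thesis .
    qed
    then show "\<exists>C. (\<forall>k\<in>good n. C k \<noteq> 0) \<and>
      (\<forall>\<mu>. of_algebra (monomial 1 \<mu>) * gv n - scl (wt n \<mu>) (gv n) -
        (\<Sum>k\<in>good n. scl (C k * wt n \<mu> * of_int (wall_root k n \<mu>)) (gv (2 * k - 1 - n)))
      \<in> Sp (cnt n - 1) (wt n))"
      using C(1) c(1) good by (intro exI[of _ "\<lambda>k. C k * c k"]) auto
  next
    case True
    define w where "w = wall i q"
    have wtq: "wt n = wt q" unfolding n_def by (rule wt_nb_P[OF True])
    have cnt: "cnt n = Suc (cnt q)" using cnt_outward[OF step(1)] True by (simp add: n_def)
    have good: "good n = insert w {k \<in> good q. outward i (2 * k - 1 - q)}" "w \<notin> good q"
      using good_outward_in_P[OF step(1) True] by (simp_all add: n_def w_def)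
    have gvn: "gv n = Kop i * gv q" using step(1) True by (simp add: n_def gv_outward)
    have den: "ev (wt q) (den i) = 0" using True by (simp add: wall_in_P)
    \<comment> \<open>The factor of \<open>ev_eta\<close> that does not depend on \<mu>.\<close>
    define e where "e = - (ev (wt q) (num i) / of_int (den_exp (\<sigma> i) (\<sigma>' i)))"
    have e0: "e \<noteq> 0" using num_nonzero[of "ch q" i] by (simp add: e_def den_exp_def)
    \<comment> \<open>The sign depends on the side of the new wall from which its root is read:
      \<open>ch w\<close> is either \<open>ch q\<close> or \<open>ch n\<close>.\<close>
    define d where "d = (if w = q then - 1 else 1 :: complex)"
    have root_w: "of_int (pairing (\<alpha> i) \<mu>) = d * of_int (wall_root w n \<mu>)" for \<mu>
    proof (cases "wall_label q = i")
      case True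
      then have "w = q" by (simp add: w_def wall_def)
      then show ?thesis using True by (simp add: d_def wall_root_def n_def ch_nb inv_refl_comp)
    next
      case False
      then have "w = n" "w \<noteq> q" "wall_label w = i"
        using wall_label_wall[of i q] by (auto simp: w_def wall_def n_def nb_def)
      then show ?thesis by (simp add: d_def wall_root_def)
    qed
    define C' where "C' = C(w := e * d)"
    \<comment> \<open>For \<open>cnt q = 0\<close> the subtraction is truncated, and the error lies
      in \<open>Sp 0\<close>, which is just \<open>J \<tau>\<close>.\<close>
    have Kq: "Kop i * x \<in> Sp (cnt q) (wt q)" if "x \<in> Sp (cnt q - 1) (wt q)" for x
    proof (cases "cnt q = 0")
      case True
      then have "x \<in> J \<tau>" using that by (auto simp: Sp_def)
      then show ?thesis by (intro Sp_J J_mult[OF \<tau>])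
    next
      case False
      have "Kop i * x \<in> Sp (Suc (cnt q - 1)) (wt q)"
        using that by (rule Kop_Sp) (use True wall_in_P_cong in blast)
      then show ?thesis using False by simp
    qed
    \<comment> \<open>If the folded gallery turns inward, \<open>Kop i\<close> only multiplies its
      vector by a scalar, and the count stays low enough for the error term.\<close>
    have refl_gv: "Kop i * gv (2 * k - 1 - q) - (if outward i (2 * k - 1 - q) then gv (2 * k - 1 - n) else 0)
        \<in> Sp (cnt q) (wt q)" if k: "k \<in> good q" for k
    proof -
      have "wall i (2 * k - 1 - q) \<in> P" using True P_reflect_iff[OF good_in_P[OF k]] by (simp add: wall_reflect)
      note K = Kop_gv[OF this]
      have "gv (2 * k - 1 - q) \<in> Sp (cnt q) (wt q)"
        using k wt_reflect[OF good_in_P[OF k]] by (intro Sp_gv) (auto simp: good_def)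
      then show ?thesis
        by (cases "outward i (2 * k - 1 - q)") (auto simp add: K nb_reflect n_def Sp_J intro: Sp_scl simp del: scale_minus_left)
    qed
    have "of_algebra (monomial 1 \<mu>) * gv n - scl (wt n \<mu>) (gv n) -
        (\<Sum>k\<in>good n. scl (C' k * wt n \<mu> * of_int (wall_root k n \<mu>)) (gv (2 * k - 1 - n)))
      \<in> Sp (cnt n - 1) (wt n)" for \<mu>
    proof -
      define E where "E = eta i (monomial 1 \<mu>)"
      define V where "V k = Kop i * gv (2 * k - 1 - q) - (if outward i (2 * k - 1 - q) then gv (2 * k - 1 - n) else 0)" for k
      have evE: "ev (wt q) E = C' w * wt n \<mu> * of_int (wall_root w n \<mu>)"
        unfolding E_def ev_eta[OF wt_torus den] root_w by (simp add: C'_def e_def wtq)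
      have 1: "Kop i * X (refl i \<mu>) \<in> Sp (cnt q) (wt q)" by (rule Kq[OF X])
      have 2: "(\<Sum>k\<in>good q. scl (t k \<mu>) (V k)) \<in> Sp (cnt q) (wt q)"
        unfolding V_def by (rule Sp_sum) (rule Sp_scl[OF refl_gv])
      have 3: "of_algebra E * gv q - scl (ev (wt q) E) (gv q) \<in> Sp (cnt q) (wt q)"
        using tri[of q] by (simp add: tri_def)
      have sum_good: "(\<Sum>k\<in>good n. scl (C' k * wt n \<mu> * of_int (wall_root k n \<mu>)) (gv (2 * k - 1 - n))) =
          scl (ev (wt q) E) (gv q) + (\<Sum>k\<in>good q. scl (t k \<mu>) (if outward i (2 * k - 1 - q) then gv (2 * k - 1 - n) else 0))"
      proof -
        have "2 * w - 1 - n = q" by (simp add: n_def w_def nb_wall)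
        moreover have "(\<Sum>k\<in>{k \<in> good q. outward i (2 * k - 1 - q)}. scl (C' k * wt n \<mu> * of_int (wall_root k n \<mu>)) (gv (2 * k - 1 - n))) =
            (\<Sum>k\<in>good q. scl (t k \<mu>) (if outward i (2 * k - 1 - q) then gv (2 * k - 1 - n) else 0))"
          by (rule sum.mono_neutral_cong_left) (use good(2) in \<open>auto simp: C'_def t_def\<close>)
        ultimately show ?thesis unfolding good(1) using good(2) by (subst sum.insert) (simp_all add: evE)
      qed
      have eq: "of_algebra (monomial 1 \<mu>) * gv n = Kop i * (of_algebra (monomial 1 (refl i \<mu>)) * gv q) + of_algebra E * gv q"
        unfolding gvn E_def by (simp add: of_mult_Kop distrib_right flip: mult.assoc)
      have "of_algebra (monomial 1 \<mu>) * gv n - scl (wt n \<mu>) (gv n) -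
        (\<Sum>k\<in>good n. scl (C' k * wt n \<mu> * of_int (wall_root k n \<mu>)) (gv (2 * k - 1 - n))) =
        (Kop i * X (refl i \<mu>) + (\<Sum>k\<in>good q. scl (t k \<mu>) (V k))) + (of_algebra E * gv q - scl (ev (wt q) E) (gv q))"
        unfolding sum_good eq Xs V_def
        by (simp add: gvn[symmetric] right_diff_distrib scl_mult_right sum_distrib_left scale_right_diff_distrib sum_subtractf)
      also have "\<dots> \<in> Sp (cnt q) (wt q)" by (rule Sp_add[OF Sp_add[OF 1 2] 3])
      finally show ?thesis by (simp add: cnt wtq)
    qed
    moreover have "C' k \<noteq> 0" if "k \<in> good n" for k
      using that C(1) e0 unfolding good(1) by (auto simp: C'_def d_def)
    ultimately show "\<exists>C. (\<forall>k\<in>good n. C k \<noteq> 0) \<and>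
      (\<forall>\<mu>. of_algebra (monomial 1 \<mu>) * gv n - scl (wt n \<mu>) (gv n) -
        (\<Sum>k\<in>good n. scl (C k * wt n \<mu> * of_int (wall_root k n \<mu>)) (gv (2 * k - 1 - n)))
      \<in> Sp (cnt n - 1) (wt n))" by blast
  qed
qed

text \<open>On a weight vector the square of \<open>Fop i\<close> is a scalar, nonzero by the
  condition on the numerators, so no intertwiner can annihilate it.\<close>

lemma weight_vector_transport:
  assumes L: "left_ideal L" and w: "w \<in> W"
    and x: "x \<in> L" "x \<notin> J \<tau>" "weight_vector \<tau> (torus_act w \<tau>) x"
  obtains y where "y \<in> L" "y \<notin> J \<tau>" "weight_vector \<tau> \<tau> y"
proof -
  have "\<forall>x. x \<in> L - J \<tau> \<longrightarrow> weight_vector \<tau> (torus_act w \<tau>) x \<longrightarrow> (\<exists>y\<in>L - J \<tau>. weight_vector \<tau> \<tau> y)"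
    using w
  proof (induction rule: W_induct)
    case (refl i w)
    show ?case
    proof (intro allI impI)
      fix x assume x: "x \<in> L - J \<tau>" "weight_vector \<tau> (torus_act (local.refl i \<circ> w) \<tau>) x"
      let ?\<omega> = "torus_act (local.refl i \<circ> w) \<tau>"
      let ?c = "ev ?\<omega> (num i * sact i (num i))"
      have "torus_act (local.refl i) ?\<omega> = torus_act w \<tau>"
        by (simp only: torus_act_refl_comp[OF refl(1)] ev_torus_act_refl_refl)
      then have "weight_vector \<tau> (torus_act w \<tau>) (Fop i * x)"
        using weight_vector_Fop[OF \<tau> x(2), of i] by (simp only:)
      moreover have "Fop i * x \<notin> J \<tau>"
      proof
        assume "Fop i * x \<in> J \<tau>"
        then have "Fop i * (Fop i * x) \<in> J \<tau>" by (rule J_mult[OF \<tau>])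
        then have "Fop i * (Fop i * x) - (Fop i * (Fop i * x) - scl ?c x) \<in> J \<tau>"
          using weight_vector_Fop_Fop[OF x(2), of i] by (rule J_diff)
        then have "scl ?c x \<in> J \<tau>" by simp
        moreover have "?c \<noteq> 0" by (rule num_num_nonzero) (simp add: W_comp refl(1) del: comp_apply)
        ultimately show False using x(1) J_scl_iff[OF \<tau>] by blast
      qed
      moreover have "Fop i * x \<in> L" using left_ideal_mult[OF L] x(1) by blast
      ultimately show "\<exists>y\<in>L - J \<tau>. weight_vector \<tau> \<tau> y" using refl(2) by blast
    qed
  qed (simp add: torus_act_id del: id_apply, blast)
  then show ?thesis using x that by blast
qed

end

section \<open>Weight vectors of weight \<tau> under both conditions\<close>

locale rank_two_criterion = rank_two_nonvanishing A pairing \<alpha> \<alpha>v \<sigma> \<sigma>' scl ZH a b \<tau>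
  for A :: "'i::finite \<Rightarrow> 'i \<Rightarrow> int"
    and pairing :: "'x::finite_free_ab_group \<Rightarrow> 'y::finite_free_ab_group \<Rightarrow> int"
    and \<alpha> :: "'i \<Rightarrow> 'x"
    and \<alpha>v :: "'i \<Rightarrow> 'y"
    and \<sigma> \<sigma>' :: "'i \<Rightarrow> complex"
    and scl :: "complex \<Rightarrow> 'h::ring_1 \<Rightarrow> 'h"
    and ZH :: "'y \<Rightarrow> ('y \<Rightarrow> 'y) \<Rightarrow> 'h"
    and a b :: 'i
    and \<tau> :: "'y \<Rightarrow> complex" +
  assumes stab: "W_stab \<tau> = W_paren \<tau>"
begin

text \<open>If \<open>P\<close> is nonempty, an even \<open>n\<close> translates \<open>P\<close>,
  so a wall of \<open>P\<close> would lie among any \<open>n\<close> consecutive ones unless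
  \<open>n = 0\<close>. For odd \<open>n\<close>, the element is a reflection in
  \<open>W_paren \<tau>\<close>, and its wall belongs to \<open>P\<close> and lies between 0 and
  \<open>n\<close>.\<close>

lemma stab_no_wall_id:
  assumes n: "wt n = \<tau>" and empty: "P \<inter> btw n = {}"
  shows "ch n = id"
proof (cases "P = {}")
  case True
  have group: "group (BijGroup (UNIV :: 'y set))" by (rule group_BijGroup)
  have "W_paren \<tau> = {\<one>\<^bsub>BijGroup UNIV\<^esub>}"
    unfolding W_paren_generate using True by (simp add: group.generate_empty[OF group])
  moreover have "ch n \<in> W_paren \<tau>" using n stab W_stab_eq by auto
  ultimately show ?thesis by (simp add: one_BijGroup)
next
  case False
  then obtain k where k: "k \<in> P" by blast
  show ?thesis
  proof (cases "even n")
    case True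
    have "k + int j * n \<in> P \<longleftrightarrow> k \<in> P" for k j
    proof (induction j)
      case (Suc j)
      then show ?case using P_stab_even[OF n True, of "k + int j * n"] by (simp add: algebra_simps)
    qed simp
    then have shift: "k + j * n \<in> P \<longleftrightarrow> k \<in> P" for k j
      by (cases j rule: int_cases2) (simp, metis add_diff_cancel_right' diff_minus_eq_add mult_minus_left)
    have "n = 0"
    proof (rule ccontr)
      assume "n \<noteq> 0"
      then consider "n > 0" | "n < 0" by linarith
      then show False
      proof cases
        case 1
        \<comment> \<open>The shift by one chooses the residue in \<open>{1..n}\<close>, the range
          of \<open>btw n\<close>; for negative \<open>n\<close> the plain residue fits.\<close>
        have "k + (- ((k - 1) div n)) * n \<in> P" using shift k by blast
        also have "k + (- ((k - 1) div n)) * n = (k - 1) mod n + 1"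
          by (simp add: minus_div_mult_eq_mod[symmetric])
        finally have "(k - 1) mod n + 1 \<in> P" .
        moreover have "(k - 1) mod n + 1 \<in> btw n"
          using 1 pos_mod_bound[OF 1, of "k - 1"] pos_mod_sign[OF 1, of "k - 1"] by (simp add: btw_def)
        ultimately show False using empty by blast
      next
        case 2
        have "k + (- (k div n)) * n \<in> P" using shift k by blast
        also have "k + (- (k div n)) * n = k mod n"
          by (simp add: minus_div_mult_eq_mod[symmetric])
        finally have "k mod n \<in> P" .
        moreover have "k mod n \<in> btw n"
          using 2 neg_mod_bound[OF 2, of k] neg_mod_sign[OF 2, of k] by (simp add: btw_def)
        ultimately show False using empty by blast
      qed
    qed
    then show ?thesis by simp
  next
    case False
    have "ch n \<in> W_paren \<tau>" using n stab W_stab_eq by auto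
    then obtain n' where n': "n' \<in> E" "ch n = ch n'" using W_paren_E by blast
    have "odd n'"
    proof
      assume "even n'"
      moreover have "even (n - n')" using n'(2) unfolding ch_eq_iff by (rule dvd_mult_left)
      ultimately show False using False by simp
    qed
    then obtain m m' where m: "n = 2 * m + 1" "n' = 2 * m' + 1" using False by (elim oddE)
    define l l' where "l = m + 1" "l' = m' + 1"
    then have l: "n = 2 * l - 1" "n' = 2 * l' - 1" using m by auto
    have "l' \<in> P" using n'(1) l by (simp add: E_def)
    then have "l \<in> P" using P_determined_by_reflection[of l l'] n'(2) l by simp
    moreover have "l \<in> btw n" using l by (auto simp: btw_def)
    ultimately show ?thesis using empty by blast
  qed
qed

text \<open>Elements of the stabiliser move chambers while preserving \<open>P\<close>; taking
  \<open>n\<close> to 0 reduces to \<open>stab_no_wall_id\<close>.\<close>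

lemma stab_no_wall_eq:
  assumes n: "wt n = \<tau>" and n': "wt n' = \<tau>" and le: "n \<le> n'"
    and no: "\<And>l. l \<in> P \<Longrightarrow> n < l \<Longrightarrow> l \<le> n' \<Longrightarrow> False"
  shows "ch n = ch n'"
proof (cases "even n")
  case True
  have "wt (n' - n) = \<tau>" using wt_add_stab[OF n True, of "n' - n"] n' by simp
  moreover have "P \<inter> btw (n' - n) = {}"
    using le no P_stab_even[OF n True] by (fastforce simp: btw_def)
  ultimately have "ch (n' - n) = id" by (rule stab_no_wall_id)
  moreover have "ch (n' - n) \<circ> ch n = ch n'" using ch_mult_even[OF True, of "n' - n"] by (simp del: comp_apply)
  ultimately show ?thesis by (simp only: id_comp)
next
  case False
  have "wt (n - n') = \<tau>" using wt_diff_stab[OF n False, of "n - n'"] n' by simp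
  moreover have "P \<inter> btw (n - n') = {}"
  proof (rule ccontr)
    assume "P \<inter> btw (n - n') \<noteq> {}"
    then obtain l where l: "l \<in> P" "n - n' < l" "l \<le> 0" using le by (auto simp: btw_def)
    then have "n + 1 - l \<in> P" using P_stab_odd[OF n False] by blast
    then show False using no[of "n + 1 - l"] l by simp
  qed
  ultimately have "ch (n - n') = id" by (rule stab_no_wall_id)
  moreover have "ch (n - n') \<circ> ch n = ch n'" using ch_mult_odd[OF False, of "n - n'"] by (simp del: comp_apply)
  ultimately show ?thesis by (simp only: id_comp)
qed

text \<open>On one side of 0 the sets \<open>btw\<close> are nested, so equal counts leave no wall
  of \<open>P\<close> between the two chambers.\<close>

lemma stab_cnt_unique:
  assumes n: "n \<in> idx" "wt n = \<tau>" and n': "n' \<in> idx" "wt n' = \<tau>"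
    and cnt: "cnt n = cnt n'" and sign: "n > 0 \<longleftrightarrow> n' > 0"
  shows "n = n'"
proof -
  have sub: "P \<inter> btw m = P \<inter> btw m'"
    if "cnt m = cnt m'" "btw m \<subseteq> btw m'" for m m'
    using that by (intro card_subset_eq) (auto simp: cnt_def)
  have *: "ch n = ch n'" if le: "n \<le> n'"  "cnt n = cnt n'" "n > 0 \<longleftrightarrow> n' > 0" "wt n = \<tau>" "wt n' = \<tau>" for n n'
  proof (rule stab_no_wall_eq[OF that(4,5,1)])
    fix l assume l: "l \<in> P" "n < l" "l \<le> n'"
    show False
    proof (cases "n > 0")
      case True
      then have "l \<in> btw n'" "btw n \<subseteq> btw n'" "l \<notin> btw n" using l le(1) by (auto simp: btw_def)
      then show False using sub[of n n'] le(2) l(1) by blast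
    next
      case False
      then have "l \<in> btw n" "btw n' \<subseteq> btw n" "l \<notin> btw n'" using l le(1,3) by (auto simp: btw_def)
      then show False using sub[of n' n] le(2) l(1) by auto
    qed
  qed
  have "ch n = ch n'"
  proof (cases "n \<le> n'")
    case True
    then show ?thesis by (rule *) (rule cnt sign n(2) n'(2))+
  next
    case False
    then have "n' \<le> n" by simp
    then have "ch n' = ch n" by (rule *) (rule cnt[symmetric] sign[symmetric] n(2) n'(2))+
    then show ?thesis by (rule sym)
  qed
  then show ?thesis using inj_on_ch_idx n(1) n'(1) by (auto simp: inj_on_def)
qed

lemma weight_vector_scalar:
  assumes x: "weight_vector \<tau> \<tau> x"
  obtains c where "x - scl c 1 \<in> J \<tau>"
proof -
  have wt: "wt n = \<tau>" if "n \<in> supp x" for n using x that by (rule weight_vector_supp)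
  have idx: "n \<in> idx" if "n \<in> supp x" for n using that by (simp add: supp_def)
  have idx0: "0 \<in> idx" by (auto simp: idx_def)
  have "supp x \<subseteq> {0}"
  proof (rule ccontr)
    assume "\<not> supp x \<subseteq> {0}"
    then obtain n0 where n0: "n0 \<in> supp x" "n0 \<noteq> 0" by blast
    \<comment> \<open>The relation will be read off at the coordinate of \<open>u\<close>, a fold of
      this topmost chamber one level below.\<close>
    obtain N where N: "N \<in> supp x" and max: "\<And>n. n \<in> supp x \<Longrightarrow> cnt n \<le> cnt N"
      using finite_ex_max[of "supp x" cnt] finite_supp[of x] n0 by blast
    have cnt_pos: "P \<inter> btw n \<noteq> {}" if "n \<in> supp x" "n \<noteq> 0" for n
      using stab_no_wall_id[OF wt[OF that(1)]] that idx0 idx[OF that(1)] inj_on_ch_idx ch_0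
      by (metis inj_onD)
    have "cnt n0 > 0" using cnt_pos[OF n0] by (simp add: cnt_def card_gt_0_iff)
    then have cnt_N: "cnt N > 0" using max[OF n0(1)] by simp
    then have "P \<inter> btw N \<noteq> {}" by (auto simp: cnt_def)
    then obtain k where k: "k \<in> good N" by (rule nearest_wall_good)
    define u where "u = 2 * k - 1 - N"
    have cnt_u: "Suc (cnt u) = cnt N" using k by (simp add: good_def u_def)
    have u: "u \<in> idx" using cnt_less_idx[OF idx[OF N], of u] cnt_u by simp
    have "\<exists>C. \<forall>n. (\<forall>k\<in>good n. C n k \<noteq> 0) \<and>
      (\<forall>\<mu>. of_algebra (monomial 1 \<mu>) * gv n - scl (wt n \<mu>) (gv n) -
          (\<Sum>k\<in>good n. scl (C n k * wt n \<mu> * of_int (wall_root k n \<mu>)) (gv (2 * k - 1 - n)))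
        \<in> Sp (cnt n - 1) (wt n))"
      by (intro choice allI chevalley)
    then obtain C where C: "\<And>n k. k \<in> good n \<Longrightarrow> C n k \<noteq> 0"
      "\<And>n \<mu>. of_algebra (monomial 1 \<mu>) * gv n - scl (wt n \<mu>) (gv n) -
          (\<Sum>k\<in>good n. scl (C n k * wt n \<mu> * of_int (wall_root k n \<mu>)) (gv (2 * k - 1 - n)))
        \<in> Sp (cnt n - 1) (wt n)"
      by blast
    \<comment> \<open>The only wall that can fold \<open>n\<close> to \<open>u\<close>. The division
      rounds if the parity is wrong, so \<open>G\<close> tests the equation again.\<close>
    define kk where "kk n = (u + 1 + n) div 2" for n
    define G where "G = {n \<in> supp x. kk n \<in> good n \<and> 2 * kk n - 1 - n = u}"
    have expand: "\<phi> u (of_algebra (monomial 1 \<mu>) * gv n) = \<tau> \<mu> * \<phi> u (gv n) +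
        (if n \<in> G then C n (kk n) * \<tau> \<mu> * of_int (wall_root (kk n) n \<mu>) else 0)" if n: "n \<in> supp x" for n \<mu>
    proof -
      let ?t = "\<lambda>k. C n k * wt n \<mu> * of_int (wall_root k n \<mu>)"
      \<comment> \<open>The error of \<open>chevalley\<close> lies strictly below the level of
        \<open>u\<close> and is invisible there.\<close>
      have le: "cnt n - 1 \<le> cnt u" using max[OF n] cnt_u by simp
      have "\<phi> u (of_algebra (monomial 1 \<mu>) * gv n - scl (wt n \<mu>) (gv n) -
          (\<Sum>k\<in>good n. scl (?t k) (gv (2 * k - 1 - n)))) = 0"
        by (rule \<phi>_Sp[OF C(2) u disjI2[OF le] u le])
      then have "\<phi> u (of_algebra (monomial 1 \<mu>) * gv n) =
          wt n \<mu> * \<phi> u (gv n) + (\<Sum>k\<in>good n. ?t k * \<phi> u (gv (2 * k - 1 - n)))"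
        unfolding \<phi>_diff \<phi>_scl \<phi>_sum by (simp only: diff_diff_eq right_minus_eq)
      also have "(\<Sum>k\<in>good n. ?t k * \<phi> u (gv (2 * k - 1 - n))) =
          (\<Sum>k\<in>good n. if k = kk n then (if 2 * kk n - 1 - n = u then ?t (kk n) else 0) else 0)"
      proof (rule sum.cong[OF HOL.refl])
        fix k assume k: "k \<in> good n"
        have "2 * k - 1 - n \<in> idx" using k by (intro cnt_less_idx[OF idx[OF n]]) (simp add: good_def)
        then show "?t k * \<phi> u (gv (2 * k - 1 - n)) =
            (if k = kk n then (if 2 * kk n - 1 - n = u then ?t (kk n) else 0) else 0)"
          using u by (auto simp: \<phi>_gv kk_def)
      qed
      also have "\<dots> = (if n \<in> G then ?t (kk n) else 0)" using n by (simp add: G_def)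
      finally show ?thesis by (simp add: wt[OF n])
    qed
    define D where "D n = \<phi> n x * C n (kk n)" for n
    have D: "D n \<noteq> 0" if "n \<in> G" for n using that C(1) by (simp add: D_def G_def supp_def)
    \<comment> \<open>The coordinate at \<open>u\<close> of \<open>Z^\<mu>\<close> times
      \<open>x\<close> is computed from the weight and from the expansion; the diagonal terms
      cancel.\<close>
    have rel: "(\<Sum>n\<in>G. D n * of_int (wall_root (kk n) n \<mu>)) = 0" for \<mu>
    proof -
      have "\<tau> \<mu> * \<phi> u x = \<phi> u (of_algebra (monomial 1 \<mu>) * x)"
        using \<phi>_weight_vector[OF x, of u "monomial 1 \<mu>"] by simp
      also have "\<dots> = (\<Sum>n\<in>supp x. \<phi> n x * \<phi> u (of_algebra (monomial 1 \<mu>) * gv n))" by (rule \<phi>_mult)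
      also have "\<dots> = (\<Sum>n\<in>supp x. \<tau> \<mu> * (\<phi> n x * \<phi> u (1 * gv n)) +
          (if n \<in> G then \<tau> \<mu> * (D n * of_int (wall_root (kk n) n \<mu>)) else 0))"
        by (intro sum.cong[OF HOL.refl]) (simp add: expand D_def algebra_simps)
      also have "\<dots> = \<tau> \<mu> * (\<Sum>n\<in>supp x. \<phi> n x * \<phi> u (1 * gv n)) +
          (\<Sum>n\<in>supp x. if n \<in> G then \<tau> \<mu> * (D n * of_int (wall_root (kk n) n \<mu>)) else 0)"
        by (simp only: sum.distrib sum_distrib_left)
      also have "(\<Sum>n\<in>supp x. \<phi> n x * \<phi> u (1 * gv n)) = \<phi> u (1 * x)" by (rule \<phi>_mult[symmetric])
      also have "(\<Sum>n\<in>supp x. if n \<in> G then \<tau> \<mu> * (D n * of_int (wall_root (kk n) n \<mu>)) else 0) =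
          (\<Sum>n\<in>G. \<tau> \<mu> * (D n * of_int (wall_root (kk n) n \<mu>)))"
        by (rule sum.mono_neutral_cong_right) (auto simp: finite_supp G_def)
      also have "\<dots> = \<tau> \<mu> * (\<Sum>n\<in>G. D n * of_int (wall_root (kk n) n \<mu>))" by (simp only: sum_distrib_left)
      finally show ?thesis using \<tau> by (simp add: torus_def)
    qed
    have kk_N: "kk N = k" by (simp add: kk_def u_def)
    then have NG: "N \<in> G" using N k by (simp add: G_def u_def)
    have G: "wt n = \<tau>" "n \<in> idx" "cnt n = cnt N" "n \<noteq> 0" if "n \<in> G" for n
    proof -
      show "cnt n = cnt N" using that cnt_u by (auto simp: G_def good_def)
      then show "n \<noteq> 0" using cnt_N by (auto simp: cnt_def)
    qed (use that wt idx in \<open>auto simp: G_def\<close>)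
    have G_sign: "n = n'" if "n \<in> G" "n' \<in> G" "n > 0 \<longleftrightarrow> n' > 0" for n n'
      using stab_cnt_unique[of n n'] G[OF that(1)] G[OF that(2)] that(3) by simp
    show False
    proof (cases "G = {N}")
      case True
      \<comment> \<open>The coroot of the wall, at which its root is 2.\<close>
      define \<mu> where "\<mu> = ch N (inv_into UNIV (ch k) (\<alpha>v (wall_label k)))"
      have "wall_root k N \<mu> = 2"
        by (simp add: wall_root_def \<mu>_def W_inv_f_f W_f_inv_f)
      then show False using rel[of \<mu>] D[OF NG] by (simp add: True kk_N)
    next
      case False
      then obtain N' where N': "N' \<in> G" "N' \<noteq> N" using NG by blast
      have opposite: "(N > 0) \<noteq> (N' > 0)" using G_sign[OF NG N'(1)] N'(2) by blast
      have G_eq: "G = {N, N'}"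
      proof (intro equalityI subsetI)
        fix n assume "n \<in> G"
        then show "n \<in> {N, N'}" using G_sign[OF _ NG, of n] G_sign[OF _ N'(1), of n] opposite by blast
      qed (use NG N' in auto)
      define k' where "k' = kk N'"
      have u': "2 * k' - 1 - N' = u" using N' by (simp add: G_def k'_def)
      let ?v = "ch k \<circ> inv_into UNIV (ch N)" and ?v' = "ch k' \<circ> inv_into UNIV (ch N')"
      define S S' where S: "S = inv_into UNIV ?v \<circ> refl (wall_label k) \<circ> ?v"
        "S' = inv_into UNIV ?v' \<circ> refl (wall_label k') \<circ> ?v'"
      have s: "S \<circ> ch N = ch u" "S' \<circ> ch N' = ch u"
        unfolding S wall_conj_ch(2) u' u_def by (rule HOL.refl)+
      \<comment> \<open>Both reflections lead to the same chamber \<open>u\<close>, so equality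
        would identify \<open>N\<close> and \<open>N'\<close>. Different reflections have
        nonproportional roots, which breaks the two-term relation.\<close>
      have "S \<noteq> S'"
      proof
        assume eq: "S = S'"
        have "inj S" unfolding S(1)
          by (intro inj_compose bij_is_inj W_subset_bij W_inv wall_conj_ch(1)) simp
        then have "ch N y = ch N' y" for y
          using injD[of S "ch N y" "ch N' y"] fun_cong[OF s(1), of y] fun_cong[OF s(2), of y] eq by simp
        then have "ch N = ch N'" by blast
        then show False using inj_onD[OF inj_on_ch_idx _ G(2)[OF NG] G(2)[OF N'(1)]] N'(2) by blast
      qed
      then have "inv_into UNIV ?v \<circ> refl (wall_label k) \<circ> ?v \<noteq> inv_into UNIV ?v' \<circ> refl (wall_label k') \<circ> ?v'"
        unfolding S .
      then obtain \<nu> where "pairing (\<alpha> (wall_label k')) (?v' \<nu>) = 0" "pairing (\<alpha> (wall_label k)) (?v \<nu>) \<noteq> 0"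
        by (rule ex_separating_coweight[OF wall_conj_ch(1) wall_conj_ch(1)])
      then have "wall_root k' N' \<nu> = 0" "wall_root k N \<nu> \<noteq> 0" by (simp_all add: wall_root_def)
      then show False using rel[of \<nu>] D[OF NG] N'(2) by (simp add: G_eq kk_N k'_def)
    qed
  qed
  then have "(\<Sum>n\<in>supp x. scl (\<phi> n x) (gv n)) = scl (\<phi> 0 x) 1"
    using idx0 by (cases "0 \<in> supp x") (auto simp: subset_singleton_iff supp_def)
  then show ?thesis using \<phi>_expand[of x] that[of "\<phi> 0 x"] by simp
qed

lemma maximal: "maximal \<tau>"
  unfolding maximal_def
proof (intro allI impI)
  fix L assume L: "left_ideal L \<and> J \<tau> \<subseteq> L"
  show "L = J \<tau> \<or> L = UNIV"
  proof (cases "L \<subseteq> J \<tau>")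
    case False
    obtain w x where "w \<in> W" "x \<in> L" "x \<notin> J \<tau>" "weight_vector \<tau> (torus_act w \<tau>) x"
      using L False by (metis ex_weight_vector[OF \<tau>])
    then obtain y where y: "y \<in> L" "y \<notin> J \<tau>" "weight_vector \<tau> \<tau> y"
      using L by (metis weight_vector_transport)
    obtain c where c: "y - scl c 1 \<in> J \<tau>" using y(3) by (rule weight_vector_scalar)
    have "c \<noteq> 0" using c y(2) by auto
    have "y - (y - scl c 1) \<in> L" by (rule left_ideal_diff) (use L c y(1) in auto)
    then have "scl c 1 \<in> L" by simp
    then have "scl (1 / c) (scl c 1) \<in> L" using L by (blast intro: left_ideal_scl)
    then have "1 \<in> L" using \<open>c \<noteq> 0\<close> by simp
    then show ?thesis using L left_ideal_UNIV_iff by blast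
  qed (use L in blast)
qed

end

theorem theorem5p35:
  fixes A :: "'i::finite \<Rightarrow> 'i \<Rightarrow> int"
    and pairing :: "'x::finite_free_ab_group \<Rightarrow> 'y::finite_free_ab_group \<Rightarrow> int"
    and \<alpha> :: "'i \<Rightarrow> 'x" and \<alpha>v :: "'i \<Rightarrow> 'y"
    and \<sigma> \<sigma>' :: "'i \<Rightarrow> complex"
    and scl :: "complex \<Rightarrow> 'h::ring_1 \<Rightarrow> 'h"
    and ZH :: "'y \<Rightarrow> ('y \<Rightarrow> 'y) \<Rightarrow> 'h"
    and \<tau> :: "'y \<Rightarrow> complex"
  assumes "BL_Hecke_algebra A pairing \<alpha> \<alpha>v \<sigma> \<sigma>' scl ZH"
    and "card (UNIV :: 'i set) = 2"
    and "\<tau> \<in> torus"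
  shows "irreducible_module (BL_Hecke_algebra.I_carrier scl ZH \<tau>) (BL_Hecke_algebra.I_act scl ZH \<tau>) \<longleftrightarrow>
      \<tau> \<in> hecke_parameters.U_set pairing \<alpha> \<alpha>v \<sigma> \<sigma>' \<and>
      root_generating_system.W_stab pairing \<alpha> \<alpha>v \<tau> = hecke_parameters.W_paren pairing \<alpha> \<alpha>v \<sigma> \<sigma>' \<tau>"
proof -
  obtain a b :: 'i where ab: "UNIV = {a, b}" "a \<noteq> b" using assms(2) by (auto simp: card_2_iff)
  interpret BL_Hecke_algebra A pairing \<alpha> \<alpha>v \<sigma> \<sigma>' scl ZH by (rule assms(1))
  interpret rank_two_principal A pairing \<alpha> \<alpha>v \<sigma> \<sigma>' scl ZH a b \<tau>
    by unfold_locales (use ab assms(3) in auto)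
  show ?thesis
  proof
    assume "irreducible_module (I_carrier \<tau>) (I_act \<tau>)"
    then have max: "maximal \<tau>" by (simp only: irreducible_iff_maximal[OF \<tau>])
    show "\<tau> \<in> U_set \<and> W_stab \<tau> = W_paren \<tau>"
      using maximal_imp_U_set[OF \<tau> max] maximal_imp_W_stab[OF max] by blast
  next
    assume *: "\<tau> \<in> U_set \<and> W_stab \<tau> = W_paren \<tau>"
    interpret rank_two_criterion A pairing \<alpha> \<alpha>v \<sigma> \<sigma>' scl ZH a b \<tau>
      by unfold_locales (use * in auto)
    show "irreducible_module (I_carrier \<tau>) (I_act \<tau>)"
      unfolding irreducible_iff_maximal[OF \<tau>] by (rule maximal)
  qed
qed

end
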